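(* Let $n\ge 2$, $1\le k \le n-1$, $\sigma=(n-k)/2 -1$, $\rho=(k-1)/2$, and let $P^{(\sigma,\rho)}_{m}$ denote the Jacobi polynomial of degree $m$. Let $R_t$ be the shifted Funk-Radon transform on $S^n$ associated with $k$-dimensional totally geodesic submanifolds. (i) For fixed $t\in (0,\pi/2)$, the operator $R_t$ is injective on $L^1_{even} (S^n)$ if and only if $P^{(\sigma,\rho)}_{j/2} (\cos 2 t)\neq 0$ for all $j\in \{0,2,4, \ldots\}$. (ii) More generally, given a positive integer $\ell$ and $t_1,\ldots,t_\ell\in(0,\pi/2)$, let $f\in L^1_{even} (S^n)$ and suppose that $R_{t_i} f=0$ a.e. for all $i=1,2,\ldots, \ell$. If the equations $$P^{(\sigma,\rho)}_{j/2} (\cos 2 t_i)= 0, \qquad i=1,2,\ldots, \ell,$$ have no common solution $j\in \{0,2, 4,\ldots\}$, then $f=0$ a.e. on $S^n$. If these equations have a common solution, say $j=j_0\in\{0,2,4,\ldots\}$, then $R_{t_i} Y_{j_0}=0$ for all $i=1,2,\ldots, \ell$ and all spherical harmonics $Y_{j_0}$ of degree $j_0$ on $S^n$.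
   Context: $S^n$ is the unit sphere in $\mathbb{R}^{n+1}$, $n\ge2$, with coordinate unit vectors $e_1,\dots,e_{n+1}$; $L^1_{even}(S^n)$ is the space of (classes of) integrable functions $f$ on $S^n$ with $f(-x)=f(x)$ a.e. $V_{n+1,n-k}$ is the Stiefel manifold of real $(n+1)\times(n-k)$ matrices $v$ with $v^Tv=I_{n-k}$, with its invariant probability measure. $\Xi$ is the set of all $k$-dimensional totally geodesic submanifolds $\xi$ of $S^n$; each has the form $\xi=S^n\cap v^\perp$ with $v\in V_{n+1,n-k}$, where $v^\perp$ is the $(k+1)$-dimensional linear subspace orthogonal to the columns of $v$. $\Xi$ carries its $O(n+1)$-invariant probability measure, and functions on $\Xi$ are identified with right $O(n-k)$-invariant functions on $V_{n+1,n-k}$. Shifted Funk-Radon transform: write $\mathbb{R}^{n+1}=\mathbb{R}^{k+1}\times\mathbb{R}^{n-k}$ with $\mathbb{R}^{k+1}=\mathrm{span}(e_1,\dots,e_{k+1})$, $\mathbb{R}^{n-k}=\mathrm{span}(e_{k+2},\dots,e_{n+1})$, let $S^k$, $S^{n-k-1}$ be the unit spheres in these subspaces with normalized (probability) surface measures $d_*\eta$, $d_*\zeta$ ($S^0=\{\pm1\}$ with mass $1/2$ at each point). Let $v_0=\begin{bmatrix}0\\ I_{n-k}\end{bmatrix}\in V_{n+1,n-k}$, and for $v\in V_{n+1,n-k}$ let $r_v\in O(n+1)$ be any map with $r_vv_0=v$. Then for $\xi=S^n\cap v^\perp$, $$(R_tf)(\xi)=\int_{S^{n-k-1}}d_*\zeta\int_{S^k}f\big(r_v(\eta\cos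 t+\zeta\sin t)\big)\,d_*\eta .$$ This is the average of $f$ over the points of $S^n$ at geodesic distance $t$ from $\xi$. Spherical harmonics of degree $j$ on $S^n$ are restrictions to $S^n$ of harmonic homogeneous polynomials of degree $j$ on $\mathbb{R}^{n+1}$. *)

theory Defs
  imports "HOL-Probability.Probability"
begin

text \<open>
  Throughout, \<open>CARD('p) = k + 1\<close> and \<open>CARD('q) = n - k\<close>, so that \<^typ>\<open>real^('p+'q)\<close> is
  \<open>\<real>\<^sup>n\<^sup>+\<^sup>1 = \<real>\<^sup>k\<^sup>+\<^sup>1 \<times> \<real>\<^sup>n\<^sup>-\<^sup>k\<close>; the index summands play the role of the coordinates
  \<open>1, \<dots>, k + 1\<close> and \<open>k + 2, \<dots>, n + 1\<close>.
\<close>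

text \<open>
  Normalized surface measure of the unit sphere: a set \<open>A\<close> gets the relative volume, in the unit
  ball, of the cone \<open>{r x | x \<in> A, 0 < r < 1}\<close>. In dimension 1 it is mass 1/2 at each of \<open>1, -1\<close>.
\<close>

definition sphere_measure :: "'a::euclidean_space measure" where
  "sphere_measure =
     restrict_space (distr (uniform_measure lborel (ball 0 1)) borel sgn) (sphere 0 1)"

text \<open>Representatives of the classes in \<open>L\<^sup>1\<^sub>e\<^sub>v\<^sub>e\<^sub>n\<close>; only the values on the unit sphere matter.\<close>

definition L1_even :: "('a::euclidean_space \<Rightarrow> real) set" where
  "L1_even = {f. integrable sphere_measure f \<and> (AE x in sphere_measure. f (- x) = f x)}"

definition stiefel :: "(real^'q^('p::finite+'q::finite)) set" where
  "stiefel = {v. transpose v ** v = mat 1}"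

definition great_subsphere :: "real^'q^('p::finite+'q::finite) \<Rightarrow> (real^('p+'q)) set" where
  "great_subsphere v = sphere 0 1 \<inter> orthogonal_comp (columns v)"

definition Xi :: "(real^('p::finite+'q::finite)) set set" where
  "Xi = great_subsphere ` (stiefel :: (real^'q^('p+'q)) set)"

text \<open>
  The quotient measurable structure: a function on \<^term>\<open>Xi\<close> is measurable iff the corresponding
  right-invariant function on the Stiefel manifold is Borel.
\<close>

definition Xi_space :: "(real^('p::finite+'q::finite)) set measure" where
  "Xi_space = sigma Xi {A. A \<subseteq> Xi \<and>
     {v \<in> stiefel :: (real^'q^('p+'q)) set. great_subsphere v \<in> A} \<in> sets borel}"

text \<open>
  The conditions characterizing the invariant probability measure on \<^term>\<open>Xi\<close>. It exists and is
  unique because the compact group \<open>O(n+1)\<close> acts transitively on \<^term>\<open>Xi\<close>.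
\<close>

definition invariant_prob_Xi :: "(real^('p::finite+'q::finite)) set measure \<Rightarrow> bool" where
  "invariant_prob_Xi \<mu> \<longleftrightarrow>
     prob_space \<mu> \<and> space \<mu> = Xi \<and> sets \<mu> = sets Xi_space \<and>
     (\<forall>\<gamma>. orthogonal_matrix \<gamma> \<longrightarrow> distr \<mu> \<mu> (\<lambda>\<xi>. (\<lambda>x. \<gamma> *v x) ` \<xi>) = \<mu>)"

definition v0 :: "real^'q^('p::finite+'q::finite)" where
  "v0 = (\<chi> i j. case i of Inl _ \<Rightarrow> 0 | Inr i' \<Rightarrow> if i' = j then 1 else 0)"

definition join_vec :: "real^'p \<Rightarrow> real^'q \<Rightarrow> real^('p::finite+'q::finite)" where
  "join_vec a b = (\<chi> i. case i of Inl i' \<Rightarrow> a $ i' | Inr i' \<Rightarrow> b $ i')"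

text \<open>
  The value does not depend on the choice of \<open>v\<close> with \<open>\<xi> = S\<^sup>n \<inter> v\<^sup>\<bottom>\<close> and of \<open>r\<close>,
  since any two choices of \<open>r\<close> differ by an element of \<open>O(k+1) \<times> O(n-k)\<close>.
\<close>

definition funk_radon ::
    "real \<Rightarrow> (real^('p::finite+'q::finite) \<Rightarrow> real) \<Rightarrow> (real^('p+'q)) set \<Rightarrow> real" where
  "funk_radon t f \<xi> =
     (let v = (SOME v :: real^'q^('p+'q). v \<in> stiefel \<and> \<xi> = great_subsphere v);
          r = (SOME r. orthogonal_matrix r \<and> r ** v0 = v)
      in \<integral>\<zeta>. (\<integral>\<eta>. f (r *v join_vec (cos t *\<^sub>R \<eta>) (sin t *\<^sub>R \<zeta>)) \<partial>sphere_measure) \<partial>sphere_measure)"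

text \<open>
  The explicit sum for the Jacobi polynomial \<open>P\<^sub>m\<close> with parameters \<open>(\<alpha>, \<beta>)\<close> in the
  standard normalization (Szego, Orthogonal Polynomials, (4.3.2)), whose value at 1 is
  \<open>(m + \<alpha>) gchoose m\<close>.
\<close>

definition jacobi :: "real \<Rightarrow> real \<Rightarrow> nat \<Rightarrow> real \<Rightarrow> real" where
  "jacobi \<alpha> \<beta> m x =
     (\<Sum>s\<le>m. ((real m + \<alpha>) gchoose (m - s)) * ((real m + \<beta>) gchoose s) *
            ((x - 1) / 2) ^ s * ((x + 1) / 2) ^ (m - s))"

definition laplacian :: "('a::euclidean_space \<Rightarrow> real) \<Rightarrow> 'a \<Rightarrow> real" where
  "laplacian p x = (\<Sum>b\<in>Basis. (deriv ^^ 2) (\<lambda>s. p (x + s *\<^sub>R b)) 0)"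

definition spherical_harmonic :: "nat \<Rightarrow> ('a::euclidean_space \<Rightarrow> real) \<Rightarrow> bool" where
  "spherical_harmonic j Y \<longleftrightarrow>
     (\<exists>p. real_polynomial_function p \<and> (\<forall>c x. p (c *\<^sub>R x) = c ^ j * p x) \<and>
          (\<forall>x. laplacian p x = 0) \<and> (\<forall>x\<in>sphere 0 1. Y x = p x))"

end

theory Submission
  imports Defs
begin

text \<open>
  Let \<open>\<xi>\<close> be a great subsphere and \<open>P\<close> the orthogonal projection onto its normal space. For a uniform random
  point \<open>x\<close> of the sphere, \<open>cos t \<cdot> sgn (x - P x) + sin t \<cdot> sgn (P x)\<close> is a uniform random point at distance \<open>t\<close>
  from \<open>\<xi>\<close>, so the transform of \<open>f\<close> at \<open>\<xi>\<close> is the expectation of \<open>f\<close> at this point (\<open>funk_radon_latitude\<close>).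

  \<^emph>\<open>Harmonics.\<close> Write \<open>J\<^sub>m\<close> for the Jacobi polynomial of degree \<open>m\<close>. The average of a harmonic form of degree \<open>2 m\<close> over the points at distance \<open>t\<close> from \<open>\<xi>\<close> is a
  form in \<open>cos\<^sup>2 t\<close> and \<open>sin\<^sup>2 t\<close>. Harmonicity gives a two-term recurrence for its coefficients, which has the
  coefficients of the Jacobi polynomial at \<open>cos (2 t)\<close> as its solution. So the average is a multiple of
  \<open>J\<^sub>m (cos (2 t))\<close>, where the factor does not depend on \<open>t\<close> (\<open>harmonic_latitude_mean_proj\<close>). If \<open>J\<^sub>m (cos (2 t))\<close>
  vanishes, the transform annihilates all spherical harmonics of degree \<open>2 m\<close>, and it is not injective.

  \<^emph>\<open>Duality.\<close> Conversely, write \<open>d(y, \<xi>)\<close> for the distance and \<open>Z\<^sub>m\<close> for the zonal harmonic of degree \<open>2 m\<close>. For all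
  integrable \<open>f\<close> and all points \<open>y\<close>,

    \<open>\<integral> R\<^sub>t f(\<xi>) J\<^sub>m (cos (2 d(y, \<xi>))) d\<mu>(\<xi>) = J\<^sub>m (cos (2 t)) \<integral> f(x) Z\<^sub>m (x \<bullet> y) dx\<close>    (\<open>duality_L1\<close>).

  Here \<open>y \<mapsto> J\<^sub>m (cos (2 d(y, \<xi>)))\<close> is itself a spherical harmonic. Only the invariance of the joint law of the
  subsphere \<open>\<xi>\<close> and the point at distance \<open>t\<close> is used: for a function of \<open>x \<bullet> z\<close> in place of \<open>f\<close>, the left-hand
  side is unchanged by rotations of \<open>y\<close> about \<open>z\<close>, and averaging the harmonic over these rotations yields the
  zonal harmonic with pole \<open>z\<close>, by the first part for a line in place of \<open>\<xi>\<close>. Kernels that concentrate at \<open>z\<close>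
  then give the formula for continuous \<open>f\<close>.

  \<^emph>\<open>Completeness.\<close> If the transforms of an even \<open>f\<close> vanish for some distances, and for every \<open>m\<close> one of these has
  \<open>J\<^sub>m (cos (2 t)) \<noteq> 0\<close>, then \<open>f\<close> is orthogonal to all \<open>Z\<^sub>m (x \<bullet> y)\<close>. These span the even powers of \<open>x \<bullet> y\<close>, and the
  odd powers are orthogonal to \<open>f\<close> because \<open>f\<close> is even. So \<open>f\<close> is orthogonal to the kernels \<open>((1 + x \<bullet> y) / 2)\<^sup>N\<close>, which form
  an approximate identity, and \<open>f\<close> vanishes almost everywhere (\<open>zonal_orthogonal_imp_zero\<close>).
\<close>

section \<open>The surface measure\<close>

text \<open>
  Two translation invariant measures are proportional: in the double integral of
  \<open>1\<^sub>A(x) 1\<^sub>B(y)\<close>, first \<open>x\<close> is translated by \<open>y\<close> and then \<open>y\<close> by \<open>-x\<close>, which exchanges the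
  roles of the two measures. Taking for \<open>B\<close> the unit ball, an isometry gives the factor 1.
\<close>

lemma lborel_distr_linear_isometry:
  fixes T :: "'a::euclidean_space \<Rightarrow> 'b::euclidean_space"
  assumes T: "linear T" "\<And>x. norm (T x) = norm x" "surj T"
  shows "distr lborel borel T = lborel"
proof -
  have inj: "inj T"
    using T(1,2) by (metis linear_injective_0 norm_eq_zero)
  have dim: "DIM('a) = DIM('b)"
    using inj T by (metis dim_UNIV dim_image_eq inj_on_subset subset_UNIV)
  have [measurable]: "T \<in> borel \<rightarrow>\<^sub>M borel"
    using T(1) linear_conv_bounded_linear linear_continuous_on borel_measurable_continuous_onI by blast
  let ?N = "distr lborel borel T"
  have trans: "(\<integral>\<^sup>+x. f (x + c) \<partial>?N) = (\<integral>\<^sup>+x. f x \<partial>?N)" if [measurable]: "f \<in> borel_measurable borel" for f c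
  proof -
    obtain d where d: "T d = c" using T(3) by (metis surjD)
    have "(\<integral>\<^sup>+x. f (x + c) \<partial>?N) = (\<integral>\<^sup>+x. f (T (d + x)) \<partial>lborel)"
      by (subst nn_integral_distr) (auto simp: linear_add[OF T(1)] d add.commute)
    also have "\<dots> = (\<integral>\<^sup>+x. f (T x) \<partial>distr lborel borel ((+) d))"
      by (subst nn_integral_distr) auto
    also have "\<dots> = (\<integral>\<^sup>+x. f x \<partial>?N)"
      by (subst nn_integral_distr) (auto simp: lborel_distr_plus)
    finally show ?thesis .
  qed
  have transL: "(\<integral>\<^sup>+x. f (x + c) \<partial>lborel) = (\<integral>\<^sup>+x. f x \<partial>lborel)"
    if [measurable]: "f \<in> borel_measurable borel" for f and c :: 'b
  proof -
    have "(\<integral>\<^sup>+x. f (x + c) \<partial>lborel) = (\<integral>\<^sup>+x. f x \<partial>distr lborel borel ((+) c))"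
      by (subst nn_integral_distr) (auto simp: add.commute)
    then show ?thesis by (simp add: lborel_distr_plus)
  qed
  define B where "B = ball (0::'b) 1"
  have [measurable]: "B \<in> sets borel" by (simp add: B_def)
  have sfN: "sigma_finite_measure ?N"
  proof
    show "\<exists>A. countable A \<and> A \<subseteq> sets ?N \<and> \<Union> A = space ?N \<and> (\<forall>a\<in>A. emeasure ?N a \<noteq> \<infinity>)"
    proof (intro exI[of _ "range (\<lambda>n::nat. ball 0 (real n))"] conjI ballI)
      show "\<Union> (range (\<lambda>n::nat. ball (0::'b) (real n))) = space ?N"
        using reals_Archimedean2 by auto
      fix A assume "A \<in> range (\<lambda>n::nat. ball (0::'b) (real n))"
      then obtain n :: nat where A: "A = ball 0 (real n)" by auto
      have "emeasure ?N A = emeasure lborel (ball (0::'a) (real n))"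
        unfolding A by (subst emeasure_distr) (auto simp: T vimage_def intro!: arg_cong[where f="emeasure lborel"])
      then show "emeasure ?N A \<noteq> \<infinity>" using emeasure_lborel_ball_finite[of "0::'a" n] by auto
    qed auto
  qed
  interpret N: sigma_finite_measure ?N by (rule sfN)
  interpret P: pair_sigma_finite ?N "lborel :: 'b measure" ..
  have NB: "emeasure ?N B = emeasure lborel B"
  proof -
    have "emeasure ?N B = emeasure lborel (ball (0::'a) 1)"
      unfolding B_def by (subst emeasure_distr) (auto simp: T vimage_def intro!: arg_cong[where f="emeasure lborel"])
    also have "\<dots> = emeasure lborel B" unfolding B_def by (simp add: emeasure_ball dim)
    finally show ?thesis .
  qed
  have key: "emeasure ?N A * emeasure lborel B = emeasure lborel A * emeasure ?N B" if [measurable]: "A \<in> sets borel" for A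
  proof -
    have "emeasure ?N A * emeasure lborel B = (\<integral>\<^sup>+y. \<integral>\<^sup>+x. indicator A x * indicator B y \<partial>?N \<partial>lborel)"
      by (simp add: nn_integral_multc nn_integral_cmult)
    also have "\<dots> = (\<integral>\<^sup>+y. \<integral>\<^sup>+x. indicator A (x + y) * indicator B y \<partial>?N \<partial>lborel)"
    proof (rule nn_integral_cong)
      fix y :: 'b
      show "(\<integral>\<^sup>+x. indicator A x * indicator B y \<partial>?N) = (\<integral>\<^sup>+x. indicator A (x + y) * indicator B y \<partial>?N)"
        using trans[of "\<lambda>x. indicator A x * indicator B y" y] by simp
    qed
    also have "\<dots> = (\<integral>\<^sup>+x. \<integral>\<^sup>+y. indicator A (x + y) * indicator B y \<partial>lborel \<partial>?N)"
      by (rule P.Fubini') measurable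
    also have "\<dots> = (\<integral>\<^sup>+x. \<integral>\<^sup>+y. indicator A y * indicator B (y - x) \<partial>lborel \<partial>?N)"
    proof (rule nn_integral_cong)
      fix x :: 'b
      show "(\<integral>\<^sup>+y. indicator A (x + y) * indicator B y \<partial>lborel) = (\<integral>\<^sup>+y. indicator A y * indicator B (y - x) \<partial>lborel)"
        using transL[of "\<lambda>y. indicator A y * indicator B (y - x)" x] by (simp add: add.commute)
    qed
    also have "\<dots> = (\<integral>\<^sup>+y. \<integral>\<^sup>+x. indicator A y * indicator B (y - x) \<partial>?N \<partial>lborel)"
      by (rule P.Fubini'[symmetric]) measurable
    also have "\<dots> = (\<integral>\<^sup>+y. \<integral>\<^sup>+x. indicator A y * indicator B (- x) \<partial>?N \<partial>lborel)"
    proof (rule nn_integral_cong)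
      fix y :: 'b
      show "(\<integral>\<^sup>+x. indicator A y * indicator B (y - x) \<partial>?N) = (\<integral>\<^sup>+x. indicator A y * indicator B (- x) \<partial>?N)"
        using trans[of "\<lambda>x. indicator A y * indicator B (y - x)" y] by simp
    qed
    also have "\<dots> = (\<integral>\<^sup>+y. \<integral>\<^sup>+x. indicator A y * indicator B x \<partial>?N \<partial>lborel)"
      by (simp add: B_def indicator_def)
    also have "\<dots> = emeasure lborel A * emeasure ?N B"
      by (simp add: nn_integral_multc nn_integral_cmult)
    finally show ?thesis .
  qed
  show ?thesis
  proof (rule measure_eqI)
    fix A assume "A \<in> sets ?N"
    then have "emeasure lborel B * emeasure ?N A = emeasure lborel B * emeasure lborel A"
      using key[of A] NB by (simp add: mult.commute)
    moreover have "emeasure lborel B \<noteq> 0" "emeasure lborel B \<noteq> \<infinity>"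
      using emeasure_lborel_ball_finite[of "0::'b" 1] unit_ball_vol_pos[of "real DIM('b)"]
      by (auto simp: B_def emeasure_ball simp del: unit_ball_vol_pos)
    ultimately show "emeasure ?N A = emeasure lborel A"
      by (simp add: ennreal_mult_cancel_left)
  qed simp
qed

abbreviation usphere :: "'a::euclidean_space set" where "usphere \<equiv> sphere 0 1"

lemma sets_sphere_measure [measurable_cong]:
  "sets (sphere_measure :: 'a::euclidean_space measure) = sets (restrict_space borel usphere)"
  unfolding sphere_measure_def by (rule sets_restrict_space_cong) simp

lemma space_sphere_measure [simp]: "space (sphere_measure :: 'a::euclidean_space measure) = usphere"
  by (simp add: sphere_measure_def space_restrict_space)

lemma measurable_ident_sphere_measure: "(\<lambda>x. x) \<in> sphere_measure \<rightarrow>\<^sub>M borel"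
  by (simp add: measurable_cong_sets[OF sets_sphere_measure refl] measurable_restrict_space1)

lemma sets_sphere_measure_iff:
  "A \<in> sets (sphere_measure :: 'a::euclidean_space measure) \<longleftrightarrow> A \<in> sets borel \<and> A \<subseteq> usphere"
  by (auto simp: sets_sphere_measure sets_restrict_space_iff)

lemma ball_lborel_pos: "emeasure lborel (ball (0::'a::euclidean_space) 1) \<noteq> 0"
  "emeasure lborel (ball (0::'a::euclidean_space) 1) \<noteq> \<infinity>"
  using emeasure_lborel_ball_finite[of "0::'a" 1] unit_ball_vol_pos[of "real DIM('a)"]
  by (auto simp: emeasure_ball simp del: unit_ball_vol_pos)

lemma emeasure_sphere_measure:
  assumes "A \<in> sets borel" "A \<subseteq> usphere"
  shows "emeasure (sphere_measure :: 'a::euclidean_space measure) A =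
     emeasure lborel (ball 0 1 \<inter> sgn -` A) / emeasure lborel (ball (0::'a) 1)"
proof -
  have "emeasure (sphere_measure :: 'a measure) A
     = emeasure (distr (uniform_measure lborel (ball 0 1)) borel sgn) A"
    unfolding sphere_measure_def using assms by (subst emeasure_restrict_space) auto
  also have "\<dots> = emeasure (uniform_measure lborel (ball 0 1)) (sgn -` A)"
    using assms(1) by (subst emeasure_distr) auto
  finally show ?thesis using assms(1)
    using measurable_sets[OF borel_measurable_sgn assms(1)]
    by (simp add: Int_commute)
qed

lemma prob_space_sphere_measure: "prob_space (sphere_measure :: 'a::euclidean_space measure)"
proof
  have "emeasure (sphere_measure :: 'a measure) usphere
      = emeasure lborel (ball (0::'a) 1 \<inter> sgn -` usphere) / emeasure lborel (ball (0::'a) 1)"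
    by (intro emeasure_sphere_measure) auto
  also have "ball 0 1 \<inter> sgn -` usphere = ball 0 1 - {0::'a}"
    by (auto simp: norm_sgn)
  also have "emeasure lborel (ball 0 1 - {0::'a}) = emeasure lborel (ball (0::'a) 1)"
    by (rule emeasure_Diff_null_set) auto
  finally show "emeasure (sphere_measure :: 'a measure) (space sphere_measure) = 1"
    using ball_lborel_pos[where 'a='a] by (simp add: ennreal_divide_self less_top)
qed

lemma sgn_linear_isometry:
  fixes T :: "'a::euclidean_space \<Rightarrow> 'b::euclidean_space"
  assumes "linear T" "\<And>x. norm (T x) = norm x"
  shows "sgn (T x) = T (sgn x)"
  using assms by (simp add: sgn_div_norm linear_cmul)

text \<open>
  An isometry commutes with \<open>sgn\<close>, so the invariance comes from that of Lebesgue measure.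
\<close>

lemma distr_sphere_measure_isometry:
  fixes T :: "'a::euclidean_space \<Rightarrow> 'b::euclidean_space"
  assumes T: "linear T" "\<And>x. norm (T x) = norm x" "surj T"
  shows "distr sphere_measure sphere_measure T = sphere_measure"
proof (rule measure_eqI)
  have Tm[measurable]: "T \<in> borel \<rightarrow>\<^sub>M borel"
    using T(1) linear_conv_bounded_linear linear_continuous_on borel_measurable_continuous_onI by blast
  have Ts: "T \<in> sphere_measure \<rightarrow>\<^sub>M sphere_measure"
    unfolding measurable_cong_sets[OF sets_sphere_measure sets_sphere_measure]
    by (rule measurable_restrict_space3) (auto simp: T)
  have lb: "emeasure lborel (T -` C) = emeasure lborel C" if "C \<in> sets borel" for C
    using emeasure_distr[of T lborel borel C] lborel_distr_linear_isometry[OF T] that by auto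
  have b: "emeasure lborel (ball (0::'a) 1) = emeasure lborel (ball (0::'b) 1)"
    using lb[of "ball 0 1"] by (auto simp: T vimage_def ball_def)
  fix A assume "A \<in> sets (distr sphere_measure sphere_measure T)"
  then have A: "A \<in> sets borel" "A \<subseteq> usphere" by (auto simp: sets_sphere_measure_iff)
  have sA: "sgn -` A \<in> sets borel" using measurable_sets[OF borel_measurable_sgn A(1)] by simp
  have "emeasure (distr sphere_measure sphere_measure T) A = emeasure sphere_measure (T -` A)"
    using A Ts by (subst emeasure_distr) (auto simp: sets_sphere_measure_iff T intro!: arg_cong[where f="emeasure _"])
  also have "\<dots> = emeasure lborel (ball 0 1 \<inter> sgn -` (T -` A)) / emeasure lborel (ball (0::'a) 1)"
    using A measurable_sets[OF Tm A(1)] by (intro emeasure_sphere_measure) (auto simp: T(2)[symmetric])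
  also have "ball 0 1 \<inter> sgn -` (T -` A) = T -` (ball 0 1 \<inter> sgn -` A)"
    by (auto simp: sgn_linear_isometry[OF T(1,2)] T)
  also have "emeasure lborel \<dots> = emeasure lborel (ball 0 1 \<inter> sgn -` A)"
    using sA by (intro lb) auto
  finally show "emeasure (distr sphere_measure sphere_measure T) A = emeasure sphere_measure A"
    using A by (simp add: emeasure_sphere_measure b)
qed simp

lemma sphere_measure_hyperplane_null:
  assumes "a \<noteq> 0"
  shows "AE x in sphere_measure. a \<bullet> (x::'a::euclidean_space) \<noteq> 0"
proof (rule AE_I)
  let ?N = "{x\<in>usphere. a \<bullet> x = 0}"
  have cl: "closed {x. a \<bullet> x = 0}" by (rule closed_hyperplane)
  have "?N = usphere \<inter> {x. a \<bullet> x = 0}" by auto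
  then have bor: "?N \<in> sets borel" using cl by auto
  then show "?N \<in> sets sphere_measure" by (auto simp: sets_sphere_measure_iff)
  have "{x. a \<bullet> x = 0} \<in> null_sets lborel"
    using negligible_hyperplane[of a 0] assms cl
    by (auto simp: negligible_iff_null_sets null_sets_completion_iff)
  moreover have "ball 0 1 \<inter> sgn -` ?N \<subseteq> {x. a \<bullet> x = 0}"
    by (auto simp: sgn_div_norm)
  moreover have "ball 0 1 \<inter> sgn -` ?N \<in> sets lborel"
    using measurable_sets[OF borel_measurable_sgn bor] by simp
  ultimately have "emeasure lborel (ball 0 1 \<inter> sgn -` ?N) = 0"
    by (meson null_setsD1 null_sets_subset)
  then show "emeasure sphere_measure ?N = 0"
    using bor by (subst emeasure_sphere_measure) auto
qed auto

lemma sphere_measure_open_pos: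
  assumes "open U" "x \<in> U" "norm (x::'a::euclidean_space) = 1"
  shows "0 < measure sphere_measure (U \<inter> usphere)"
proof -
  interpret prob_space "sphere_measure :: 'a measure" by (rule prob_space_sphere_measure)
  let ?V = "ball 0 1 \<inter> {y. y \<noteq> 0 \<and> sgn y \<in> U}"
  have "{y. y \<noteq> 0 \<and> sgn y \<in> U} = sgn -` U \<inter> - {0}" by auto
  moreover have "open (sgn -` U \<inter> - {0::'a})"
    using continuous_on_open_vimage[of "- {0::'a}" sgn] assms(1) continuous_on_sgn[OF continuous_on_id, of "- {0::'a}"]
    by auto
  ultimately have op: "open ?V" by auto
  have "sgn x = x" using assms by (simp add: sgn_div_norm)
  then have "(1/2) *\<^sub>R x \<in> ?V" using assms by (auto simp: sgn_scaleR sgn_real_def)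
  then have "\<not> negligible ?V" using open_not_negligible[OF op] by blast
  then have pos: "emeasure lborel ?V \<noteq> 0"
    using op by (auto simp: negligible_iff_null_sets null_sets_completion_iff)
  have "?V \<subseteq> ball 0 1 \<inter> sgn -` (U \<inter> usphere)" by (auto simp: norm_sgn)
  moreover have "U \<inter> usphere \<in> sets borel" using assms by auto
  moreover have "ball 0 1 \<inter> sgn -` (U \<inter> usphere) \<in> sets lborel"
    using measurable_sets[OF borel_measurable_sgn \<open>U \<inter> usphere \<in> sets borel\<close>] by simp
  ultimately have "emeasure sphere_measure (U \<inter> usphere) \<noteq> 0"
    using pos emeasure_mono[of ?V "ball 0 1 \<inter> sgn -` (U \<inter> usphere)" lborel] ball_lborel_pos[where 'a='a]
    by (subst emeasure_sphere_measure) (auto simp: ennreal_divide_eq_0_iff)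
  then show ?thesis by (simp add: emeasure_eq_measure zero_less_measure_iff)
qed

section \<open>Approximate identities on the sphere\<close>

text \<open>
  The closed sets generate the Borel sets, and the indicator of a closed set \<open>C\<close> is the limit of the
  continuous functions \<open>max 0 (1 - n d(x, C))\<close>.
\<close>

lemma finite_measure_eqI_continuous:
  fixes M N :: "'a::metric_space measure"
  assumes fin: "finite_measure M" "finite_measure N"
    and sets: "sets M = sets borel" "sets N = sets borel"
    and eq: "\<And>f. continuous_on UNIV f \<Longrightarrow> (\<And>x. 0 \<le> f x \<and> f x \<le> 1) \<Longrightarrow> integral\<^sup>L M f = integral\<^sup>L N (f :: 'a \<Rightarrow> real)"
  shows "M = N"
proof -
  interpret M: finite_measure M by fact
  interpret N: finite_measure N by fact
  note [measurable_cong] = sets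
  have closed: "measure M C = measure N C" if C: "closed C" "C \<noteq> {}" for C
  proof -
    define f where "f n x = max 0 (1 - real n * infdist x C)" for n x
    have f01: "0 \<le> f n x \<and> f n x \<le> 1" for n x
      by (simp add: f_def infdist_nonneg)
    have fc: "continuous_on UNIV (f n)" for n
      unfolding f_def by (intro continuous_intros)
    have [measurable]: "f n \<in> borel_measurable borel" for n
      using fc by (rule borel_measurable_continuous_onI)
    have [measurable]: "C \<in> sets borel" using C by auto
    have lim: "(\<lambda>n. f n x) \<longlonglongrightarrow> indicator C x" for x
    proof (cases "x \<in> C")
      case True
      then show ?thesis by (simp add: f_def)
    next
      case False
      then have "infdist x C > 0"
        using C in_closed_iff_infdist_zero[OF C] infdist_nonneg[of x C] by (simp add: less_eq_real_def)
      then obtain n0 :: nat where n0: "1 < real n0 * infdist x C"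
        using reals_Archimedean3 by blast
      have "\<forall>\<^sub>F n in sequentially. f n x = 0"
      proof (rule eventually_sequentiallyI)
        fix n assume "n0 \<le> n"
        then have "real n0 * infdist x C \<le> real n * infdist x C"
          by (intro mult_right_mono infdist_nonneg) auto
        then show "f n x = 0" using n0 by (simp add: f_def)
      qed
      then show ?thesis using False by (simp add: tendsto_eventually)
    qed
    have "(\<lambda>n. integral\<^sup>L M (f n)) \<longlonglongrightarrow> integral\<^sup>L M (indicator C)"
      by (rule integral_dominated_convergence[where w="\<lambda>_. 1"]) (use f01 lim in auto)
    moreover have "(\<lambda>n. integral\<^sup>L N (f n)) \<longlonglongrightarrow> integral\<^sup>L N (indicator C)"
      by (rule integral_dominated_convergence[where w="\<lambda>_. 1"]) (use f01 lim in auto)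
    moreover have "integral\<^sup>L M (f n) = integral\<^sup>L N (f n)" for n
      by (rule eq[OF fc f01])
    ultimately have "integral\<^sup>L M (indicator C :: _ \<Rightarrow> real) = integral\<^sup>L N (indicator C)"
      by (simp add: LIMSEQ_unique)
    then show ?thesis by simp
  qed
  show ?thesis
  proof (rule measure_eqI_generator_eq[where \<Omega>=UNIV and E="Collect closed" and A="\<lambda>_. UNIV"])
    show "emeasure M X = emeasure N X" if "X \<in> Collect closed" for X
      using closed[of X] that by (cases "X = {}") (auto simp: M.emeasure_eq_measure N.emeasure_eq_measure)
    show "emeasure M UNIV \<noteq> \<infinity>" for i :: nat by simp
  qed (auto simp: Int_stable_def sets borel_eq_closed)
qed

lemma integrable_sphere_continuous:
  fixes f :: "'a::euclidean_space \<Rightarrow> real"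
  assumes "continuous_on usphere f"
  shows "integrable sphere_measure f"
proof -
  interpret prob_space "sphere_measure :: 'a measure" by (rule prob_space_sphere_measure)
  have "compact (f ` usphere)" using assms by (intro compact_continuous_image) auto
  then obtain B where "\<And>x. x \<in> usphere \<Longrightarrow> norm (f x) \<le> B"
    using compact_imp_bounded bounded_iff by (metis imageI)
  moreover have "f \<in> borel_measurable sphere_measure"
    unfolding measurable_cong_sets[OF sets_sphere_measure refl]
    using assms by (intro borel_measurable_continuous_on_restrict)
  ultimately show ?thesis by (intro integrable_const_bound[where B=B]) auto
qed

lemma sphere_continuous_bounded:
  fixes g :: "'a::euclidean_space \<Rightarrow> real"
  assumes "continuous_on usphere g"
  obtains B where "0 \<le> B" "\<And>z. norm z = 1 \<Longrightarrow> \<bar>g z\<bar> \<le> B"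
proof -
  have "compact (g ` usphere)" by (rule compact_continuous_image[OF assms compact_sphere])
  then obtain B where "\<And>z. norm z = 1 \<Longrightarrow> \<bar>g z\<bar> \<le> B"
    using compact_imp_bounded bounded_iff by (metis imageI real_norm_def mem_sphere_0)
  then show ?thesis by (intro that[of "max 0 B"]) (auto simp: le_max_iff_disj)
qed

lemma integrable_mult_bounded:
  fixes f g :: "'w \<Rightarrow> real"
  assumes f: "integrable M f" and g: "g \<in> borel_measurable M" and B: "\<And>x. x \<in> space M \<Longrightarrow> \<bar>g x\<bar> \<le> B"
  shows "integrable M (\<lambda>x. f x * g x)"
proof (rule Bochner_Integration.integrable_bound[OF integrable_mult_left[OF f, of B]])
  show "(\<lambda>x. f x * g x) \<in> borel_measurable M"
    using g borel_measurable_integrable[OF f] by measurable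
  show "AE x in M. norm (f x * g x) \<le> norm (f x * B)"
    using B by (intro AE_I2) (simp add: abs_mult mult_left_mono order_trans[OF _ abs_ge_self])
qed

lemma weighted_fubini_sphere:
  fixes F :: "'w \<Rightarrow> 'a::euclidean_space \<Rightarrow> real"
  assumes M: "prob_space M" and w: "integrable M w"
    and F: "(\<lambda>(\<omega>, x). F \<omega> x) \<in> borel_measurable (M \<Otimes>\<^sub>M sphere_measure)"
    and B: "\<And>\<omega> x. \<omega> \<in> space M \<Longrightarrow> norm x = 1 \<Longrightarrow> \<bar>F \<omega> x\<bar> \<le> B"
  shows "(\<integral>x. \<integral>\<omega>. w \<omega> * F \<omega> x \<partial>M \<partial>sphere_measure) = (\<integral>\<omega>. w \<omega> * (\<integral>x. F \<omega> x \<partial>sphere_measure) \<partial>M)"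
proof -
  interpret M: prob_space M by (rule M)
  interpret S: prob_space "sphere_measure :: 'a measure" by (rule prob_space_sphere_measure)
  interpret MS: pair_prob_space M "sphere_measure :: 'a measure" ..
  have "integrable (distr (M \<Otimes>\<^sub>M sphere_measure) M (fst :: 'w \<times> 'a \<Rightarrow> 'w)) w"
    using w by (simp add: S.distr_pair_fst)
  then have "integrable (M \<Otimes>\<^sub>M sphere_measure) (\<lambda>p :: 'w \<times> 'a. w (fst p))"
    using borel_measurable_integrable[OF w] by (subst (asm) integrable_distr_eq) auto
  from integrable_mult_bounded[OF this F, of B]
  have "integrable (M \<Otimes>\<^sub>M sphere_measure) (\<lambda>(\<omega>, x). w \<omega> * F \<omega> x)"
    using B by (simp add: case_prod_beta' space_pair_measure mem_Times_iff)
  from MS.Fubini_integral[OF this] show ?thesis by simp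
qed

text \<open>
  On the sphere \<open>(1 + x \<bullet> z) / 2\<close> equals 1 at \<open>z = x\<close> and is smaller elsewhere. Its powers, divided by
  their integral, are an approximate identity that consists of polynomials in \<open>x \<bullet> z\<close>.
\<close>

definition cap_mass :: "nat \<Rightarrow> 'a::euclidean_space \<Rightarrow> real" where
  "cap_mass m x = (\<integral>z. ((1 + x \<bullet> z) / 2) ^ m \<partial>sphere_measure)"

lemma cap_kernel_bounds:
  assumes "norm (x::'a::euclidean_space) = 1" "norm z = 1"
  shows "0 \<le> (1 + x \<bullet> z) / 2" "(1 + x \<bullet> z) / 2 \<le> 1" "(1 + x \<bullet> z) / 2 = 1 - (dist x z)\<^sup>2 / 4"
proof -
  have "(dist x z)\<^sup>2 = 2 - 2 * (x \<bullet> z)"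
    using assms by (simp add: dist_norm power2_norm_eq_inner inner_diff inner_commute norm_eq_1)
  then show "(1 + x \<bullet> z) / 2 = 1 - (dist x z)\<^sup>2 / 4" by (simp add: field_simps)
  show "0 \<le> (1 + x \<bullet> z) / 2" "(1 + x \<bullet> z) / 2 \<le> 1"
    using Cauchy_Schwarz_ineq2[of x z] assms by auto
qed

lemma integrable_cap_kernel:
  assumes "continuous_on usphere (g :: 'a::euclidean_space \<Rightarrow> real)"
  shows "integrable sphere_measure (\<lambda>z. ((1 + x \<bullet> z) / 2) ^ m * g z)"
  by (intro integrable_sphere_continuous continuous_intros assms) auto

lemma cap_mass_lower:
  assumes x: "norm (x::'a::euclidean_space) = 1" and d: "0 < d" "d \<le> 1"
  shows "measure sphere_measure (ball x d \<inter> usphere) * (1 - d\<^sup>2 / 4) ^ m \<le> cap_mass m x"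
proof -
  interpret prob_space "sphere_measure :: 'a measure" by (rule prob_space_sphere_measure)
  have S: "ball x d \<inter> usphere \<in> sets sphere_measure" by (simp add: sets_sphere_measure_iff)
  have "measure sphere_measure (ball x d \<inter> usphere) * (1 - d\<^sup>2 / 4) ^ m
      = (\<integral>z. indicator (ball x d \<inter> usphere) z * (1 - d\<^sup>2 / 4) ^ m \<partial>sphere_measure)"
    using S by simp
  also have "\<dots> \<le> cap_mass m x"
    unfolding cap_mass_def
  proof (rule integral_mono)
    show "integrable sphere_measure (\<lambda>z. indicator (ball x d \<inter> usphere) z * (1 - d\<^sup>2 / 4) ^ m)"
      using S by (intro integrable_mult_left integrable_real_indicator) (auto simp: less_top[symmetric])
    show "integrable sphere_measure (\<lambda>z. ((1 + x \<bullet> z) / 2) ^ m)"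
      by (intro integrable_sphere_continuous continuous_intros) auto
    fix z :: 'a assume "z \<in> space sphere_measure"
    then have z: "norm z = 1" by simp
    note k = cap_kernel_bounds[OF x z]
    have "1 - d\<^sup>2 / 4 \<ge> 0" using d power_le_one[of d 2] by simp
    moreover have "(dist x z)\<^sup>2 \<le> d\<^sup>2" if "dist x z < d" using that by (intro power_mono) auto
    ultimately show "indicator (ball x d \<inter> usphere) z * (1 - d\<^sup>2 / 4) ^ m \<le> ((1 + x \<bullet> z) / 2) ^ m"
      using k(1) by (auto simp: indicator_def k(3) simp del: zero_le_divide_iff intro!: power_mono)
  qed
  finally show ?thesis .
qed

lemma cap_mass_pos:
  assumes x: "norm (x::'a::euclidean_space) = 1"
  shows "0 < cap_mass m x"
proof -
  have "0 < measure sphere_measure (ball x 1 \<inter> usphere) * (1 - 1\<^sup>2 / 4 :: real) ^ m"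
    using sphere_measure_open_pos[of "ball x 1" x] x by simp
  also have "\<dots> \<le> cap_mass m x" by (rule cap_mass_lower) (use x in auto)
  finally show ?thesis .
qed

text \<open>
  Outside the ball of radius \<open>d\<close> around \<open>x\<close> the kernel is at most \<open>(1 - d\<^sup>2/4)\<^sup>m\<close>, whereas the ball of
  radius \<open>d/2\<close> alone contributes at least a constant times \<open>(1 - d\<^sup>2/16)\<^sup>m\<close> to its mass. Hence the part of
  the mass outside any ball becomes negligible.
\<close>

lemma cap_kernel_approx_identity:
  assumes x: "norm (x::'a::euclidean_space) = 1" and g: "continuous_on usphere g"
  shows "(\<lambda>m. (\<integral>z. ((1 + x \<bullet> z) / 2) ^ m * g z \<partial>sphere_measure) / cap_mass m x) \<longlonglongrightarrow> g x"
proof (rule LIMSEQ_I)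
  fix e :: real assume e: "0 < e"
  interpret prob_space "sphere_measure :: 'a measure" by (rule prob_space_sphere_measure)
  obtain B where B0: "0 \<le> B" and B: "\<And>z. norm z = 1 \<Longrightarrow> \<bar>g z\<bar> \<le> B"
    using sphere_continuous_bounded[OF g] by blast
  obtain d0 where d0: "0 < d0" "\<And>z. z \<in> usphere \<Longrightarrow> dist z x < d0 \<Longrightarrow> \<bar>g z - g x\<bar> < e / 2"
    using g x e unfolding continuous_on_iff dist_real_def
    by (metis half_gt_zero mem_sphere_0)
  define d where "d = min 1 d0"
  have d: "0 < d" "d \<le> 1" "\<And>z. z \<in> usphere \<Longrightarrow> dist z x < d \<Longrightarrow> \<bar>g z - g x\<bar> < e / 2"
    using d0 by (auto simp: d_def)
  \<comment> \<open>the kernel is at most \<open>a\<^sup>m\<close> at distance at least \<open>d\<close>, and at least \<open>b\<^sup>m\<close> at distance at most \<open>d/2\<close>\<close>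
  define a where "a = 1 - d\<^sup>2 / 4"
  define b where "b = 1 - (d/2)\<^sup>2 / 4"
  define w where "w = measure sphere_measure (ball x (d/2) \<inter> usphere)"
  have d2: "0 < d\<^sup>2" "d\<^sup>2 \<le> 1" using d by (auto intro: power_le_one)
  have ab: "0 \<le> a" "a < b" "0 < b" using d2 by (auto simp: a_def b_def power_divide)
  have w: "0 < w" unfolding w_def using sphere_measure_open_pos[of "ball x (d/2)" x] x d by simp
  have low: "w * b ^ m \<le> cap_mass m x" for m
    unfolding w_def b_def using x d by (intro cap_mass_lower) auto
  have est: "\<bar>(\<integral>z. ((1 + x \<bullet> z) / 2) ^ m * g z \<partial>sphere_measure) / cap_mass m x - g x\<bar>
      \<le> e / 2 + 2 * B / w * (a / b) ^ m" for m
  proof -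
    let ?K = "\<lambda>z. ((1 + x \<bullet> z) / 2) ^ m"
    have cp: "0 < cap_mass m x" by (rule cap_mass_pos[OF x])
    have iK: "integrable sphere_measure ?K"
      by (intro integrable_sphere_continuous continuous_intros) auto
    have iKg: "integrable sphere_measure (\<lambda>z. ?K z * g z)"
      by (rule integrable_cap_kernel[OF g])
    have "(\<integral>z. ?K z * g z \<partial>sphere_measure) - g x * cap_mass m x
        = (\<integral>z. ?K z * g z - g x * ?K z \<partial>sphere_measure)"
      unfolding cap_mass_def using iK iKg by simp
    also have "\<bar>\<dots>\<bar> \<le> (\<integral>z. \<bar>?K z * g z - g x * ?K z\<bar> \<partial>sphere_measure)"
      by (rule integral_abs_bound)
    also have "\<dots> \<le> (\<integral>z. e / 2 * ?K z + 2 * B * a ^ m \<partial>sphere_measure)"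
    proof (rule integral_mono)
      show "integrable sphere_measure (\<lambda>z. \<bar>?K z * g z - g x * ?K z\<bar>)"
        using iK iKg by (intro integrable_abs Bochner_Integration.integrable_diff) auto
      show "integrable sphere_measure (\<lambda>z. e / 2 * ?K z + 2 * B * a ^ m)"
        using iK by simp
      fix z :: 'a assume "z \<in> space sphere_measure"
      then have z: "norm z = 1" by simp
      note k = cap_kernel_bounds[OF x z]
      have eq: "\<bar>?K z * g z - g x * ?K z\<bar> = ?K z * \<bar>g z - g x\<bar>"
      proof -
        have "?K z * g z - g x * ?K z = ?K z * (g z - g x)" by algebra
        then show ?thesis using k(1) by (simp add: abs_mult)
      qed
      show "\<bar>?K z * g z - g x * ?K z\<bar> \<le> e / 2 * ?K z + 2 * B * a ^ m"
      proof (cases "dist z x < d")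
        case True
        then have "?K z * \<bar>g z - g x\<bar> \<le> ?K z * (e / 2)"
          using d(3)[of z] z k(1) by (intro mult_left_mono zero_le_power) auto
        then show ?thesis unfolding eq using B0 ab(1) by (simp add: mult.commute add_increasing2)
      next
        case False
        then have "d\<^sup>2 \<le> (dist x z)\<^sup>2" using d by (intro power_mono) (auto simp: dist_commute)
        then have "(1 + x \<bullet> z) / 2 \<le> a" unfolding k(3) a_def by simp
        then have "?K z \<le> a ^ m" using k(1) by (intro power_mono) auto
        moreover have "\<bar>g z - g x\<bar> \<le> 2 * B" using B[of z] B[of x] z x by auto
        ultimately have "?K z * \<bar>g z - g x\<bar> \<le> a ^ m * (2 * B)"
          using ab by (intro mult_mono) auto
        moreover have "0 \<le> e / 2 * ?K z" using e k(1) by (intro mult_nonneg_nonneg zero_le_power) auto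
        ultimately show ?thesis unfolding eq by (simp add: mult.commute)
      qed
    qed
    also have "\<dots> = e / 2 * cap_mass m x + 2 * B * a ^ m"
      unfolding cap_mass_def using iK prob_space by simp
    finally have 1: "\<bar>(\<integral>z. ?K z * g z \<partial>sphere_measure) - g x * cap_mass m x\<bar>
        \<le> e / 2 * cap_mass m x + 2 * B * a ^ m" .
    have "\<bar>(\<integral>z. ?K z * g z \<partial>sphere_measure) / cap_mass m x - g x\<bar>
        = \<bar>(\<integral>z. ?K z * g z \<partial>sphere_measure) - g x * cap_mass m x\<bar> / cap_mass m x"
      using cp by (simp add: field_simps abs_mult)
    also have "\<dots> \<le> (e / 2 * cap_mass m x + 2 * B * a ^ m) / cap_mass m x"
      using 1 cp by (intro divide_right_mono) auto
    also have "\<dots> = e / 2 + 2 * B * a ^ m / cap_mass m x" using cp by (simp add: field_simps)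
    also have "\<dots> \<le> e / 2 + 2 * B * a ^ m / (w * b ^ m)"
      using low[of m] w ab B0 cp by (intro add_left_mono divide_left_mono mult_nonneg_nonneg) auto
    finally show ?thesis by (simp add: power_divide)
  qed
  have "(\<lambda>m. 2 * B / w * (a / b) ^ m) \<longlonglongrightarrow> 2 * B / w * 0"
    using ab by (intro tendsto_mult LIMSEQ_power_zero tendsto_const) auto
  then obtain M where M: "\<And>m. m \<ge> M \<Longrightarrow> \<bar>2 * B / w * (a / b) ^ m\<bar> < e / 2"
    using e LIMSEQ_D[of _ 0 "e/2"] by fastforce
  show "\<exists>no. \<forall>n\<ge>no. norm ((\<integral>z. ((1 + x \<bullet> z) / 2) ^ n * g z \<partial>sphere_measure) / cap_mass n x - g x) < e"
  proof (intro exI allI impI)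
    fix n assume "M \<le> n"
    then show "norm ((\<integral>z. ((1 + x \<bullet> z) / 2) ^ n * g z \<partial>sphere_measure) / cap_mass n x - g x) < e"
      using est[of n] M[of n] unfolding real_norm_def by linarith
  qed
qed

section \<open>Moments of rotation invariant measures\<close>

definition monomial :: "('n \<Rightarrow> nat) \<Rightarrow> real^'n::finite \<Rightarrow> real" where
  "monomial \<kappa> x = (\<Prod>i\<in>UNIV. x $ i ^ \<kappa> i)"

definition rot :: "'n \<Rightarrow> 'n \<Rightarrow> real \<Rightarrow> real^'n::finite \<Rightarrow> real^'n" where
  "rot i j \<theta> x = (\<chi> k. if k = i then x $ i * cos \<theta> - x $ j * sin \<theta>
                      else if k = j then x $ i * sin \<theta> + x $ j * cos \<theta> else x $ k)"

lemma monomial_measurable [measurable]: "monomial \<kappa> \<in> borel_measurable borel"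
  unfolding monomial_def by measurable

lemma rot_measurable [measurable]: "rot i j \<theta> \<in> borel_measurable borel"
proof (rule borel_measurable_continuous_onI)
  show "continuous_on UNIV (rot i j \<theta>)"
    unfolding rot_def
  proof (rule continuous_on_vec_lambda)
    fix k show "continuous_on UNIV (\<lambda>x. if k = i then x $ i * cos \<theta> - x $ j * sin \<theta>
        else if k = j then x $ i * sin \<theta> + x $ j * cos \<theta> else x $ k)"
      by (cases "k = i"; cases "k = j") (auto intro!: continuous_intros)
  qed
qed

lemma monomial_split2:
  assumes "i \<noteq> j"
  shows "monomial \<kappa> x = x $ i ^ \<kappa> i * x $ j ^ \<kappa> j * (\<Prod>k\<in>- {i, j}. x $ k ^ \<kappa> k)"
proof -
  have "monomial \<kappa> x = (\<Prod>k\<in>insert i (insert j (- {i, j})). x $ k ^ \<kappa> k)"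
    unfolding monomial_def by (rule prod.cong) auto
  then show ?thesis using assms by (simp add: mult.assoc)
qed

lemma monomial_shift: "monomial (\<kappa>(i := \<kappa> i + c)) x = x $ i ^ c * monomial \<kappa> x"
proof -
  have "monomial (\<kappa>(i := \<kappa> i + c)) x = (\<Prod>k\<in>insert i (- {i}). x $ k ^ (\<kappa>(i := \<kappa> i + c)) k)"
    unfolding monomial_def by (rule prod.cong) auto
  also have "\<dots> = x $ i ^ c * (x $ i ^ \<kappa> i * (\<Prod>k\<in>- {i}. x $ k ^ \<kappa> k))"
    by (subst prod.insert) (auto simp: power_add)
  also have "x $ i ^ \<kappa> i * (\<Prod>k\<in>- {i}. x $ k ^ \<kappa> k) = (\<Prod>k\<in>insert i (- {i}). x $ k ^ \<kappa> k)"
    by simp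
  also have "\<dots> = monomial \<kappa> x" unfolding monomial_def by (rule prod.cong) auto
  finally show ?thesis .
qed

lemma monomial_bound:
  assumes "\<And>i. \<bar>x $ i\<bar> \<le> 1" shows "\<bar>monomial \<kappa> x\<bar> \<le> 1"
  unfolding monomial_def abs_prod power_abs using assms by (intro prod_le_1) (auto intro: power_le_one)

text \<open>
  The projection of \<open>N\<close> to the coordinates in \<open>K\<close> is carried by the unit sphere of that coordinate
  subspace, and \<open>N\<close> is invariant under its rotations. The remaining coordinates are only bounded, so that
  all moments exist.
\<close>

locale rotation_invariant = prob_space N for N :: "(real^'n::finite) measure" +
  fixes K :: "'n set"
  assumes sets_N [measurable_cong]: "sets N = sets borel"
    and bounded_N: "AE x in N. \<forall>i. \<bar>x $ i\<bar> \<le> 1"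
    and sphere_N: "AE x in N. (\<Sum>i\<in>K. (x $ i)\<^sup>2) = 1"
    and rot_N: "\<And>i j \<theta>. i \<in> K \<Longrightarrow> j \<in> K \<Longrightarrow> i \<noteq> j \<Longrightarrow> distr N N (rot i j \<theta>) = N"
begin

abbreviation moment :: "('n \<Rightarrow> nat) \<Rightarrow> real" where
  "moment \<kappa> \<equiv> (\<integral>x. monomial \<kappa> x \<partial>N)"

lemma integrable_monomial: "integrable N (monomial \<kappa>)"
  by (rule integrable_const_bound[where B=1])
     (use bounded_N in \<open>auto elim!: eventually_mono intro: monomial_bound\<close>)

text \<open>
  The integral of a monomial over the point rotated by \<open>\<theta>\<close> in the plane of \<open>i\<close> and \<open>j\<close> does not depend on
  \<open>\<theta>\<close>. Its derivative at \<open>\<theta> = 0\<close> is the difference of the two sides.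
\<close>

lemma moment_rot:
  assumes ij: "i \<in> K" "j \<in> K" "i \<noteq> j"
  shows "real b * moment (\<kappa>(i := a + 1, j := b - 1)) = real a * moment (\<kappa>(i := a - 1, j := b + 1))"
proof -
  define R where "R x = (\<Prod>k\<in>- {i, j}. x $ k ^ \<kappa> k)" for x :: "real^'n"
  define A where "A \<theta> x = x $ i * cos \<theta> - x $ j * sin \<theta>" for \<theta> and x :: "real^'n"
  define B where "B \<theta> x = x $ i * sin \<theta> + x $ j * cos \<theta>" for \<theta> and x :: "real^'n"
  define f where "f \<theta> x = A \<theta> x ^ a * B \<theta> x ^ b * R x" for \<theta> and x :: "real^'n"
  define D where "D \<theta> x = (real a * A \<theta> x ^ (a - 1) * (- B \<theta> x)) * B \<theta> x ^ b * R x
      + A \<theta> x ^ a * (real b * B \<theta> x ^ (b - 1) * A \<theta> x) * R x" for \<theta> and x :: "real^'n"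
  have Rm [measurable]: "R \<in> borel_measurable borel" unfolding R_def by measurable
  have AB [measurable]: "A \<theta> \<in> borel_measurable borel" "B \<theta> \<in> borel_measurable borel" for \<theta>
    unfolding A_def B_def by (intro borel_measurable_continuous_onI continuous_intros)+
  have fm [measurable]: "f \<theta> \<in> borel_measurable borel" for \<theta>
    unfolding f_def by measurable
  have Dm [measurable]: "D \<theta> \<in> borel_measurable borel" for \<theta>
    unfolding D_def by measurable
  have mono: "monomial (\<kappa>(i := c, j := d)) x = x $ i ^ c * x $ j ^ d * R x" for c d x
    using ij(3) by (subst monomial_split2[of i j]) (auto simp: R_def intro!: prod.cong)
  have f_rot: "f \<theta> x = monomial (\<kappa>(i := a, j := b)) (rot i j \<theta> x)" for \<theta> x
    unfolding mono f_def A_def B_def R_def rot_def using ij(3) by (auto intro!: prod.cong)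
  have If: "(\<integral>x. f \<theta> x \<partial>N) = moment (\<kappa>(i := a, j := b))" for \<theta>
  proof -
    have "(\<integral>x. f \<theta> x \<partial>N) = (\<integral>x. monomial (\<kappa>(i := a, j := b)) x \<partial>distr N N (rot i j \<theta>))"
      unfolding f_rot by (subst integral_distr) auto
    then show ?thesis by (simp add: rot_N[OF ij])
  qed
  have deriv: "((\<lambda>\<theta>. f \<theta> x) has_field_derivative D \<theta> x) (at \<theta>)" for \<theta> x
    unfolding f_def D_def A_def B_def
    by (auto intro!: derivative_eq_intros simp: algebra_simps)
  have bounds: "\<bar>A \<theta> x\<bar> \<le> 1 \<and> \<bar>B \<theta> x\<bar> \<le> 1 \<and> \<bar>R x\<bar> \<le> 1"
    if "\<forall>i. \<bar>x $ i\<bar> \<le> 1" "(\<Sum>i\<in>K. (x $ i)\<^sup>2) = 1" for \<theta> x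
  proof -
    have "(\<Sum>k\<in>{i, j}. (x $ k)\<^sup>2) \<le> (\<Sum>k\<in>K. (x $ k)\<^sup>2)"
      by (rule sum_mono2) (use ij in auto)
    then have "(x $ i)\<^sup>2 + (x $ j)\<^sup>2 \<le> 1" using that(2) ij(3) by simp
    moreover have "(u * c - v * s)\<^sup>2 + (u * s + v * c)\<^sup>2 = (u\<^sup>2 + v\<^sup>2) * (s\<^sup>2 + c\<^sup>2)"
      for u v c s :: real by (simp add: power2_eq_square algebra_simps)
    then have "(A \<theta> x)\<^sup>2 + (B \<theta> x)\<^sup>2 = ((x $ i)\<^sup>2 + (x $ j)\<^sup>2) * ((sin \<theta>)\<^sup>2 + (cos \<theta>)\<^sup>2)"
      unfolding A_def B_def .
    ultimately have s: "(A \<theta> x)\<^sup>2 + (B \<theta> x)\<^sup>2 \<le> 1" by simp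
    then have "(A \<theta> x)\<^sup>2 \<le> 1" "(B \<theta> x)\<^sup>2 \<le> 1"
      using zero_le_power2[of "A \<theta> x"] zero_le_power2[of "B \<theta> x"] by linarith+
    moreover have "\<bar>R x\<bar> \<le> 1"
      unfolding R_def abs_prod power_abs using that(1) by (intro prod_le_1) (auto intro: power_le_one)
    ultimately show ?thesis by (simp add: abs_square_le_1)
  qed
  have Dbound: "\<bar>D \<theta> x\<bar> \<le> real a + real b"
    if x: "\<forall>i. \<bar>x $ i\<bar> \<le> 1" "(\<Sum>i\<in>K. (x $ i)\<^sup>2) = 1" for \<theta> x
  proof -
    note b = bounds[OF x, of \<theta>]
    have 1: "\<bar>A \<theta> x ^ c\<bar> \<le> 1" "\<bar>B \<theta> x ^ c\<bar> \<le> 1" for c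
      using b by (auto simp: power_abs intro: power_le_one)
    have "\<bar>(real a * A \<theta> x ^ (a - 1) * (- B \<theta> x)) * B \<theta> x ^ b * R x\<bar> =
        real a * (\<bar>A \<theta> x ^ (a - 1)\<bar> * (\<bar>B \<theta> x\<bar> * (\<bar>B \<theta> x ^ b\<bar> * \<bar>R x\<bar>)))"
      by (simp add: abs_mult)
    also have "\<dots> \<le> real a * 1"
      using b 1 by (intro mult_left_mono mult_le_one) auto
    finally have 2: "\<bar>(real a * A \<theta> x ^ (a - 1) * (- B \<theta> x)) * B \<theta> x ^ b * R x\<bar> \<le> real a" by simp
    have "\<bar>A \<theta> x ^ a * (real b * B \<theta> x ^ (b - 1) * A \<theta> x) * R x\<bar> =
        real b * (\<bar>A \<theta> x ^ a\<bar> * (\<bar>B \<theta> x ^ (b - 1)\<bar> * (\<bar>A \<theta> x\<bar> * \<bar>R x\<bar>)))"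
      by (simp add: abs_mult)
    also have "\<dots> \<le> real b * 1"
      using b 1 by (intro mult_left_mono mult_le_one) auto
    finally show ?thesis using 2 unfolding D_def by (intro order_trans[OF abs_triangle_ineq]) auto
  qed
  define h where "h n = 1 / real (Suc n)" for n
  have h: "h n \<noteq> 0" "h \<longlonglongrightarrow> 0" for n
    unfolding h_def using LIMSEQ_Suc[OF lim_1_over_n] by (auto simp: o_def)
  have "(\<lambda>n. \<integral>x. (f (h n) x - f 0 x) / h n \<partial>N) \<longlonglongrightarrow> (\<integral>x. D 0 x \<partial>N)"
  proof (rule integral_dominated_convergence[where w="\<lambda>_. real a + real b"])
    show "AE x in N. (\<lambda>n. (f (h n) x - f 0 x) / h n) \<longlonglongrightarrow> D 0 x"
    proof (rule AE_I2)
      fix x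
      have "((\<lambda>t. (f t x - f 0 x) / t) \<longlongrightarrow> D 0 x) (at 0)"
        using deriv[of x 0] by (simp add: has_field_derivative_iff)
      moreover have "filterlim h (at 0) sequentially"
        using h by (simp add: filterlim_at)
      ultimately show "(\<lambda>n. (f (h n) x - f 0 x) / h n) \<longlonglongrightarrow> D 0 x"
        by (rule filterlim_compose)
    qed
    show "AE x in N. norm ((f (h n) x - f 0 x) / h n) \<le> real a + real b" for n
      using bounded_N sphere_N
    proof eventually_elim
      case (elim x)
      have "norm (f (h n) x - f 0 x) \<le> (real a + real b) * norm (h n - 0)"
        by (rule field_differentiable_bound[where S=UNIV and f'="\<lambda>\<theta>. D \<theta> x"])
           (use deriv Dbound[OF elim] in \<open>auto intro: has_field_derivative_at_within\<close>)
      then show ?case using h(1)[of n] by (simp add: divide_le_eq abs_mult)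
    qed
  qed auto
  moreover have "integrable N (f \<theta>)" for \<theta>
  proof (rule integrable_const_bound[where B=1])
    show "AE x in N. norm (f \<theta> x) \<le> 1"
      using bounded_N sphere_N
    proof eventually_elim
      case (elim x)
      note b = bounds[OF elim, of \<theta>]
      have "\<bar>f \<theta> x\<bar> = \<bar>A \<theta> x\<bar> ^ a * \<bar>B \<theta> x\<bar> ^ b * \<bar>R x\<bar>" by (simp add: f_def abs_mult power_abs)
      also have "\<dots> \<le> 1" using b by (intro mult_le_one power_le_one) auto
      finally show ?case by simp
    qed
  qed auto
  ultimately have "(\<integral>x. D 0 x \<partial>N) = 0"
    by (simp add: If LIMSEQ_const_iff)
  moreover have "D 0 x = real b * monomial (\<kappa>(i := a + 1, j := b - 1)) x
      - real a * monomial (\<kappa>(i := a - 1, j := b + 1)) x" for x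
    unfolding mono D_def A_def B_def by (simp add: algebra_simps)
  ultimately show ?thesis
    using integrable_monomial by simp
qed

lemma moment_sphere: "(\<Sum>i\<in>K. moment (\<kappa>(i := \<kappa> i + 2))) = moment \<kappa>"
proof -
  have "(\<Sum>i\<in>K. moment (\<kappa>(i := \<kappa> i + 2))) = (\<integral>x. (\<Sum>i\<in>K. monomial (\<kappa>(i := \<kappa> i + 2)) x) \<partial>N)"
    by (simp add: integrable_monomial)
  also have "\<dots> = moment \<kappa>"
  proof (rule integral_cong_AE)
    show "AE x in N. (\<Sum>i\<in>K. monomial (\<kappa>(i := \<kappa> i + 2)) x) = monomial \<kappa> x"
      using sphere_N by eventually_elim (simp only: monomial_shift sum_distrib_right[symmetric] mult_1)
  qed auto
  finally show ?thesis .
qed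

text \<open>
  The relation \<open>\<Sum>\<^sub>i x\<^sub>i\<^sup>2 = 1\<close> is inserted into the moment with \<open>x\<^sub>j\<^sup>2\<close> removed, and \<open>moment_rot\<close> moves each new
  factor \<open>x\<^sub>i\<^sup>2\<close> back to \<open>x\<^sub>j\<^sup>2\<close>. In the mean, the Laplacian in the coordinates \<open>K\<close> thus acts on monomials of degree
  \<open>a\<close> in these coordinates as on the radial function \<open>r\<^sup>a\<close>.
\<close>

lemma moment_laplacian:
  "(\<Sum>j\<in>K. real (\<kappa> j * (\<kappa> j - 1)) * moment (\<kappa>(j := \<kappa> j - 2)))
    = real (\<Sum>j\<in>K. \<kappa> j) * (real (\<Sum>j\<in>K. \<kappa> j) + real (card K) - 2) * moment \<kappa>"
proof -
  have each: "real (\<kappa> j * (\<kappa> j - 1)) * moment (\<kappa>(j := \<kappa> j - 2))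
      = real (\<kappa> j) * (real (\<Sum>j\<in>K. \<kappa> j) + real (card K) - 2) * moment \<kappa>" if j: "j \<in> K" for j
  proof -
    define \<kappa>' where "\<kappa>' = \<kappa>(j := \<kappa> j - 2)"
    have "real (\<kappa> j * (\<kappa> j - 1)) * moment \<kappa>'
        = (\<Sum>i\<in>K. real (\<kappa> j * (\<kappa> j - 1)) * moment (\<kappa>'(i := \<kappa>' i + 2)))"
      by (simp only: moment_sphere sum_distrib_left[symmetric])
    also have "\<dots> = (\<Sum>i\<in>insert j (K - {j}). real (\<kappa> j * (\<kappa> j - 1)) * moment (\<kappa>'(i := \<kappa>' i + 2)))"
      using j by (intro sum.cong) auto
    also have "\<dots> = real (\<kappa> j * (\<kappa> j - 1)) * moment (\<kappa>'(j := \<kappa>' j + 2))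
        + (\<Sum>i\<in>K - {j}. real (\<kappa> j * (\<kappa> j - 1)) * moment (\<kappa>'(i := \<kappa>' i + 2)))"
      by (subst sum.insert) auto
    also have "real (\<kappa> j * (\<kappa> j - 1)) * moment (\<kappa>'(j := \<kappa>' j + 2)) = real (\<kappa> j) * (real (\<kappa> j) - 1) * moment \<kappa>"
    proof (cases "\<kappa> j \<ge> 2")
      case True
      then have "\<kappa>'(j := \<kappa>' j + 2) = \<kappa>" by (auto simp: \<kappa>'_def fun_eq_iff)
      then show ?thesis using True by (simp add: of_nat_diff)
    next
      case False
      then have "\<kappa> j = 0 \<or> \<kappa> j = 1" by auto
      then show ?thesis by auto
    qed
    also have "(\<Sum>i\<in>K - {j}. real (\<kappa> j * (\<kappa> j - 1)) * moment (\<kappa>'(i := \<kappa>' i + 2)))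
        = (\<Sum>i\<in>K - {j}. real (\<kappa> j) * (real (\<kappa> i) + 1) * moment \<kappa>)"
    proof (rule sum.cong[OF refl])
      fix i assume i: "i \<in> K - {j}"
      show "real (\<kappa> j * (\<kappa> j - 1)) * moment (\<kappa>'(i := \<kappa>' i + 2)) = real (\<kappa> j) * (real (\<kappa> i) + 1) * moment \<kappa>"
      proof (cases "\<kappa> j = 0")
        case False
        have "\<kappa>'(i := \<kappa>' i + 2) = \<kappa>(i := \<kappa> i + 1 + 1, j := \<kappa> j - 1 - 1)"
          using i by (auto simp: \<kappa>'_def fun_eq_iff)
        moreover have "\<kappa>(i := \<kappa> i + 1 - 1, j := \<kappa> j - 1 + 1) = \<kappa>"
          using False by (auto simp: fun_eq_iff)
        ultimately have "real (\<kappa> j - 1) * moment (\<kappa>'(i := \<kappa>' i + 2)) = real (\<kappa> i + 1) * moment \<kappa>"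
          using moment_rot[of i j "\<kappa> j - 1" \<kappa> "\<kappa> i + 1"] i j by simp
        then show ?thesis by (simp add: mult.assoc)
      qed simp
    qed
    also have "\<dots> = real (\<kappa> j) * (real (\<Sum>i\<in>K - {j}. \<kappa> i) + real (card (K - {j}))) * moment \<kappa>"
      by (simp add: sum_distrib_left[symmetric] sum_distrib_right[symmetric] sum.distrib)
    also have "real (card (K - {j})) = real (card K) - 1"
    proof -
      have "card K \<ge> 1" using j by (auto simp: Suc_le_eq card_gt_0_iff)
      then show ?thesis using j by (simp add: of_nat_diff)
    qed
    also have "real (\<Sum>i\<in>K - {j}. \<kappa> i) = real (\<Sum>i\<in>K. \<kappa> i) - real (\<kappa> j)"
      using j by (simp add: sum.remove[of K j])
    finally show ?thesis unfolding \<kappa>'_def[symmetric] by (simp add: algebra_simps)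
  qed
  have "(\<Sum>j\<in>K. real (\<kappa> j * (\<kappa> j - 1)) * moment (\<kappa>(j := \<kappa> j - 2)))
      = (\<Sum>j\<in>K. real (\<kappa> j) * (real (\<Sum>j\<in>K. \<kappa> j) + real (card K) - 2) * moment \<kappa>)"
    by (rule sum.cong[OF refl each])
  then show ?thesis by (simp add: sum_distrib_right)
qed

end

section \<open>Averages of harmonic polynomials\<close>

lemma monomial_add: "monomial (\<lambda>i. \<kappa> i + \<kappa>' i) x = monomial \<kappa> x * monomial \<kappa>' x"
  by (simp add: monomial_def power_add prod.distrib)

lemma monomial_single: "monomial ((\<lambda>_. 0)(i := 1)) x = x $ i"
  using monomial_shift[of "\<lambda>_. 0" i 1 x] by (simp add: monomial_def)

lemma real_polynomial_function_monomials:
  assumes "real_polynomial_function (p :: real^'n::finite \<Rightarrow> real)"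
  obtains N :: nat and a :: "nat \<Rightarrow> real" and \<kappa>
  where "\<And>x. p x = (\<Sum>l<N. a l * monomial (\<kappa> l) x)"
proof -
  have "\<exists>L :: (real \<times> ('n \<Rightarrow> nat)) list. \<forall>x. p x = (\<Sum>(a, \<kappa>)\<leftarrow>L. a * monomial \<kappa> x)"
    using assms
  proof (induction rule: real_polynomial_function.induct)
    case (linear f)
    obtain xs where xs: "set xs = (UNIV :: 'n set)" "distinct xs"
      using finite_distinct_list[of "UNIV :: 'n set"] by auto
    have "f x = (\<Sum>(a, \<kappa>)\<leftarrow>map (\<lambda>i. (f (axis i 1), (\<lambda>_. 0)(i := 1))) xs. a * monomial \<kappa> x)" for x
    proof -
      have "f x = f (\<Sum>i\<in>UNIV. (x $ i) *\<^sub>R axis i 1)"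
        using basis_expansion[of x] by (simp add: scalar_mult_eq_scaleR)
      also have "\<dots> = (\<Sum>i\<in>UNIV. f (axis i 1) * x $ i)"
        using linear by (simp add: linear_sum linear_cmul bounded_linear.linear mult.commute)
      also have "\<dots> = (\<Sum>i\<leftarrow>xs. f (axis i 1) * x $ i)"
        using xs by (simp add: sum_list_distinct_conv_sum_set)
      finally show ?thesis by (simp add: o_def monomial_single del: One_nat_def)
    qed
    then show ?case by blast
  next
    case (const c)
    show ?case by (rule exI[of _ "[(c, \<lambda>_. 0)]"]) (simp add: monomial_def)
  next
    case (add f g)
    then obtain L L' where "\<forall>x. f x = (\<Sum>(a, \<kappa>)\<leftarrow>L. a * monomial \<kappa> x)"
      "\<forall>x. g x = (\<Sum>(a, \<kappa>)\<leftarrow>L'. a * monomial \<kappa> x)" by auto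
    then show ?case by (intro exI[of _ "L @ L'"]) simp
  next
    case (mult f g)
    then obtain L L' where *: "\<forall>x. f x = (\<Sum>(a, \<kappa>)\<leftarrow>L. a * monomial \<kappa> x)"
      "\<forall>x. g x = (\<Sum>(a, \<kappa>)\<leftarrow>L'. a * monomial \<kappa> x)" by auto
    let ?L = "concat (map (\<lambda>(a, \<kappa>). map (\<lambda>(b, \<kappa>'). (a * b, \<lambda>i. \<kappa> i + \<kappa>' i)) L') L)"
    have in1: "(\<Sum>(b, \<kappa>')\<leftarrow>map (\<lambda>(b, \<kappa>'). (a * b, \<lambda>i. \<kappa> i + \<kappa>' i)) L'. b * monomial \<kappa>' x)
        = a * monomial \<kappa> x * (\<Sum>(b, \<kappa>')\<leftarrow>L'. b * monomial \<kappa>' x)" for a \<kappa> and x :: "real^'n"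
      by (induction L') (auto simp: monomial_add algebra_simps)
    have "(\<Sum>(a, \<kappa>)\<leftarrow>?L. a * monomial \<kappa> x)
        = (\<Sum>(a, \<kappa>)\<leftarrow>L. a * monomial \<kappa> x) * (\<Sum>(a, \<kappa>)\<leftarrow>L'. a * monomial \<kappa> x)" for x
    proof (induction L)
      case (Cons y L)
      obtain a \<kappa> where y: "y = (a, \<kappa>)" by (cases y)
      show ?case using Cons in1[where a=a and \<kappa>=\<kappa> and x=x] by (simp add: y distrib_right)
    qed simp
    then show ?case using * by (intro exI[of _ ?L]) simp
  qed
  then obtain L :: "(real \<times> ('n \<Rightarrow> nat)) list"
    where L: "\<And>x. p x = (\<Sum>(a, \<kappa>)\<leftarrow>L. a * monomial \<kappa> x)" by blast
  show thesis
  proof (rule that)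
    show "p x = (\<Sum>l<length L. fst (L ! l) * monomial (snd (L ! l)) x)" for x
      unfolding L by (subst sum_list_sum_nth) (auto simp: case_prod_beta atLeast0LessThan)
  qed
qed

lemma power_sum_eq_zero_coeff:
  fixes e :: "'i \<Rightarrow> real"
  assumes "finite S" "\<And>\<beta>. (\<Sum>l\<in>S. e l * \<beta> ^ d l) = 0"
  shows "(\<Sum>l\<in>S. if d l = s then e l else 0) = 0"
proof -
  define P where "P = (\<Sum>l\<in>S. Polynomial.monom (e l) (d l))"
  have "poly P \<beta> = 0" for \<beta>
    unfolding P_def using assms(2) by (simp add: poly_sum poly_monom)
  then have "P = 0" using poly_all_0_iff_0 by blast
  then have "coeff P s = 0" by simp
  then show ?thesis by (simp add: P_def coeff_sum)
qed

lemma Basis_vec_axis: "(Basis :: (real^'n::finite) set) = (\<lambda>j. axis j 1) ` UNIV"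
  by (auto simp: Basis_vec_def)

lemma sum_Basis_vec: "(\<Sum>b\<in>Basis. g b) = (\<Sum>j\<in>UNIV. g (axis j (1::real) :: real^'n::finite))"
  unfolding Basis_vec_axis by (subst sum.reindex) (auto simp: inj_on_def axis_eq_axis)

lemma deriv2_eqI:
  assumes "\<And>s::real. (f has_field_derivative f' s) (at s)" "(f' has_field_derivative c) (at 0)"
  shows "(deriv ^^ 2) f 0 = c"
proof -
  have "deriv f = f'" using assms(1) by (intro ext DERIV_imp_deriv)
  then show ?thesis using assms(2) by (simp add: numeral_2_eq_2 DERIV_imp_deriv)
qed

lemma laplacian_monomials:
  fixes p :: "real^'n::finite \<Rightarrow> real"
  assumes p: "\<And>x. p x = (\<Sum>l<N. a l * monomial (\<kappa> l) x)"
  shows "laplacian p x = (\<Sum>l<N. a l * (\<Sum>j\<in>UNIV. real (\<kappa> l j * (\<kappa> l j - 1)) * monomial ((\<kappa> l)(j := \<kappa> l j - 2)) x))"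
proof -
  have D: "(deriv ^^ 2) (\<lambda>s. p (x + s *\<^sub>R axis j 1)) 0
      = (\<Sum>l<N. a l * (real (\<kappa> l j * (\<kappa> l j - 1)) * monomial ((\<kappa> l)(j := \<kappa> l j - 2)) x))" for j
  proof -
    define C where "C l = (\<Prod>i\<in>- {j}. x $ i ^ \<kappa> l i)" for l
    have mono: "monomial \<kappa>' y = y $ j ^ \<kappa>' j * (\<Prod>i\<in>- {j}. y $ i ^ \<kappa>' i)" for \<kappa>' and y :: "real^'n"
    proof -
      have "monomial \<kappa>' y = (\<Prod>i\<in>insert j (- {j}). y $ i ^ \<kappa>' i)"
        unfolding monomial_def by (rule prod.cong) auto
      then show ?thesis by simp
    qed
    have line: "p (x + s *\<^sub>R axis j 1) = (\<Sum>l<N. a l * ((x $ j + s) ^ \<kappa> l j * C l))" for s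
      unfolding p mono C_def by (auto simp: axis_def intro!: sum.cong prod.cong)
    have second: "real (\<kappa> l j * (\<kappa> l j - 1)) * monomial ((\<kappa> l)(j := \<kappa> l j - 2)) x
        = real (\<kappa> l j) * (real (\<kappa> l j - 1) * x $ j ^ (\<kappa> l j - 1 - 1)) * C l" for l
      unfolding mono C_def by (auto simp: numeral_2_eq_2 intro!: prod.cong)
    show ?thesis unfolding line second
    proof (rule deriv2_eqI)
      show "((\<lambda>s. \<Sum>l<N. a l * ((x $ j + s) ^ \<kappa> l j * C l)) has_field_derivative
          (\<Sum>l<N. a l * (real (\<kappa> l j) * (x $ j + s) ^ (\<kappa> l j - 1) * C l))) (at s)" for s
        by (auto intro!: derivative_eq_intros sum.cong)
      show "((\<lambda>s. \<Sum>l<N. a l * (real (\<kappa> l j) * (x $ j + s) ^ (\<kappa> l j - 1) * C l)) has_field_derivative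
          (\<Sum>l<N. a l * (real (\<kappa> l j) * (real (\<kappa> l j - 1) * x $ j ^ (\<kappa> l j - 1 - 1)) * C l))) (at 0)"
        by (auto intro!: derivative_eq_intros sum.cong)
    qed
  qed
  show ?thesis
    unfolding laplacian_def sum_Basis_vec D sum_distrib_left by (rule sum.swap)
qed

text \<open>
  The coefficients of the Jacobi polynomial at \<open>cos (2 t)\<close>, regarded as a form in \<open>cos\<^sup>2 t\<close> and \<open>sin\<^sup>2 t\<close>.
\<close>

definition jacobi_coeff :: "real \<Rightarrow> real \<Rightarrow> nat \<Rightarrow> nat \<Rightarrow> real" where
  "jacobi_coeff \<alpha> \<beta> m s = (-1) ^ s * ((real m + \<alpha>) gchoose (m - s)) * ((real m + \<beta>) gchoose s)"

lemma jacobi_cos: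
  "jacobi \<alpha> \<beta> m (cos (2 * t)) = (\<Sum>s\<le>m. jacobi_coeff \<alpha> \<beta> m s * (cos t)\<^sup>2 ^ (m - s) * (sin t)\<^sup>2 ^ s)"
proof -
  have 1: "(cos (2 * t) - 1) / 2 = - (sin t)\<^sup>2" by (simp add: cos_double_sin)
  have 2: "(cos (2 * t) + 1) / 2 = (cos t)\<^sup>2" by (simp add: cos_double_cos)
  have "(- (sin t)\<^sup>2) ^ s = (-1) ^ s * (sin t)\<^sup>2 ^ s" for s by (rule power_minus)
  then show ?thesis unfolding jacobi_def 1 2 jacobi_coeff_def by (simp add: mult_ac)
qed

lemma gbinomial_Suc_times: "real (Suc k) * ((z::real) gchoose Suc k) = (z - real k) * (z gchoose k)"
  using gbinomial_absorb_comp[of z k] gbinomial_absorption[of k z] by simp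

lemma gbinomial_pos:
  assumes "real k < z + 1" shows "0 < ((z::real) gchoose k)"
  unfolding gbinomial_prod_rev using assms
  by (intro divide_pos_pos prod_pos) auto

text \<open>
  A form in \<open>|a|\<^sup>2\<close> and \<open>|b|\<^sup>2\<close> is harmonic if and only if its coefficients satisfy this recurrence, where
  \<open>\<alpha> + 1\<close> and \<open>\<beta> + 1\<close> are half the dimensions of the spaces of \<open>b\<close> and of \<open>a\<close>. It follows from the absorption
  rule for each of the two binomial coefficients.
\<close>

lemma jacobi_coeff_recurrence:
  assumes "s < m"
  shows "jacobi_coeff \<alpha> \<beta> m (Suc s) * real (Suc s) * (real s + 1 + \<alpha>)
      = - jacobi_coeff \<alpha> \<beta> m s * real (m - s) * (real (m - s) + \<beta>)"
proof -
  obtain r where r: "m - s = Suc r" using assms by (metis Suc_diff_Suc)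
  then have mr: "m - Suc s = r" "real m = real s + real r + 1" using assms by auto
  have 1: "real (Suc r) * ((real m + \<alpha>) gchoose Suc r) = (real s + 1 + \<alpha>) * ((real m + \<alpha>) gchoose r)"
    using gbinomial_Suc_times[of r "real m + \<alpha>"] mr by (simp add: algebra_simps)
  have 2: "real (Suc s) * ((real m + \<beta>) gchoose Suc s) = (real (Suc r) + \<beta>) * ((real m + \<beta>) gchoose s)"
    using gbinomial_Suc_times[of s "real m + \<beta>"] mr by (simp add: algebra_simps)
  have "jacobi_coeff \<alpha> \<beta> m (Suc s) * real (Suc s) * (real s + 1 + \<alpha>)
     = - ((-1) ^ s) * ((real s + 1 + \<alpha>) * ((real m + \<alpha>) gchoose r)) * (real (Suc s) * ((real m + \<beta>) gchoose Suc s))"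
    unfolding jacobi_coeff_def mr by simp
  also have "\<dots> = - jacobi_coeff \<alpha> \<beta> m s * real (m - s) * (real (m - s) + \<beta>)"
    unfolding 1[symmetric] 2 jacobi_coeff_def r by simp
  finally show ?thesis .
qed

lemma jacobi_coeff_0_pos:
  assumes "- 1 < \<alpha>" shows "0 < jacobi_coeff \<alpha> \<beta> m 0"
  unfolding jacobi_coeff_def using assms by (simp add: gbinomial_pos)

text \<open>
  If \<open>x\<close> has unit length both in the coordinates \<open>I\<close> and in the others, \<open>blend I (cos t) (sin t) x\<close> is the
  point of the unit sphere at distance \<open>t\<close> from the coordinate subsphere \<open>I\<close> in the same two directions.
\<close>

definition blend :: "'n set \<Rightarrow> real \<Rightarrow> real \<Rightarrow> real^'n::finite \<Rightarrow> real^'n" where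
  "blend I \<alpha> \<beta> x = (\<chi> i. if i \<in> I then \<alpha> * x $ i else \<beta> * x $ i)"

lemma monomial_blend:
  "monomial \<kappa> (blend I \<alpha> \<beta> x) = \<alpha> ^ (\<Sum>i\<in>I. \<kappa> i) * \<beta> ^ (\<Sum>i\<in>- I. \<kappa> i) * monomial \<kappa> x"
proof -
  have *: "monomial \<kappa> y = (\<Prod>i\<in>I. y $ i ^ \<kappa> i) * (\<Prod>i\<in>- I. y $ i ^ \<kappa> i)" for y :: "real^'a"
    unfolding monomial_def by (subst prod.union_disjoint[symmetric]) auto
  have "monomial \<kappa> (blend I \<alpha> \<beta> x) = (\<Prod>i\<in>I. (\<alpha> * x $ i) ^ \<kappa> i) * (\<Prod>i\<in>- I. (\<beta> * x $ i) ^ \<kappa> i)"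
    unfolding * by (simp add: blend_def)
  then show ?thesis
    by (simp add: *[of x] power_mult_distrib prod.distrib power_sum)
qed

lemma blend_measurable [measurable]: "blend I \<alpha> \<beta> \<in> borel_measurable borel"
proof (rule borel_measurable_continuous_onI)
  show "continuous_on UNIV (blend I \<alpha> \<beta>)"
    unfolding blend_def
  proof (rule continuous_on_vec_lambda)
    fix k show "continuous_on UNIV (\<lambda>x. if k \<in> I then \<alpha> * x $ k else \<beta> * x $ k)"
      by (cases "k \<in> I") (auto intro!: continuous_intros)
  qed
qed

text \<open>
  The average \<open>F(\<alpha>, \<beta>)\<close> of \<open>p (blend I \<alpha> \<beta> x)\<close> is a form \<open>\<Sum>\<^sub>s c\<^sub>s \<alpha>\<^sup>2\<^sup>m\<^sup>-\<^sup>s \<beta>\<^sup>s\<close>. The reflection removes the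
  odd \<open>s\<close>. By \<open>moment_laplacian\<close>, applied to \<open>I\<close> and to its complement, the equation \<open>\<Delta>p = 0\<close> becomes a
  two-term recurrence between \<open>c\<^sub>s\<close> and \<open>c\<^sub>s\<^sub>+\<^sub>2\<close>. The Jacobi coefficients satisfy the same recurrence, so
  \<open>F\<close> is determined by \<open>c\<^sub>0\<close>.
\<close>

lemma harmonic_average_jacobi:
  fixes N :: "(real^'n::finite) measure"
  assumes I: "rotation_invariant N I" and J: "rotation_invariant N (- I)"
    and reflect: "distr N N (blend I 1 (-1)) = N"
    and p: "real_polynomial_function p" and hom: "\<And>c x. p (c *\<^sub>R x) = c ^ (2 * m) * p x"
    and harm: "\<And>x. laplacian p x = 0"
  shows "\<exists>C. \<forall>t. (\<integral>x. p (blend I (cos t) (sin t) x) \<partial>N)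
      = C * jacobi (real (card (- I)) / 2 - 1) (real (card I) / 2 - 1) m (cos (2 * t))"
proof -
  interpret I: rotation_invariant N I by (rule I)
  interpret J: rotation_invariant N "- I" by (rule J)
  obtain L :: nat and a \<kappa> where pL: "\<And>x. p x = (\<Sum>l<L. a l * monomial (\<kappa> l) x)"
    using real_polynomial_function_monomials[OF p] by metis
  define A B where "A l = (\<Sum>i\<in>I. \<kappa> l i)" and "B l = (\<Sum>i\<in>- I. \<kappa> l i)" for l
  define b where "b l = (if A l + B l = 2 * m then a l else 0)" for l
  \<comment> \<open>by homogeneity only the monomials of degree \<open>2 m\<close> contribute\<close>
  have p': "p x = (\<Sum>l<L. b l * monomial (\<kappa> l) x)" for x
  proof -
    have sc: "monomial (\<kappa> l) (c *\<^sub>R x) = c ^ (A l + B l) * monomial (\<kappa> l) x" for l c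
      using monomial_blend[of "\<kappa> l" I c c x] by (simp add: blend_def A_def B_def power_add vec_eq_iff scaleR_vec_def)
    \<comment> \<open>the equation \<open>p (c x) = c\<^sup>2\<^sup>m p x\<close> as an identity between powers of \<open>c\<close>; index \<open>L\<close> stands for the right-hand side\<close>
    have "(\<Sum>l<Suc L. (if l < L then a l * monomial (\<kappa> l) x else - p x) * c ^ (if l < L then A l + B l else 2 * m)) = 0" for c
      using hom[of c x] pL[of "c *\<^sub>R x"] by (simp add: sc mult_ac)
    then have "(\<Sum>l<Suc L. if (if l < L then A l + B l else 2 * m) = 2 * m
        then (if l < L then a l * monomial (\<kappa> l) x else - p x) else 0) = 0"
      by (intro power_sum_eq_zero_coeff) auto
    then have "p x = (\<Sum>l<L. if A l + B l = 2 * m then if l < L then a l * monomial (\<kappa> l) x else - p x else 0)" by simp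
    also have "\<dots> = (\<Sum>l<L. b l * monomial (\<kappa> l) x)" by (intro sum.cong) (auto simp: b_def)
    finally show ?thesis .
  qed
  define M where "M l = I.moment (\<kappa> l)" for l
  define c where "c s = (\<Sum>l<L. if B l = s then b l * M l else 0)" for s
  define P Q where "P = real (card I)" and "Q = real (card (- I))"
  have int: "integrable N (\<lambda>x. b l * monomial \<kappa>' x)" for l \<kappa>'
    by (intro integrable_mult_right I.integrable_monomial)
  have F: "(\<integral>x. p (blend I \<alpha> \<beta> x) \<partial>N) = (\<Sum>s\<le>2*m. c s * \<alpha> ^ (2 * m - s) * \<beta> ^ s)" for \<alpha> \<beta>
  proof -
    have "(\<integral>x. p (blend I \<alpha> \<beta> x) \<partial>N) = (\<integral>x. (\<Sum>l<L. \<alpha> ^ A l * \<beta> ^ B l * (b l * monomial (\<kappa> l) x)) \<partial>N)"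
      unfolding p' monomial_blend A_def B_def by (simp add: mult_ac)
    also have "\<dots> = (\<Sum>l<L. \<alpha> ^ A l * \<beta> ^ B l * (b l * M l))"
      unfolding M_def by (subst Bochner_Integration.integral_sum) (auto intro!: integrable_mult_right int I.integrable_monomial)
    also have "\<dots> = (\<Sum>l<L. \<Sum>s\<le>2*m. if B l = s then b l * M l * \<alpha> ^ (2 * m - s) * \<beta> ^ s else 0)"
    proof (rule sum.cong[OF refl])
      fix l assume "l \<in> {..<L}"
      show "\<alpha> ^ A l * \<beta> ^ B l * (b l * M l) = (\<Sum>s\<le>2*m. if B l = s then b l * M l * \<alpha> ^ (2 * m - s) * \<beta> ^ s else 0)"
      proof (cases "A l + B l = 2 * m")
        case True
        then have "A l = 2 * m - B l" "B l \<le> 2 * m" by auto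
        then show ?thesis by (simp add: sum.delta mult_ac)
      qed (simp add: b_def)
    qed
    also have "\<dots> = (\<Sum>s\<le>2*m. \<Sum>l<L. if B l = s then b l * M l * \<alpha> ^ (2 * m - s) * \<beta> ^ s else 0)"
      by (rule sum.swap)
    also have "\<dots> = (\<Sum>s\<le>2*m. c s * \<alpha> ^ (2 * m - s) * \<beta> ^ s)"
      unfolding c_def sum_distrib_right by (intro sum.cong) auto
    finally show ?thesis .
  qed
  have c_odd: "c s = 0" if "odd s" for s
  proof -
    have "M l = (-1) ^ B l * M l" for l
    proof -
      have "M l = (\<integral>x. monomial (\<kappa> l) x \<partial>distr N N (blend I 1 (-1)))" by (simp add: M_def reflect)
      also have "\<dots> = (\<integral>x. monomial (\<kappa> l) (blend I 1 (-1) x) \<partial>N)" by (rule integral_distr) auto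
      finally show ?thesis unfolding monomial_blend B_def M_def by simp
    qed
    then have "M l = 0" if "odd (B l)" for l using that by (metis minus_one_power_iff mult_minus1 neg_equal_zero)
    then show ?thesis using that unfolding c_def by (intro sum.neutral) auto
  qed
  have rec: "c s * ((2 * real m - real s) * (2 * real m - real s + P - 2))
      + c (s + 2) * ((real s + 2) * (real s + Q)) = 0" for s
  proof -
    let ?D = "\<lambda>l j. real (\<kappa> l j * (\<kappa> l j - 1))" and ?\<kappa> = "\<lambda>l j. (\<kappa> l)(j := \<kappa> l j - 2)"
    \<comment> \<open>the integral of \<open>\<Delta>p\<close> over \<open>blend I 1 \<beta>\<close> as a sum of \<open>2 L\<close> powers of \<open>\<beta>\<close>: the first \<open>L\<close> terms come from
      derivatives in the coordinates \<open>I\<close>, the others, where \<open>\<beta>\<close> loses two powers, from the remaining ones\<close>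
    define e where "e l = (if l < L then b l * (real (A l) * (real (A l) + P - 2) * M l)
        else b (l - L) * (real (B (l - L)) * (real (B (l - L)) + Q - 2) * M (l - L)))" for l
    define d where "d l = (if l < L then B l else B (l - L) - 2)" for l
    have "(\<Sum>l<2 * L. e l * \<beta> ^ d l) = 0" for \<beta>
    proof -
      have split: "(\<Sum>j\<in>UNIV. g j) = (\<Sum>j\<in>I. g j) + (\<Sum>j\<in>-I. g j)" for g :: "'n \<Rightarrow> real"
        by (subst sum.union_disjoint[symmetric]) auto
      have "0 = (\<integral>x. laplacian p (blend I 1 \<beta> x) \<partial>N)" by (simp add: harm)
      also have "\<dots> = (\<integral>x. (\<Sum>l<L. b l * (\<Sum>j\<in>UNIV. ?D l j * monomial (?\<kappa> l j) (blend I 1 \<beta> x))) \<partial>N)"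
        by (simp only: laplacian_monomials[OF p'])
      also have "\<dots> = (\<Sum>l<L. b l * (\<Sum>j\<in>UNIV. ?D l j * (\<beta> ^ (\<Sum>i\<in>- I. ?\<kappa> l j i) * I.moment (?\<kappa> l j))))"
        unfolding monomial_blend
        by (simp add: Bochner_Integration.integral_sum I.integrable_monomial)
      also have "\<dots> = (\<Sum>l<L. b l * (\<beta> ^ B l * (\<Sum>j\<in>I. ?D l j * I.moment (?\<kappa> l j))
          + \<beta> ^ (B l - 2) * (\<Sum>j\<in>-I. ?D l j * I.moment (?\<kappa> l j))))"
      proof (intro sum.cong refl arg_cong[where f="(*) (b _)"])
        fix l assume "l \<in> {..<L}"
        have 1: "?D l j * (\<beta> ^ (\<Sum>i\<in>- I. ?\<kappa> l j i) * I.moment (?\<kappa> l j)) = \<beta> ^ B l * (?D l j * I.moment (?\<kappa> l j))"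
          if "j \<in> I" for j
        proof -
          have "(\<Sum>i\<in>- I. ?\<kappa> l j i) = B l" unfolding B_def using that by (intro sum.cong) auto
          then show ?thesis by simp
        qed
        have 2: "?D l j * (\<beta> ^ (\<Sum>i\<in>- I. ?\<kappa> l j i) * I.moment (?\<kappa> l j)) = \<beta> ^ (B l - 2) * (?D l j * I.moment (?\<kappa> l j))"
          if "j \<in> - I" for j
        proof (cases "\<kappa> l j \<ge> 2")
          case True
          have "(\<Sum>i\<in>- I. ?\<kappa> l j i) = (\<kappa> l j - 2) + (\<Sum>i\<in>- I - {j}. \<kappa> l i)"
            using that by (subst sum.remove[of _ j]) auto
          moreover have "B l = \<kappa> l j + (\<Sum>i\<in>- I - {j}. \<kappa> l i)"
            unfolding B_def using that by (subst sum.remove[of _ j]) auto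
          ultimately show ?thesis using True by simp
        next
          case False
          then have "\<kappa> l j = 0 \<or> \<kappa> l j = 1" by auto
          then show ?thesis by auto
        qed
        show "(\<Sum>j\<in>UNIV. ?D l j * (\<beta> ^ (\<Sum>i\<in>- I. ?\<kappa> l j i) * I.moment (?\<kappa> l j))) =
           \<beta> ^ B l * (\<Sum>j\<in>I. ?D l j * I.moment (?\<kappa> l j)) + \<beta> ^ (B l - 2) * (\<Sum>j\<in>-I. ?D l j * I.moment (?\<kappa> l j))"
          unfolding split sum_distrib_left using 1 2 by (auto intro!: arg_cong2[where f="(+)"] sum.cong)
      qed
      also have "\<dots> = (\<Sum>l<L. b l * (\<beta> ^ B l * (real (A l) * (real (A l) + P - 2) * M l)
          + \<beta> ^ (B l - 2) * (real (B l) * (real (B l) + Q - 2) * M l)))"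
        unfolding I.moment_laplacian J.moment_laplacian A_def B_def P_def Q_def M_def ..
      also have "\<dots> = (\<Sum>l<L. e l * \<beta> ^ d l) + (\<Sum>l<L. e (l + L) * \<beta> ^ d (l + L))"
        unfolding sum.distrib[symmetric] by (intro sum.cong refl) (auto simp: e_def d_def algebra_simps)
      also have "(\<Sum>l<L. e (l + L) * \<beta> ^ d (l + L)) = (\<Sum>l\<in>{L..<2*L}. e l * \<beta> ^ d l)"
        by (rule sum.reindex_bij_witness[of _ "\<lambda>l. l - L" "\<lambda>l. l + L"]) auto
      also have "(\<Sum>l<L. e l * \<beta> ^ d l) + \<dots> = (\<Sum>l<2 * L. e l * \<beta> ^ d l)"
        by (subst sum.union_disjoint[symmetric]) (auto intro!: sum.cong)
      finally show ?thesis by simp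
    qed
    then have "(\<Sum>l<2 * L. if d l = s then e l else 0) = 0"
      by (intro power_sum_eq_zero_coeff) auto
    also have "(\<Sum>l<2 * L. if d l = s then e l else 0)
        = (\<Sum>l<L. if d l = s then e l else 0) + (\<Sum>l\<in>{L..<2*L}. if d l = s then e l else 0)"
      by (subst sum.union_disjoint[symmetric]) (auto intro!: sum.cong)
    also have "(\<Sum>l\<in>{L..<2*L}. if d l = s then e l else 0) = (\<Sum>l<L. if d (l + L) = s then e (l + L) else 0)"
      by (rule sum.reindex_bij_witness[of _ "\<lambda>l. l + L" "\<lambda>l. l - L"]) auto
    also have "\<dots> = c (s + 2) * ((real s + 2) * (real s + Q))"
      unfolding c_def sum_distrib_right
    proof (rule sum.cong[OF refl])
      fix l assume "l \<in> {..<L}"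
      show "(if d (l + L) = s then e (l + L) else 0) =
          (if B l = s + 2 then b l * M l else 0) * ((real s + 2) * (real s + Q))"
      proof (cases "B l \<ge> 2")
        case True
        then show ?thesis by (auto simp: d_def e_def)
      next
        case False
        then have "B l = 0 \<or> B l = 1" by auto
        moreover have "real (B l) * (real (B l) + Q - 2) * M l = 0"
        proof -
          have "(\<Sum>j\<in>- I. ?D l j * J.moment (?\<kappa> l j)) = 0"
          proof (rule sum.neutral, rule ballI)
            fix j assume j: "j \<in> - I"
            have "\<kappa> l j \<le> B l" unfolding B_def using j by (intro member_le_sum) auto
            then have "\<kappa> l j = 0 \<or> \<kappa> l j = 1" using False by auto
            then show "?D l j * J.moment (?\<kappa> l j) = 0" by auto
          qed
          then show ?thesis using J.moment_laplacian[of "\<kappa> l"] unfolding B_def Q_def M_def by simp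
        qed
        ultimately show ?thesis using False by (auto simp: d_def e_def)
      qed
    qed
    also have "(\<Sum>l<L. if d l = s then e l else 0) = c s * ((2 * real m - real s) * (2 * real m - real s + P - 2))"
      unfolding c_def sum_distrib_right
    proof (rule sum.cong[OF refl])
      fix l assume "l \<in> {..<L}"
      then show "(if d l = s then e l else 0) =
          (if B l = s then b l * M l else 0) * ((2 * real m - real s) * (2 * real m - real s + P - 2))"
      proof (cases "A l + B l = 2 * m")
        case True
        then have "real (A l) = 2 * real m - real (B l)" by (metis add_diff_cancel_right' of_nat_add of_nat_mult of_nat_numeral)
        then show ?thesis using \<open>l \<in> {..<L}\<close> by (auto simp: d_def e_def)
      qed (auto simp: b_def e_def)
    qed
    finally show ?thesis .
  qed
  define \<sigma> \<rho> where "\<sigma> = Q / 2 - 1" and "\<rho> = P / 2 - 1"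
  have "- I \<noteq> {}"
  proof
    assume "- I = {}"
    then have "AE x in N. False" using J.sphere_N by simp
    then show False using I.AE_False by simp
  qed
  then have Q1: "Q \<ge> 1" unfolding Q_def by (simp add: Suc_le_eq card_gt_0_iff)
  then have \<sigma>: "- 1 < \<sigma>" unfolding \<sigma>_def by simp
  define C where "C = c 0 / jacobi_coeff \<sigma> \<rho> m 0"
  have cC: "c (2 * s) = C * jacobi_coeff \<sigma> \<rho> m s" if "s \<le> m" for s
    using that
  proof (induction s)
    case 0
    then show ?case using jacobi_coeff_0_pos[OF \<sigma>, of \<rho> m] by (simp add: C_def)
  next
    case (Suc s)
    then have IH: "c (2 * s) = C * jacobi_coeff \<sigma> \<rho> m s" and s: "s < m" by auto
    have ms: "real (m - s) = real m - real s" using s by simp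
    have "c (2 * Suc s) * (real (Suc s) * (real s + 1 + \<sigma>)) = - c (2 * s) * (real (m - s) * (real (m - s) + \<rho>))"
      using rec[of "2 * s"] unfolding ms \<sigma>_def \<rho>_def by (simp add: field_simps)
    also have "\<dots> = C * (- jacobi_coeff \<sigma> \<rho> m s * real (m - s) * (real (m - s) + \<rho>))"
      by (simp add: IH)
    also have "\<dots> = C * jacobi_coeff \<sigma> \<rho> m (Suc s) * (real (Suc s) * (real s + 1 + \<sigma>))"
      unfolding jacobi_coeff_recurrence[OF s, of \<sigma> \<rho>, symmetric] by (simp only: mult.assoc)
    finally show ?case using \<sigma> by (simp add: add_pos_pos add_nonneg_pos)
  qed
  have "(\<integral>x. p (blend I (cos t) (sin t) x) \<partial>N) = C * jacobi \<sigma> \<rho> m (cos (2 * t))" for t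
  proof -
    have "(\<integral>x. p (blend I (cos t) (sin t) x) \<partial>N) = (\<Sum>s\<in>{..2*m}. c s * cos t ^ (2 * m - s) * sin t ^ s)"
      by (rule F)
    also have "\<dots> = (\<Sum>s\<in>(\<lambda>s. 2 * s) ` {..m}. c s * cos t ^ (2 * m - s) * sin t ^ s)"
      by (rule sum.mono_neutral_right) (auto simp: c_odd elim!: evenE, metis (no_types, lifting) atMost_iff c_odd evenE imageI mult_le_cancel1 zero_less_numeral)
    also have "\<dots> = (\<Sum>s\<le>m. c (2 * s) * cos t ^ (2 * m - 2 * s) * sin t ^ (2 * s))"
      by (subst sum.reindex) (auto simp: inj_on_def)
    also have "\<dots> = (\<Sum>s\<le>m. C * (jacobi_coeff \<sigma> \<rho> m s * (cos t)\<^sup>2 ^ (m - s) * (sin t)\<^sup>2 ^ s))"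
      by (intro sum.cong) (auto simp: cC power_mult diff_mult_distrib2[symmetric])
    finally show ?thesis by (simp add: jacobi_cos sum_distrib_left)
  qed
  then show ?thesis unfolding \<sigma>_def \<rho>_def P_def Q_def by blast
qed

section \<open>The harmonics attached to a great subsphere\<close>

text \<open>
  The second derivative in a direction \<open>b\<close> is a quadratic form in \<open>b\<close>. Hence the Laplacian is the trace of
  its matrix, and a trace does not depend on the orthonormal basis.
\<close>

lemma polynomial_gradient_hessian:
  assumes "real_polynomial_function (p :: real^'n::finite \<Rightarrow> real)"
  shows "\<exists>(G :: real^'n \<Rightarrow> real^'n) (H :: real^'n \<Rightarrow> real^'n^'n).
    (\<forall>x b. ((\<lambda>s. p (x + s *\<^sub>R b)) has_field_derivative G x \<bullet> b) (at 0)) \<and>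
    (\<forall>x b. ((\<lambda>s. G (x + s *\<^sub>R b) \<bullet> b) has_field_derivative b \<bullet> (H x *v b)) (at 0))"
  using assms
proof (induction rule: real_polynomial_function.induct)
  case (linear f)
  obtain g where g: "\<And>x. f x = g \<bullet> x"
    using linear by (metis bounded_linear.linear adjoint_works inner_real_def mult.right_neutral inner_commute)
  show ?case
    by (intro exI[of _ "\<lambda>_. g"] exI[of _ "\<lambda>_. 0"])
       (auto simp: g inner_right_distrib matrix_vector_mult_def zero_vec_def[symmetric] intro!: derivative_eq_intros)
next
  case (const c)
  show ?case by (intro exI[of _ "\<lambda>_. 0"] exI[of _ "\<lambda>_. 0"]) auto
next
  case (add f g)
  then obtain G H G' H' where *:
    "\<And>x b. ((\<lambda>s. f (x + s *\<^sub>R b)) has_field_derivative G x \<bullet> b) (at 0)"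
    "\<And>x b. ((\<lambda>s. G (x + s *\<^sub>R b) \<bullet> b) has_field_derivative b \<bullet> (H x *v b)) (at 0)"
    "\<And>x b. ((\<lambda>s. g (x + s *\<^sub>R b)) has_field_derivative G' x \<bullet> b) (at 0)"
    "\<And>x b. ((\<lambda>s. G' (x + s *\<^sub>R b) \<bullet> b) has_field_derivative b \<bullet> (H' x *v b)) (at 0)"
    by blast
  show ?case
    by (intro exI[of _ "\<lambda>x. G x + G' x"] exI[of _ "\<lambda>x. H x + H' x"])
       (auto simp: inner_add_left inner_add_right matrix_vector_mult_add_rdistrib intro!: derivative_eq_intros *)
next
  case (mult f g)
  then obtain G H G' H' where *:
    "\<And>x b. ((\<lambda>s. f (x + s *\<^sub>R b)) has_field_derivative G x \<bullet> b) (at 0)"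
    "\<And>x b. ((\<lambda>s. G (x + s *\<^sub>R b) \<bullet> b) has_field_derivative b \<bullet> (H x *v b)) (at 0)"
    "\<And>x b. ((\<lambda>s. g (x + s *\<^sub>R b)) has_field_derivative G' x \<bullet> b) (at 0)"
    "\<And>x b. ((\<lambda>s. G' (x + s *\<^sub>R b) \<bullet> b) has_field_derivative b \<bullet> (H' x *v b)) (at 0)"
    by blast
  let ?H = "\<lambda>x. f x *\<^sub>R H' x + g x *\<^sub>R H x + (\<chi> i j. 2 * G x $ i * G' x $ j)"
  have out: "b \<bullet> ((\<chi> i j. 2 * u $ i * v $ j) *v b) = 2 * (u \<bullet> b) * (v \<bullet> b)" for u v b :: "real^'n"
  proof -
    have "(\<chi> i j. 2 * u $ i * v $ j) *v b = (2 * (v \<bullet> b)) *\<^sub>R u"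
      by (simp add: vec_eq_iff matrix_vector_mult_def inner_vec_def sum_distrib_left sum_distrib_right mult_ac)
    then show ?thesis by (simp add: inner_commute)
  qed
  have bH: "b \<bullet> (?H x *v b) = f x * (b \<bullet> (H' x *v b)) + g x * (b \<bullet> (H x *v b)) + 2 * (G x \<bullet> b) * (G' x \<bullet> b)" for x b
    by (simp add: matrix_vector_mult_add_rdistrib inner_add_right scaleR_matrix_vector_assoc[symmetric] out)
  show ?case
  proof (intro exI[of _ "\<lambda>x. f x *\<^sub>R G' x + g x *\<^sub>R G x"] exI[of _ ?H] conjI allI)
    fix x b
    show "((\<lambda>s. f (x + s *\<^sub>R b) * g (x + s *\<^sub>R b)) has_field_derivative (f x *\<^sub>R G' x + g x *\<^sub>R G x) \<bullet> b) (at 0)"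
      by (auto simp: inner_add_left intro!: derivative_eq_intros *)
    show "((\<lambda>s. (f (x + s *\<^sub>R b) *\<^sub>R G' (x + s *\<^sub>R b) + g (x + s *\<^sub>R b) *\<^sub>R G (x + s *\<^sub>R b)) \<bullet> b)
        has_field_derivative b \<bullet> (?H x *v b)) (at 0)"
      unfolding bH
      by (auto simp: inner_add_left algebra_simps intro!: derivative_eq_intros *)
  qed
qed

text \<open>
  At \<open>r x\<close> the Hessian \<open>H\<close> of \<open>p\<close> becomes \<open>r\<^sup>T H r\<close>, which has the same trace.
\<close>

lemma laplacian_orthogonal:
  fixes p :: "real^'n::finite \<Rightarrow> real"
  assumes p: "real_polynomial_function p" and r: "orthogonal_matrix r"
  shows "laplacian (\<lambda>x. p (r *v x)) x = laplacian p (r *v x)"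
proof -
  obtain G H where
    G: "\<And>x b. ((\<lambda>s. p (x + s *\<^sub>R b)) has_field_derivative G x \<bullet> b) (at 0)" and
    H: "\<And>x b. ((\<lambda>s. G (x + s *\<^sub>R b) \<bullet> b) has_field_derivative b \<bullet> (H x *v b)) (at 0)"
    using polynomial_gradient_hessian[OF p] by blast
  have D: "(deriv ^^ 2) (\<lambda>s. p (x + s *\<^sub>R b)) 0 = b \<bullet> (H x *v b)" for x b
  proof (rule deriv2_eqI[OF _ H])
    fix s :: real
    show "((\<lambda>s. p (x + s *\<^sub>R b)) has_field_derivative G (x + s *\<^sub>R b) \<bullet> b) (at s)"
      using G[of "x + s *\<^sub>R b" b] DERIV_shift[of "\<lambda>s. p (x + s *\<^sub>R b)" _ 0 s]
      by (simp add: algebra_simps)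
  qed
  have tr: "(\<Sum>j\<in>UNIV. axis j 1 \<bullet> (A *v axis j 1)) = trace A" for A :: "real^'n^'n"
    by (simp add: trace_def inner_axis' matrix_vector_mult_basis column_def)
  have rb: "(r *v b) \<bullet> (A *v (r *v b)) = b \<bullet> ((transpose r ** A ** r) *v b)" for A and b :: "real^'n"
    by (simp add: dot_lmul_matrix[symmetric] matrix_vector_mul_assoc[symmetric] matrix_mul_assoc[symmetric] vector_transpose_matrix
        flip: transpose_matrix_vector)
  have "laplacian (\<lambda>x. p (r *v x)) x = (\<Sum>j\<in>UNIV. axis j 1 \<bullet> ((transpose r ** H (r *v x) ** r) *v axis j 1))"
    unfolding laplacian_def sum_Basis_vec
    by (simp add: matrix_vector_right_distrib matrix_vector_mult_scaleR D rb)
  also have "\<dots> = trace (r ** (transpose r ** H (r *v x)))"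
    unfolding tr by (rule trace_mul_sym)
  also have "\<dots> = trace (H (r *v x))"
    using r by (simp add: matrix_mul_assoc orthogonal_matrix_def)
  also have "\<dots> = laplacian p (r *v x)"
    unfolding laplacian_def sum_Basis_vec D tr ..
  finally show ?thesis .
qed

text \<open>
  If \<open>P\<close> is the projection onto the normal space of a great subsphere and \<open>y\<close> a unit vector at distance \<open>t\<close>
  from it, the two norms are \<open>cos t\<close> and \<open>sin t\<close>. So this is the value of the Jacobi polynomial at
  \<open>cos (2 t)\<close>, extended from the sphere to a form of degree \<open>2 m\<close>.
\<close>

definition latitude_form :: "real \<Rightarrow> real \<Rightarrow> nat \<Rightarrow> real^'n^'n \<Rightarrow> real^'n::finite \<Rightarrow> real" where
  "latitude_form \<alpha> \<beta> m P y =
     (\<Sum>s\<le>m. jacobi_coeff \<alpha> \<beta> m s * ((norm (y - P *v y))\<^sup>2) ^ (m - s) * ((norm (P *v y))\<^sup>2) ^ s)"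

definition coord_proj :: "'n set \<Rightarrow> real^'n^'n::finite" where
  "coord_proj J = (\<chi> i j. if i = j \<and> i \<in> J then 1 else 0)"

lemma coord_proj_mult: "coord_proj J *v x = (\<chi> i. if i \<in> J then x $ i else 0)"
  by (auto simp: coord_proj_def matrix_vector_mult_def vec_eq_iff if_distrib[where f="\<lambda>a. a * _"] sum.delta' cong: if_cong)

lemma latitude_form_coord:
  "latitude_form \<alpha> \<beta> m (coord_proj (- I)) y =
     (\<Sum>s\<le>m. jacobi_coeff \<alpha> \<beta> m s * (\<Sum>i\<in>I. (y $ i)\<^sup>2) ^ (m - s) * (\<Sum>i\<in>- I. (y $ i)\<^sup>2) ^ s)"
proof -
  have 1: "(norm (y - coord_proj (- I) *v y))\<^sup>2 = (\<Sum>i\<in>I. (y $ i)\<^sup>2)"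
    unfolding coord_proj_mult norm_vec_def L2_set_def
    by (auto simp: sum_nonneg if_distrib sum.If_cases Int_def intro!: sum.mono_neutral_cong_right)
  have 2: "(norm (coord_proj (- I) *v y))\<^sup>2 = (\<Sum>i\<in>- I. (y $ i)\<^sup>2)"
    unfolding coord_proj_mult norm_vec_def L2_set_def
    by (auto simp: sum_nonneg if_distrib sum.If_cases Int_def intro!: sum.mono_neutral_cong_right)
  show ?thesis unfolding latitude_form_def 1 2 ..
qed

lemma latitude_form_polynomial: "real_polynomial_function (latitude_form \<alpha> \<beta> m P)"
proof -
  have n: "real_polynomial_function (\<lambda>y. (norm (A *v y))\<^sup>2)" for A :: "real^'a^'a"
  proof -
    have "bounded_linear (\<lambda>y. (A *v y) $ i)" for i
      by (rule bounded_linear_compose[OF bounded_linear_vec_nth matrix_vector_mul_bounded_linear])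
    moreover have "(norm (A *v y))\<^sup>2 = (\<Sum>i\<in>UNIV. ((A *v y) $ i)\<^sup>2)" for y
      by (simp add: norm_vec_def L2_set_def sum_nonneg)
    ultimately show ?thesis
      by (simp only:) (intro real_polynomial_function_sum real_polynomial_function_power real_polynomial_function.intros(1) finite_UNIV, simp)
  qed
  have "y - P *v y = (mat 1 - P) *v y" for y by (simp add: matrix_vector_mult_diff_rdistrib)
  then show ?thesis
    unfolding latitude_form_def
    by (simp only:) (intro real_polynomial_function_sum real_polynomial_function.intros(2-) real_polynomial_function_power n finite_atMost)
qed

lemma latitude_form_scale: "latitude_form \<alpha> \<beta> m P (c *\<^sub>R y) = c ^ (2 * m) * latitude_form \<alpha> \<beta> m P y"
proof -
  have n: "(norm (c *\<^sub>R y - P *v (c *\<^sub>R y)))\<^sup>2 = c\<^sup>2 * (norm (y - P *v y))\<^sup>2"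
    "(norm (P *v (c *\<^sub>R y)))\<^sup>2 = c\<^sup>2 * (norm (P *v y))\<^sup>2"
    by (simp_all add: matrix_vector_mult_scaleR power_mult_distrib flip: scaleR_diff_right)
  have "(c\<^sup>2) ^ (m - s) * (c\<^sup>2) ^ s = c ^ (2 * m)" if "s \<le> m" for s
    using that by (simp add: power_mult[symmetric] power_add[symmetric] diff_mult_distrib2)
  then have "a * (c\<^sup>2 * u) ^ (m - s) * (c\<^sup>2 * v) ^ s = c ^ (2 * m) * (a * u ^ (m - s) * v ^ s)"
    if "s \<le> m" for s and a u v :: real
    using that by (simp add: power_mult_distrib mult_ac)
  then show ?thesis
    unfolding latitude_form_def n sum_distrib_left by (intro sum.cong refl) auto
qed

text \<open>
  For the squared norm \<open>A\<close> of the part of \<open>y\<close> in the coordinates \<open>I\<close>, \<open>\<Delta>(A\<^sup>a) = 4 a (a - 1 + |I|/2) A\<^sup>a\<^sup>-\<^sup>1\<close>.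
  Thus the Laplacian of the form is a sum of two series, which cancel after a shift by one.
\<close>

lemma latitude_form_harmonic_coord:
  fixes I :: "'n::finite set"
  assumes "- I \<noteq> {}"
  shows "laplacian (latitude_form (real (card (- I)) / 2 - 1) (real (card I) / 2 - 1) m (coord_proj (- I))) y = 0"
proof -
  define \<alpha> \<beta> where ab: "\<alpha> = real (card (- I)) / 2 - 1" "\<beta> = real (card I) / 2 - 1"
  define A where "A y = (\<Sum>i\<in>I. (y $ i)\<^sup>2)" for y :: "real^'n"
  define B where "B y = (\<Sum>i\<in>- I. (y $ i)\<^sup>2)" for y :: "real^'n"
  define c where "c = jacobi_coeff \<alpha> \<beta> m"
  have shift: "(\<Sum>i\<in>K. ((y + s *\<^sub>R axis j 1) $ i)\<^sup>2) = (\<Sum>i\<in>K. (y $ i)\<^sup>2) + (if j \<in> K then 2 * s * y $ j + s\<^sup>2 else 0)" for s j K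
  proof (cases "j \<in> K")
    case True
    have "(\<Sum>i\<in>K. ((y + s *\<^sub>R axis j 1) $ i)\<^sup>2) = (\<Sum>i\<in>K. (y $ i)\<^sup>2 + (if i = j then 2 * s * y $ j + s\<^sup>2 else 0))"
      by (intro sum.cong) (auto simp: axis_def power2_sum)
    then show ?thesis using True by (simp add: sum.distrib)
  next
    case False
    then show ?thesis by (auto simp: axis_def intro!: sum.cong)
  qed
  define U where "U j = 4 * (y $ j)\<^sup>2" for j
  have dI: "(deriv ^^ 2) (\<lambda>s. latitude_form \<alpha> \<beta> m (coord_proj (- I)) (y + s *\<^sub>R axis j 1)) 0
      = (\<Sum>s\<le>m. c s * (real (m - s) * (real (m - s - 1) * A y ^ (m - s - 2) * U j + 2 * A y ^ (m - s - 1))) * B y ^ s)"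
    if "j \<in> I" for j
    unfolding latitude_form_coord shift c_def[symmetric] A_def[symmetric] B_def[symmetric] using that
    by (intro deriv2_eqI[where f'="\<lambda>u. \<Sum>s\<le>m. c s * (real (m - s) * (A y + (2 * u * y $ j + u\<^sup>2)) ^ (m - s - 1) * (2 * y $ j + 2 * u)) * B y ^ s"])
       (auto intro!: derivative_eq_intros sum.cong simp: U_def power2_eq_square algebra_simps numeral_2_eq_2)
  have dJ: "(deriv ^^ 2) (\<lambda>s. latitude_form \<alpha> \<beta> m (coord_proj (- I)) (y + s *\<^sub>R axis j 1)) 0
      = (\<Sum>s\<le>m. c s * A y ^ (m - s) * (real s * (real (s - 1) * B y ^ (s - 2) * U j + 2 * B y ^ (s - 1))))"
    if "j \<in> - I" for j
    unfolding latitude_form_coord shift c_def[symmetric] A_def[symmetric] B_def[symmetric] using that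
    by (intro deriv2_eqI[where f'="\<lambda>u. \<Sum>s\<le>m. c s * A y ^ (m - s) * (real s * (B y + (2 * u * y $ j + u\<^sup>2)) ^ (s - 1) * (2 * y $ j + 2 * u))"])
       (auto intro!: derivative_eq_intros sum.cong simp: U_def power2_eq_square algebra_simps numeral_2_eq_2)
  have pw: "real a * real (a - 1) * z ^ (a - 2) * z = real a * real (a - 1) * z ^ (a - 1)" for a and z :: real
  proof (cases "a \<ge> 2")
    case True
    then have "a - 1 = Suc (a - 2)" by simp
    then show ?thesis by simp
  next
    case False
    then have "a = 0 \<or> a = 1" by auto
    then show ?thesis by auto
  qed
  have comb: "(\<Sum>j\<in>K. real a * (real (a - 1) * z ^ (a - 2) * U j + 2 * z ^ (a - 1)))
      = 4 * real a * (real a - 1 + real (card K) / 2) * z ^ (a - 1)" if z: "z = (\<Sum>i\<in>K. (y $ i)\<^sup>2)" for K a z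
  proof -
    have "(\<Sum>j\<in>K. U j) = 4 * z" unfolding U_def z by (simp add: sum_distrib_left)
    then have "(\<Sum>j\<in>K. real a * (real (a - 1) * z ^ (a - 2) * U j + 2 * z ^ (a - 1)))
        = 4 * (real a * real (a - 1) * z ^ (a - 2) * z) + real (card K) * (real a * (2 * z ^ (a - 1)))"
      by (simp add: distrib_left sum.distrib sum_distrib_left[symmetric])
    also have "\<dots> = 4 * (real a * real (a - 1)) * z ^ (a - 1) + real (card K) * (real a * (2 * z ^ (a - 1)))"
      unfolding pw by simp
    also have "real a * real (a - 1) = real a * (real a - 1)" by (cases a) auto
    finally show ?thesis by (simp add: algebra_simps)
  qed
  define f where "f s = c s * (4 * real (m - s) * (real (m - s) + \<beta>)) * A y ^ (m - s - 1) * B y ^ s" for s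
  define g where "g s = c s * A y ^ (m - s) * (4 * real s * (real s + \<alpha>) * B y ^ (s - 1))" for s
  have "laplacian (latitude_form \<alpha> \<beta> m (coord_proj (- I))) y
      = (\<Sum>j\<in>I. (deriv ^^ 2) (\<lambda>s. latitude_form \<alpha> \<beta> m (coord_proj (- I)) (y + s *\<^sub>R axis j 1)) 0)
      + (\<Sum>j\<in>-I. (deriv ^^ 2) (\<lambda>s. latitude_form \<alpha> \<beta> m (coord_proj (- I)) (y + s *\<^sub>R axis j 1)) 0)"
    unfolding laplacian_def sum_Basis_vec by (subst sum.union_disjoint[symmetric]) auto
  also have "(\<Sum>j\<in>I. (deriv ^^ 2) (\<lambda>s. latitude_form \<alpha> \<beta> m (coord_proj (- I)) (y + s *\<^sub>R axis j 1)) 0) = (\<Sum>s\<le>m. f s)"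
  proof -
    have "(\<Sum>j\<in>I. (deriv ^^ 2) (\<lambda>s. latitude_form \<alpha> \<beta> m (coord_proj (- I)) (y + s *\<^sub>R axis j 1)) 0)
      = (\<Sum>j\<in>I. \<Sum>s\<le>m. c s * (real (m - s) * (real (m - s - 1) * A y ^ (m - s - 2) * U j + 2 * A y ^ (m - s - 1))) * B y ^ s)"
      by (rule sum.cong[OF refl dI])
    also have "\<dots> = (\<Sum>s\<le>m. c s * (\<Sum>j\<in>I. real (m - s) * (real (m - s - 1) * A y ^ (m - s - 2) * U j + 2 * A y ^ (m - s - 1))) * B y ^ s)"
      by (subst sum.swap) (simp only: sum_distrib_left sum_distrib_right)
    also have "\<dots> = (\<Sum>s\<le>m. f s)"
      unfolding comb[OF A_def] f_def ab by (simp add: algebra_simps)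
    finally show ?thesis .
  qed
  also have "(\<Sum>j\<in>-I. (deriv ^^ 2) (\<lambda>s. latitude_form \<alpha> \<beta> m (coord_proj (- I)) (y + s *\<^sub>R axis j 1)) 0) = (\<Sum>s\<le>m. g s)"
  proof -
    have "(\<Sum>j\<in>-I. (deriv ^^ 2) (\<lambda>s. latitude_form \<alpha> \<beta> m (coord_proj (- I)) (y + s *\<^sub>R axis j 1)) 0)
      = (\<Sum>j\<in>-I. \<Sum>s\<le>m. c s * A y ^ (m - s) * (real s * (real (s - 1) * B y ^ (s - 2) * U j + 2 * B y ^ (s - 1))))"
      by (rule sum.cong[OF refl dJ])
    also have "\<dots> = (\<Sum>s\<le>m. c s * A y ^ (m - s) * (\<Sum>j\<in>-I. real s * (real (s - 1) * B y ^ (s - 2) * U j + 2 * B y ^ (s - 1))))"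
      by (subst sum.swap) (simp only: sum_distrib_left)
    also have "\<dots> = (\<Sum>s\<le>m. g s)"
      unfolding comb[OF B_def] g_def ab by (simp add: algebra_simps)
    finally show ?thesis .
  qed
  also have "(\<Sum>s\<le>m. f s) + (\<Sum>s\<le>m. g s) = 0"
  proof (cases m)
    case 0
    then show ?thesis by (simp add: f_def g_def)
  next
    case (Suc k)
    have fg: "f s + g (Suc s) = 0" if "s \<le> k" for s
    proof -
      have s: "s < m" using that Suc by simp
      have "g (Suc s) = 4 * (c (Suc s) * real (Suc s) * (real s + 1 + \<alpha>)) * A y ^ (m - s - 1) * B y ^ s"
        by (simp add: g_def algebra_simps)
      also have "\<dots> = - f s"
        unfolding c_def jacobi_coeff_recurrence[OF s] f_def by (simp add: algebra_simps)
      finally show ?thesis by simp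
    qed
    have "(\<Sum>s\<le>m. f s) + (\<Sum>s\<le>m. g s) = (\<Sum>s\<le>k. f s) + f m + (g 0 + (\<Sum>s\<le>k. g (Suc s)))"
      unfolding Suc sum.atMost_Suc_shift[of g] by simp
    also have "\<dots> = (\<Sum>s\<le>k. f s + g (Suc s))" by (simp add: f_def g_def sum.distrib)
    also have "\<dots> = 0" using fg by (intro sum.neutral) auto
    finally show ?thesis .
  qed
  finally show ?thesis unfolding ab by simp
qed

lemma latitude_form_conj:
  assumes r: "orthogonal_matrix r"
  shows "latitude_form \<alpha> \<beta> m (r ** P ** transpose r) (r *v y) = latitude_form \<alpha> \<beta> m P y"
proof -
  have n: "norm (r *v z) = norm z" for z
    using r orthogonal_transformation_matrix[of "(*v) r"] by (simp add: orthogonal_transformation_norm)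
  have P: "(r ** P ** transpose r) *v (r *v y) = r *v (P *v y)"
    using r by (simp add: matrix_vector_mul_assoc matrix_mul_assoc[symmetric] orthogonal_matrix_def)
  show ?thesis unfolding latitude_form_def P n by (simp add: n flip: matrix_vector_mult_diff_distrib)
qed

lemma latitude_form_harmonic:
  fixes I :: "'n::finite set"
  assumes "- I \<noteq> {}" and r: "orthogonal_matrix r"
  shows "laplacian (latitude_form (real (card (- I)) / 2 - 1) (real (card I) / 2 - 1) m
     (r ** coord_proj (- I) ** transpose r)) y = 0"
proof -
  have rr: "r *v (transpose r *v y) = y" for y
    using r by (simp add: matrix_vector_mul_assoc orthogonal_matrix_def del: transpose_matrix_vector)
  have "latitude_form \<alpha> \<beta> m (r ** coord_proj (- I) ** transpose r)
      = (\<lambda>y. latitude_form \<alpha> \<beta> m (coord_proj (- I)) (transpose r *v y))" for \<alpha> \<beta>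
    using latitude_form_conj[OF r, of \<alpha> \<beta> m "coord_proj (- I)" "transpose r *v _"] by (simp add: rr fun_eq_iff del: transpose_matrix_vector)
  then show ?thesis
    using r by (simp add: laplacian_orthogonal[OF latitude_form_polynomial] latitude_form_harmonic_coord[OF assms(1)]
        del: transpose_matrix_vector)
qed

section \<open>Points at a given distance from a subspace\<close>

text \<open>
  The point at distance \<open>t\<close> from the great subsphere \<open>\<xi>\<close> with normal projection \<open>P\<close>, in the direction given
  by \<open>x\<close>. If \<open>x\<close> is uniformly distributed on the sphere, so is this point on the set of all points at
  distance \<open>t\<close> from \<open>\<xi>\<close>. In contrast to an orthonormal frame, \<open>P\<close> is determined by \<open>\<xi>\<close> and depends on it
  measurably.
\<close>

definition latitude :: "real \<Rightarrow> real^'n^'n \<Rightarrow> real^'n::finite \<Rightarrow> real^'n" where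
  "latitude t P x = cos t *\<^sub>R sgn (x - P *v x) + sin t *\<^sub>R sgn (P *v x)"

lemma latitude_norm_le: "norm (latitude t P x) \<le> 2"
proof -
  have "norm (latitude t P x) \<le> norm (cos t *\<^sub>R sgn (x - P *v x)) + norm (sin t *\<^sub>R sgn (P *v x))"
    unfolding latitude_def by (rule norm_triangle_ineq)
  also have "\<dots> \<le> 1 * 1 + 1 * 1"
    unfolding norm_scaleR by (intro add_mono mult_mono) (auto simp: norm_sgn)
  finally show ?thesis by simp
qed

lemma distr_sphere_measure_orthogonal:
  fixes r :: "real^'n^'n::finite"
  assumes "orthogonal_matrix r"
  shows "distr sphere_measure sphere_measure ((*v) r) = sphere_measure"
proof (rule distr_sphere_measure_isometry)
  have o: "orthogonal_transformation ((*v) r)"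
    using assms by (simp add: orthogonal_transformation_matrix)
  then show "linear ((*v) r)" "\<And>x. norm (r *v x) = norm x" "surj ((*v) r)"
    by (auto simp: orthogonal_transformation_norm orthogonal_transformation_surj)
qed

lemma measurable_sphere_measure_borel [measurable (raw)]:
  "f \<in> borel \<rightarrow>\<^sub>M M \<Longrightarrow> f \<in> sphere_measure \<rightarrow>\<^sub>M M"
  by (rule measurable_compose[OF measurable_ident_sphere_measure])

text \<open>
  The two unit directions of \<open>x\<close>, along the coordinates \<open>I\<close> and along the others, packed into one vector:
  \<open>latitude t\<close> arises from it by \<open>blend\<close>, so that a single law serves all \<open>t\<close>.
\<close>

definition split_dir :: "'n set \<Rightarrow> real^'n::finite \<Rightarrow> real^'n" where
  "split_dir I x = sgn (blend I 1 0 x) + sgn (blend I 0 1 x)"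

lemma split_dir_measurable [measurable]: "split_dir I \<in> borel_measurable borel"
  unfolding split_dir_def by measurable

lemma coord_proj_blend: "coord_proj (- I) *v x = blend I 0 1 x" "x - coord_proj (- I) *v x = blend I 1 0 x"
  by (auto simp: coord_proj_mult blend_def vec_eq_iff)

lemma latitude_coord: "latitude t (coord_proj (- I)) x = blend I (cos t) (sin t) (split_dir I x)"
  unfolding latitude_def coord_proj_blend(2) unfolding coord_proj_blend(1) split_dir_def
  by (auto simp: blend_def vec_eq_iff sgn_div_norm)

lemma split_dir_equivariant:
  assumes "linear T" "\<And>x. norm (T x) = norm x" "\<And>\<alpha> \<beta> x. T (blend I \<alpha> \<beta> x) = blend I \<alpha> \<beta> (T x)"
  shows "split_dir I (T x) = T (split_dir I x)"
  unfolding split_dir_def assms(3)[symmetric] sgn_linear_isometry[OF assms(1,2)] linear_add[OF assms(1)] ..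

lemma split_dir_law_invariant:
  assumes T: "linear T" "\<And>x. norm (T x) = norm x" "\<And>\<alpha> \<beta> x. T (blend I \<alpha> \<beta> x) = blend I \<alpha> \<beta> (T (x :: real^'n::finite))"
  defines "N \<equiv> distr sphere_measure borel (split_dir I)"
  shows "distr N N T = N"
proof -
  have surj: "surj T"
    using T(1,2) by (metis linear_injective_0 linear_injective_imp_surjective norm_eq_zero)
  have Tm [measurable]: "T \<in> borel \<rightarrow>\<^sub>M borel"
    using T(1) linear_conv_bounded_linear linear_continuous_on borel_measurable_continuous_onI by blast
  have Ts [measurable]: "T \<in> sphere_measure \<rightarrow>\<^sub>M sphere_measure"
    unfolding measurable_cong_sets[OF sets_sphere_measure sets_sphere_measure]
    by (rule measurable_restrict_space3) (auto simp: T)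
  have "distr N N T = distr sphere_measure borel (\<lambda>x. T (split_dir I x))"
    unfolding N_def by (subst distr_distr) (auto simp: o_def cong: distr_cong)
  also have "\<dots> = distr sphere_measure borel (\<lambda>x. split_dir I (T x))"
    by (simp add: split_dir_equivariant[OF T])
  also have "\<dots> = distr (distr sphere_measure sphere_measure T) borel (split_dir I)"
    by (subst distr_distr) (auto simp: o_def)
  also have "\<dots> = N" unfolding N_def by (simp add: distr_sphere_measure_isometry[OF T(1,2) surj])
  finally show ?thesis .
qed

lemma rot_linear: "linear (rot i j \<theta>)"
  by (rule linearI) (auto simp: rot_def vec_eq_iff algebra_simps)

lemma rot_norm:
  assumes "i \<noteq> j" shows "norm (rot i j \<theta> x) = norm x"
proof -
  have split: "(norm y)\<^sup>2 = (y $ i)\<^sup>2 + (y $ j)\<^sup>2 + (\<Sum>k\<in>- {i, j}. (y $ k)\<^sup>2)" for y :: "real^'a"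
  proof -
    have "(norm y)\<^sup>2 = (\<Sum>k\<in>insert i (insert j (- {i, j})). (y $ k)\<^sup>2)"
      unfolding norm_vec_def L2_set_def by (auto simp: sum_nonneg intro!: sum.cong)
    then show ?thesis using assms by simp
  qed
  have "(u * c - v * s)\<^sup>2 + (u * s + v * c)\<^sup>2 = (u\<^sup>2 + v\<^sup>2) * (s\<^sup>2 + c\<^sup>2)"
    for u v c s :: real by (simp add: power2_eq_square algebra_simps)
  from this[of "x $ i" "cos \<theta>" "x $ j" "sin \<theta>"]
  have "(norm (rot i j \<theta> x))\<^sup>2 = (norm x)\<^sup>2"
    unfolding split using assms by (auto simp: rot_def intro!: sum.cong)
  then show ?thesis by simp
qed

lemma rot_blend:
  assumes "i \<in> I \<and> j \<in> I \<or> i \<in> - I \<and> j \<in> - I"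
  shows "rot i j \<theta> (blend I \<alpha> \<beta> x) = blend I \<alpha> \<beta> (rot i j \<theta> x)"
  using assms by (auto simp: rot_def blend_def vec_eq_iff algebra_simps)

lemma blend_nonzero_AE:
  assumes "I \<noteq> {}"
  shows "AE x in sphere_measure. blend I 1 0 (x::real^'n::finite) \<noteq> 0"
proof -
  obtain i where i: "i \<in> I" using assms by blast
  have "AE x in sphere_measure. axis i 1 \<bullet> (x::real^'n) \<noteq> 0"
    by (rule sphere_measure_hyperplane_null) (simp add: axis_eq_0_iff)
  then show ?thesis
  proof eventually_elim
    case (elim x)
    then have "blend I 1 0 x $ i \<noteq> 0" using i by (simp add: blend_def inner_axis')
    then show ?case by auto
  qed
qed

lemma blend_swap: "blend I \<alpha> \<beta> x = blend (- I) \<beta> \<alpha> x"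
  by (auto simp: blend_def vec_eq_iff)

lemma split_dir_swap: "split_dir I x = split_dir (- I) x"
  unfolding split_dir_def blend_swap[of "- I"] by (simp add: add.commute)

lemma norm_split: "(norm y)\<^sup>2 = (\<Sum>i\<in>I. (y $ i)\<^sup>2) + (\<Sum>i\<in>- I. (y $ i)\<^sup>2)" for y :: "real^'n::finite"
proof -
  have "(norm y)\<^sup>2 = (\<Sum>k\<in>I \<union> - I. (y $ k)\<^sup>2)"
    unfolding norm_vec_def L2_set_def by (auto simp: sum_nonneg intro!: sum.cong)
  also have "\<dots> = (\<Sum>i\<in>I. (y $ i)\<^sup>2) + (\<Sum>i\<in>- I. (y $ i)\<^sup>2)"
    by (rule sum.union_disjoint) auto
  finally show ?thesis .
qed

lemma split_dir_sum_squares: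
  assumes "blend I 1 0 x \<noteq> 0"
  shows "(\<Sum>i\<in>I. (split_dir I x $ i)\<^sup>2) = 1"
proof -
  have "(\<Sum>i\<in>I. (split_dir I x $ i)\<^sup>2) = (norm (sgn (blend I 1 0 x)))\<^sup>2"
    unfolding norm_split[of _ I] by (auto simp: split_dir_def blend_def sgn_div_norm)
  then show ?thesis using assms by (simp add: norm_sgn)
qed

text \<open>
  Rotations that preserve the coordinate subspace \<open>I\<close> commute with \<open>split_dir\<close>, and they preserve the
  surface measure.
\<close>

lemma split_dir_law_rotation_invariant:
  fixes I :: "'n::finite set"
  assumes "I \<noteq> {}" "- I \<noteq> {}"
  shows "rotation_invariant (distr sphere_measure borel (split_dir I)) I"
proof -
  interpret S: prob_space "sphere_measure :: (real^'n) measure" by (rule prob_space_sphere_measure)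
  interpret N: prob_space "distr sphere_measure borel (split_dir I)" by (rule S.prob_space_distr) measurable
  have sq: "AE x in sphere_measure. (\<Sum>i\<in>I. (split_dir I x $ i)\<^sup>2) = 1"
    using blend_nonzero_AE[OF assms(1)] by eventually_elim (rule split_dir_sum_squares)
  have sq': "AE x in sphere_measure. (\<Sum>i\<in>- I. (split_dir I x $ i)\<^sup>2) = 1"
    using blend_nonzero_AE[OF assms(2)] unfolding split_dir_swap[of I] by eventually_elim (rule split_dir_sum_squares)
  show ?thesis
  proof
    show "AE x in distr sphere_measure borel (split_dir I). (\<Sum>i\<in>I. (x $ i)\<^sup>2) = 1"
      using sq by (subst AE_distr_iff) auto
    have "AE x in sphere_measure. \<forall>i. \<bar>split_dir I x $ i\<bar> \<le> 1"
      using sq sq'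
    proof eventually_elim
      case (elim x)
      show ?case
      proof
        fix i
        have "(split_dir I x $ i)\<^sup>2 \<le> (if i \<in> I then (\<Sum>i\<in>I. (split_dir I x $ i)\<^sup>2) else (\<Sum>i\<in>- I. (split_dir I x $ i)\<^sup>2))"
          by (auto intro!: member_le_sum)
        then show "\<bar>split_dir I x $ i\<bar> \<le> 1" using elim by (simp add: abs_square_le_1 split: if_splits)
      qed
    qed
    then show "AE x in distr sphere_measure borel (split_dir I). \<forall>i. \<bar>x $ i\<bar> \<le> 1"
      by (subst AE_distr_iff) auto
    show "distr (distr sphere_measure borel (split_dir I)) (distr sphere_measure borel (split_dir I)) (rot i j \<theta>)
        = distr sphere_measure borel (split_dir I)" if "i \<in> I" "j \<in> I" "i \<noteq> j" for i j \<theta>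
      using that by (intro split_dir_law_invariant rot_linear rot_norm rot_blend) auto
  qed simp
qed

text \<open>
  The law of \<open>split_dir\<close> is invariant under the rotations of both coordinate subspaces and under the reflection
  in one of them, and \<open>blend\<close> recovers the point at distance \<open>t\<close>. Since this law does not involve \<open>t\<close>, neither
  does the constant.
\<close>

theorem harmonic_latitude_mean:
  fixes p :: "real^'n::finite \<Rightarrow> real"
  assumes I: "I \<noteq> {}" "- I \<noteq> {}"
    and p: "real_polynomial_function p" "\<And>c x. p (c *\<^sub>R x) = c ^ (2 * m) * p x" "\<And>x. laplacian p x = 0"
  shows "\<exists>C. \<forall>t. (\<integral>x. p (latitude t (coord_proj (- I)) x) \<partial>sphere_measure)
      = C * jacobi (real (card (- I)) / 2 - 1) (real (card I) / 2 - 1) m (cos (2 * t))"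
proof -
  let ?N = "distr sphere_measure borel (split_dir I)"
  have 1: "rotation_invariant ?N I" by (rule split_dir_law_rotation_invariant[OF I])
  have 2: "rotation_invariant ?N (- I)"
    using split_dir_law_rotation_invariant[of "- I"] I by (simp add: split_dir_swap[of I, abs_def, symmetric] split_dir_swap[of "- I", abs_def])
  have 3: "distr ?N ?N (blend I 1 (-1)) = ?N"
  proof (rule split_dir_law_invariant)
    show "linear (blend I 1 (-1))" by (rule linearI) (auto simp: blend_def vec_eq_iff algebra_simps)
    show "norm (blend I 1 (-1) x) = norm x" for x
      by (rule power2_eq_imp_eq) (auto simp: norm_split[of _ I] blend_def)
  qed (auto simp: blend_def vec_eq_iff)
  have pm [measurable]: "p \<in> borel_measurable borel"
    using p(1) by (intro borel_measurable_continuous_onI continuous_on_polymonial_function) (simp add: real_polynomial_function_eq)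
  have "(\<integral>x. p (blend I (cos t) (sin t) x) \<partial>?N) = (\<integral>x. p (latitude t (coord_proj (- I)) x) \<partial>sphere_measure)" for t
    unfolding latitude_coord by (subst integral_distr) auto
  then show ?thesis
    using harmonic_average_jacobi[OF 1 2 3 p] by simp
qed

text \<open>
  The orthogonal projections whose rank is the number of coordinates outside \<open>I\<close>.
\<close>

definition subspace_proj :: "'n set \<Rightarrow> real^'n^'n::finite \<Rightarrow> bool" where
  "subspace_proj I P \<longleftrightarrow> (\<exists>r. orthogonal_matrix r \<and> P = r ** coord_proj (- I) ** transpose r)"

lemma orthogonal_matrix_norm:
  fixes r :: "real^'n^'n::finite"
  assumes "orthogonal_matrix r" shows "norm (r *v z) = norm z"
  using assms orthogonal_transformation_matrix[of "(*v) r"] by (simp add: orthogonal_transformation_norm)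

lemma orthogonal_matrix_inner:
  fixes r :: "real^'n^'n::finite"
  assumes "orthogonal_matrix r" shows "(r *v x) \<bullet> (r *v y) = x \<bullet> y"
  using assms orthogonal_transformation_matrix[of "(*v) r"] by (simp add: orthogonal_transformation_def)

lemma orthogonal_matrix_cancel:
  assumes "orthogonal_matrix r"
  shows "transpose r *v (r *v x) = x" "r *v (transpose r *v x) = x"
  using assms by (simp_all add: matrix_vector_mul_assoc orthogonal_matrix_def del: transpose_matrix_vector)

lemma conj_mult_vec:
  assumes "orthogonal_matrix r" shows "(r ** P ** transpose r) *v (r *v y) = r *v (P *v y)"
  by (simp add: orthogonal_matrix_cancel[OF assms] matrix_vector_mul_assoc[symmetric] del: transpose_matrix_vector)

lemma latitude_conj:
  assumes "orthogonal_matrix r"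
  shows "latitude t (r ** P ** transpose r) (r *v x) = r *v latitude t P x"
proof -
  have s: "sgn (r *v z) = r *v sgn z" for z
    by (rule sgn_linear_isometry) (auto simp: orthogonal_matrix_norm[OF assms])
  show ?thesis
    unfolding latitude_def conj_mult_vec[OF assms]
    by (simp add: s matrix_vector_right_distrib matrix_vector_mult_scaleR flip: matrix_vector_mult_diff_distrib)
qed

lemma latitude_AE_coord:
  fixes I :: "'n::finite set"
  assumes I: "I \<noteq> {}" "- I \<noteq> {}"
  shows "AE x in sphere_measure. norm (latitude t (coord_proj (- I)) x) = 1
     \<and> latitude_form \<alpha> \<beta> m (coord_proj (- I)) (latitude t (coord_proj (- I)) x) = jacobi \<alpha> \<beta> m (cos (2 * t))"
  using blend_nonzero_AE[OF I(1)] blend_nonzero_AE[OF I(2)]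
proof eventually_elim
  case (elim x)
  let ?u = "latitude t (coord_proj (- I)) x"
  have "(\<Sum>i\<in>I. (?u $ i)\<^sup>2) = (cos t)\<^sup>2 * (\<Sum>i\<in>I. (split_dir I x $ i)\<^sup>2)"
    unfolding latitude_coord by (simp add: blend_def power_mult_distrib sum_distrib_left)
  then have 1: "(\<Sum>i\<in>I. (?u $ i)\<^sup>2) = (cos t)\<^sup>2" by (simp add: split_dir_sum_squares[OF elim(1)])
  have "(\<Sum>i\<in>- I. (?u $ i)\<^sup>2) = (sin t)\<^sup>2 * (\<Sum>i\<in>- I. (split_dir (- I) x $ i)\<^sup>2)"
    unfolding latitude_coord split_dir_swap[of I] by (simp add: blend_def power_mult_distrib sum_distrib_left)
  then have 2: "(\<Sum>i\<in>- I. (?u $ i)\<^sup>2) = (sin t)\<^sup>2" by (simp add: split_dir_sum_squares[OF elim(2)])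
  have "(norm ?u)\<^sup>2 = 1" unfolding norm_split[of _ I] 1 2 by simp
  then have "norm ?u = 1" using norm_ge_zero[of ?u] by (simp only: power2_eq_1_iff) linarith
  then show ?case unfolding latitude_form_coord 1 2 jacobi_cos by simp
qed

lemma measurable_orthogonal_sphere:
  fixes r :: "real^'n^'n::finite"
  assumes "orthogonal_matrix r"
  shows "(*v) r \<in> sphere_measure \<rightarrow>\<^sub>M sphere_measure"
  unfolding measurable_cong_sets[OF sets_sphere_measure sets_sphere_measure]
proof (rule measurable_restrict_space3)
  show "(*v) r \<in> borel \<rightarrow>\<^sub>M borel"
    by (intro borel_measurable_continuous_onI linear_continuous_on matrix_vector_mul_bounded_linear)
qed (auto simp: orthogonal_matrix_norm[OF assms])

text \<open>
  The directions of \<open>x\<close> along both subspaces exist unless one of its parts vanishes. If they exist, the parts of the point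
  at distance \<open>t\<close> have norms \<open>cos t\<close> and \<open>sin t\<close>.
\<close>

lemma latitude_AE:
  fixes I :: "'n::finite set"
  assumes I: "I \<noteq> {}" "- I \<noteq> {}" and P: "subspace_proj I P"
  shows "AE x in sphere_measure. norm (latitude t P x) = 1
     \<and> latitude_form \<alpha> \<beta> m P (latitude t P x) = jacobi \<alpha> \<beta> m (cos (2 * t))"
proof -
  obtain r where r: "orthogonal_matrix r" and Pr: "P = r ** coord_proj (- I) ** transpose r"
    using P by (auto simp: subspace_proj_def)
  have rt: "orthogonal_matrix (transpose r)" using r by simp
  have "AE x in distr sphere_measure sphere_measure ((*v) (transpose r)). norm (latitude t (coord_proj (- I)) x) = 1
     \<and> latitude_form \<alpha> \<beta> m (coord_proj (- I)) (latitude t (coord_proj (- I)) x) = jacobi \<alpha> \<beta> m (cos (2 * t))"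
    unfolding distr_sphere_measure_orthogonal[OF rt] by (rule latitude_AE_coord[OF I])
  from AE_distrD[OF measurable_orthogonal_sphere[OF rt] this] show ?thesis
  proof eventually_elim
    case (elim x)
    have "latitude t P x = r *v latitude t (coord_proj (- I)) (transpose r *v x)"
      unfolding Pr latitude_conj[OF r, symmetric] orthogonal_matrix_cancel[OF r] ..
    then show ?case using elim unfolding Pr by (simp add: latitude_form_conj[OF r] orthogonal_matrix_norm[OF r] del: transpose_matrix_vector)
  qed
qed

lemma continuous_on_matrix_vector [continuous_intros]:
  fixes f :: "'a::topological_space \<Rightarrow> real^'n^'m::finite" and g :: "'a \<Rightarrow> real^'n::finite"
  assumes "continuous_on S f" "continuous_on S g"
  shows "continuous_on S (\<lambda>x. f x *v g x)"
  unfolding matrix_vector_mult_def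
  by (intro continuous_on_vec_lambda continuous_intros assms)

lemma continuous_on_latitude_form [continuous_intros]:
  assumes "continuous_on S P" "continuous_on S g"
  shows "continuous_on S (\<lambda>x. latitude_form \<alpha> \<beta> m (P x) (g x))"
  unfolding latitude_form_def by (intro continuous_intros assms)

lemma measurable_latitude_form [measurable]:
  assumes [measurable]: "P \<in> borel_measurable M" "g \<in> borel_measurable M"
  shows "(\<lambda>x. latitude_form \<alpha> \<beta> m (P x) (g x)) \<in> borel_measurable M"
proof -
  have "(\<lambda>z. latitude_form \<alpha> \<beta> m (fst z) (snd z)) \<in> borel_measurable borel"
    by (intro borel_measurable_continuous_onI continuous_intros)
  then have "(\<lambda>z. latitude_form \<alpha> \<beta> m (fst z) (snd z)) \<circ> (\<lambda>x. (P x, g x)) \<in> borel_measurable M"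
    by (rule measurable_comp[rotated]) measurable
  then show ?thesis by (simp add: o_def)
qed

lemma measurable_matrix_vector [measurable]:
  fixes P :: "'a \<Rightarrow> real^'n^'m::finite" and g :: "'a \<Rightarrow> real^'n::finite"
  assumes [measurable]: "P \<in> borel_measurable M" "g \<in> borel_measurable M"
  shows "(\<lambda>x. P x *v g x) \<in> borel_measurable M"
proof -
  have "(\<lambda>z :: (real^'n^'m) \<times> (real^'n). fst z *v snd z) \<in> borel_measurable borel"
    by (intro borel_measurable_continuous_onI continuous_intros)
  then have "(\<lambda>z. fst z *v snd z) \<circ> (\<lambda>x. (P x, g x)) \<in> borel_measurable M"
    by (rule measurable_comp[rotated]) measurable
  then show ?thesis by (simp add: o_def)
qed

lemma measurable_latitude [measurable]:
  assumes [measurable]: "P \<in> borel_measurable M" "g \<in> borel_measurable M"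
  shows "(\<lambda>x. latitude t (P x) (g x)) \<in> borel_measurable M"
  unfolding latitude_def by measurable

definition form_bound :: "real \<Rightarrow> real \<Rightarrow> nat \<Rightarrow> real" where
  "form_bound \<alpha> \<beta> m = (\<Sum>s\<le>m. \<bar>jacobi_coeff \<alpha> \<beta> m s\<bar>)"

lemma latitude_form_bound:
  assumes P: "subspace_proj I P" and y: "norm y = 1"
  shows "\<bar>latitude_form \<alpha> \<beta> m P y\<bar> \<le> form_bound \<alpha> \<beta> m"
proof -
  obtain r where r: "orthogonal_matrix r" and Pr: "P = r ** coord_proj (- I) ** transpose r"
    using P by (auto simp: subspace_proj_def)
  have yr: "y = r *v (transpose r *v y)" by (rule orthogonal_matrix_cancel(2)[OF r, symmetric])
  let ?z = "transpose r *v y"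
  have nz: "norm ?z = 1" using orthogonal_matrix_norm[of "transpose r" y] r y by simp
  have "latitude_form \<alpha> \<beta> m P y = latitude_form \<alpha> \<beta> m (coord_proj (- I)) ?z"
    unfolding Pr by (subst yr) (rule latitude_form_conj[OF r])
  also have "\<bar>\<dots>\<bar> \<le> form_bound \<alpha> \<beta> m"
    unfolding latitude_form_coord form_bound_def
  proof (rule sum_abs[THEN order_trans], rule sum_mono)
    fix s assume "s \<in> {..m}"
    have "(\<Sum>i\<in>I. (?z $ i)\<^sup>2) + (\<Sum>i\<in>- I. (?z $ i)\<^sup>2) = 1" using norm_split[of ?z I] nz by simp
    moreover have "0 \<le> (\<Sum>i\<in>I. (?z $ i)\<^sup>2)" "0 \<le> (\<Sum>i\<in>- I. (?z $ i)\<^sup>2)" by (auto intro: sum_nonneg)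
    ultimately have "\<bar>(\<Sum>i\<in>I. (?z $ i)\<^sup>2) ^ (m - s)\<bar> \<le> 1" "\<bar>(\<Sum>i\<in>- I. (?z $ i)\<^sup>2) ^ s\<bar> \<le> 1"
      by (auto simp: power_abs intro!: power_le_one)
    then have "\<bar>(\<Sum>i\<in>I. (?z $ i)\<^sup>2) ^ (m - s)\<bar> * \<bar>(\<Sum>i\<in>- I. (?z $ i)\<^sup>2) ^ s\<bar> \<le> 1"
      by (intro mult_le_one) auto
    from mult_left_mono[OF this, of "\<bar>jacobi_coeff \<alpha> \<beta> m s\<bar>"]
    show "\<bar>jacobi_coeff \<alpha> \<beta> m s * (\<Sum>i\<in>I. (?z $ i)\<^sup>2) ^ (m - s) * (\<Sum>i\<in>- I. (?z $ i)\<^sup>2) ^ s\<bar> \<le> \<bar>jacobi_coeff \<alpha> \<beta> m s\<bar>"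
      by (simp add: abs_mult mult.assoc)
  qed
  finally show ?thesis .
qed

lemma harmonic_latitude_mean_proj:
  fixes p :: "real^'n::finite \<Rightarrow> real"
  assumes I: "I \<noteq> {}" "- I \<noteq> {}" and P: "subspace_proj I P"
    and p: "real_polynomial_function p" "\<And>c x. p (c *\<^sub>R x) = c ^ (2 * m) * p x" "\<And>x. laplacian p x = 0"
  shows "\<exists>C. \<forall>t. (\<integral>x. p (latitude t P x) \<partial>sphere_measure)
      = C * jacobi (real (card (- I)) / 2 - 1) (real (card I) / 2 - 1) m (cos (2 * t))"
proof -
  obtain r where r: "orthogonal_matrix r" and Pr: "P = r ** coord_proj (- I) ** transpose r"
    using P by (auto simp: subspace_proj_def)
  have pm [measurable]: "p \<in> borel_measurable borel"
    using p(1) by (intro borel_measurable_continuous_onI continuous_on_polymonial_function) (simp add: real_polynomial_function_eq)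
  have "real_polynomial_function (\<lambda>x. p (r *v x))"
    using real_polynomial_function_compose[OF _ p(1), of "(*v) r"]
    by (simp add: o_def polynomial_function_bounded_linear matrix_vector_mul_bounded_linear)
  then obtain C where C: "\<And>t. (\<integral>x. p (r *v latitude t (coord_proj (- I)) x) \<partial>sphere_measure)
      = C * jacobi (real (card (- I)) / 2 - 1) (real (card I) / 2 - 1) m (cos (2 * t))"
    using harmonic_latitude_mean[OF I, of "\<lambda>x. p (r *v x)" m] p laplacian_orthogonal[OF p(1) r]
    by (auto simp: matrix_vector_mult_scaleR)
  have "(\<integral>x. p (latitude t P x) \<partial>sphere_measure) = (\<integral>x. p (r *v latitude t (coord_proj (- I)) x) \<partial>sphere_measure)" for t
  proof -
    have "(\<integral>x. p (latitude t P x) \<partial>sphere_measure) = (\<integral>x. p (latitude t P x) \<partial>distr sphere_measure sphere_measure ((*v) r))"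
      by (simp add: distr_sphere_measure_orthogonal[OF r])
    also have "\<dots> = (\<integral>x. p (latitude t P (r *v x)) \<partial>sphere_measure)"
      by (rule integral_distr[OF measurable_orthogonal_sphere[OF r]]) measurable
    finally show ?thesis unfolding Pr latitude_conj[OF r] .
  qed
  then show ?thesis using C by auto
qed

text \<open>
  The reflection in the hyperplane orthogonal to \<open>y - y'\<close>. It fixes every vector that forms the same inner
  product with \<open>y\<close> and \<open>y'\<close>, which makes it serve for all the transitivity statements below.
\<close>

lemma reflection_exists:
  fixes y y' :: "real^'n::finite"
  assumes "norm y = norm y'"
  obtains r where "orthogonal_matrix r" "r *v y = y'" "\<And>z. y \<bullet> z = y' \<bullet> z \<Longrightarrow> r *v z = z"
proof (cases "y = y'")
  case True
  then show ?thesis using that[of "mat 1"] by (simp add: orthogonal_matrix_id)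
next
  case False
  define w where "w = y - y'"
  have ww: "w \<bullet> w \<noteq> 0" using False by (simp add: w_def)
  have wz: "w \<bullet> z = 0" if "y \<bullet> z = y' \<bullet> z" for z using that by (simp add: w_def inner_diff_left)
  have yy: "y \<bullet> y = y' \<bullet> y'" using assms(1) by (simp add: norm_eq)
  have wy: "2 * (w \<bullet> y) = w \<bullet> w"
    unfolding w_def by (simp add: inner_diff_left inner_diff_right inner_commute[of y' y] yy)
  define T where "T x = x - (2 * (w \<bullet> x) / (w \<bullet> w)) *\<^sub>R w" for x
  have lin: "linear T"
    by (rule linearI) (auto simp: T_def inner_add_right distrib_left add_divide_distrib scaleR_left_distrib scaleR_diff_right mult_ac)
  have "T u \<bullet> T v = u \<bullet> v" for u v
  proof -
    have "T u \<bullet> T v = u \<bullet> v - (2 * (w \<bullet> v) / (w \<bullet> w)) * (w \<bullet> u) - (2 * (w \<bullet> u) / (w \<bullet> w)) * (w \<bullet> v)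
        + (2 * (w \<bullet> u) / (w \<bullet> w)) * (2 * (w \<bullet> v) / (w \<bullet> w)) * (w \<bullet> w)"
      unfolding T_def by (simp add: inner_diff_left inner_diff_right inner_commute[of u w])
    then show ?thesis using ww by simp
  qed
  then have "orthogonal_transformation T" using lin by (simp add: orthogonal_transformation_def)
  then have "orthogonal_matrix (matrix T)" using lin by (simp add: orthogonal_transformation_matrix)
  moreover have "matrix T *v x = T x" for x using lin by (simp add: matrix_works)
  moreover have "T z = z" if "y \<bullet> z = y' \<bullet> z" for z by (simp add: T_def wz[OF that])
  moreover have "T y = y'" using ww by (simp add: T_def wy) (simp add: w_def)
  ultimately show ?thesis using that by metis
qed

section \<open>Zonal averages\<close>

text \<open>
  The zonal harmonic of degree \<open>2 m\<close> as a function of the inner product \<open>u\<close> with the pole, with value 1 at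
  the pole. The parameters are those of \<open>harmonic_latitude_mean\<close> for a line, and
  \<open>cos (2 s) = 2 (cos s)\<^sup>2 - 1\<close>.
\<close>

definition zonal :: "'n::finite itself \<Rightarrow> nat \<Rightarrow> real \<Rightarrow> real" where
  "zonal _ m u = jacobi ((real CARD('n) - 1) / 2 - 1) (- 1 / 2) m (2 * u\<^sup>2 - 1)
     / jacobi ((real CARD('n) - 1) / 2 - 1) (- 1 / 2) m 1"

lemma jacobi_1: "jacobi \<alpha> \<beta> m 1 = jacobi_coeff \<alpha> \<beta> m 0"
proof -
  have "jacobi \<alpha> \<beta> m 1 = (\<Sum>s\<in>{0}. ((real m + \<alpha>) gchoose (m - s)) * ((real m + \<beta>) gchoose s) * ((1 - 1) / 2) ^ s * ((1 + 1) / 2) ^ (m - s))"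
    unfolding jacobi_def by (rule sum.mono_neutral_right) auto
  then show ?thesis by (simp add: jacobi_coeff_def)
qed

lemma exists_axis_proj:
  fixes z :: "real^'n::finite"
  assumes "norm z = 1"
  obtains i r where "orthogonal_matrix r" "r *v axis i 1 = z"
  using orthogonal_matrix_exists_basis[OF assms] by metis

text \<open>
  The unit sphere of the line through \<open>z\<close> consists of \<open>z\<close> and \<open>-z\<close> only. Hence a point at distance \<open>s\<close> from it
  forms the inner product \<open>cos s\<close> with one of these two.
\<close>

lemma latitude_zonal:
  fixes r :: "real^'n::finite^'n"
  assumes r: "orthogonal_matrix r" "r *v axis i 1 = z"
    and card: "CARD('n) \<ge> 2"
  shows "AE x in sphere_measure. \<exists>e\<in>{1, -1}. latitude s (r ** coord_proj (- {i}) ** transpose r) x \<bullet> z = e * cos s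
      \<and> norm (latitude s (r ** coord_proj (- {i}) ** transpose r) x) = 1
      \<and> (s = 0 \<longrightarrow> latitude s (r ** coord_proj (- {i}) ** transpose r) x = e *\<^sub>R z)"
proof -
  let ?P = "r ** coord_proj (- {i}) ** transpose r"
  have ne: "- {i} \<noteq> {}"
  proof
    assume "- {i} = {}"
    then have "(UNIV :: 'n set) = {i}" by auto
    then have "CARD('n) = 1" by (metis card_1_singleton_iff One_nat_def)
    then show False using card by simp
  qed
  have sp: "subspace_proj {i} ?P" using r unfolding subspace_proj_def by blast
  have "norm z = 1" using r orthogonal_matrix_norm[OF r(1), of "axis i 1"] by simp
  then have "AE x in sphere_measure. z \<bullet> x \<noteq> 0" by (intro sphere_measure_hyperplane_null) auto
  then show ?thesis
    using latitude_AE[OF insert_not_empty ne sp, of s 0 0 0]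
  proof eventually_elim
    case (elim x)
    define x' where "x' = transpose r *v x"
    have x: "x = r *v x'" unfolding x'_def by (rule orthogonal_matrix_cancel(2)[OF r(1), symmetric])
    have l: "latitude s ?P x = r *v latitude s (coord_proj (- {i})) x'"
      unfolding x latitude_conj[OF r(1)] ..
    have zx: "z \<bullet> x = x' $ i"
      unfolding x r(2)[symmetric] orthogonal_matrix_inner[OF r(1)] by (simp add: inner_axis')
    have d: "x' - coord_proj (- {i}) *v x' = (x' $ i) *\<^sub>R axis i 1"
      unfolding coord_proj_blend by (auto simp: blend_def vec_eq_iff axis_def)
    have c: "(coord_proj (- {i}) *v x') $ i = 0"
      unfolding coord_proj_blend by (simp add: blend_def)
    define e where "e = sgn (x' $ i)"
    have e: "e \<in> {1, -1}" using elim(1) unfolding zx e_def by (auto simp: sgn_if)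
    have sd: "sgn (x' - coord_proj (- {i}) *v x') = e *\<^sub>R axis i 1"
      unfolding d e_def by (simp add: sgn_scaleR sgn_div_norm[of "axis i 1"])
    have lz: "latitude s ?P x \<bullet> z = latitude s (coord_proj (- {i})) x' $ i"
      unfolding l r(2)[symmetric] orthogonal_matrix_inner[OF r(1)] by (simp add: inner_axis)
    show ?case
    proof (intro bexI[OF _ e] conjI impI)
      show "latitude s ?P x \<bullet> z = e * cos s"
        unfolding lz unfolding latitude_def sd using c by (simp add: sgn_div_norm)
      show "norm (latitude s ?P x) = 1" using elim(2) by simp
      show "latitude s ?P x = e *\<^sub>R z" if "s = 0"
        unfolding l unfolding latitude_def sd using that by (simp add: matrix_vector_mult_scaleR r(2))
    qed
  qed
qed

lemma latitude_form_even:
  assumes "e \<in> {1, -1::real}" shows "latitude_form \<alpha> \<beta> m P (e *\<^sub>R z) = latitude_form \<alpha> \<beta> m P z"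
  using assms by (auto simp: latitude_form_scale simp del: scaleR_minus1_left)

lemma latitude_form_bound':
  assumes P: "subspace_proj I P"
  shows "\<bar>latitude_form \<alpha> \<beta> m P y\<bar> \<le> form_bound \<alpha> \<beta> m * norm y ^ (2 * m)"
proof (cases "y = 0")
  case True
  show ?thesis
  proof (cases m)
    case 0
    then show ?thesis by (simp add: latitude_form_def form_bound_def)
  next
    case (Suc k)
    then show ?thesis using latitude_form_scale[of \<alpha> \<beta> m P 0 y] True by simp
  qed
next
  case False
  have "latitude_form \<alpha> \<beta> m P y = norm y ^ (2 * m) * latitude_form \<alpha> \<beta> m P (sgn y)"
    using latitude_form_scale[of \<alpha> \<beta> m P "norm y" "sgn y"] False by (simp add: sgn_div_norm)
  then show ?thesis
    using mult_left_mono[OF latitude_form_bound[OF P, of "sgn y" \<alpha> \<beta> m], of "norm y ^ (2 * m)"] False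
    by (simp add: abs_mult norm_sgn mult.commute)
qed

text \<open>
  Averaging a harmonic over the rotations about \<open>z\<close> leaves a multiple of the zonal harmonic with pole \<open>z\<close>.
  The multiple is the value at \<open>z\<close>, as the case \<open>s = 0\<close> shows.
\<close>

lemma zonal_mean:
  fixes P r :: "real^'n^'n::finite" and m :: nat
  assumes I: "I \<noteq> {}" "- I \<noteq> {}" and P: "subspace_proj I P"
    and r: "orthogonal_matrix r" "r *v axis i 1 = z"
  defines "H \<equiv> latitude_form (real (card (- I)) / 2 - 1) (real (card I) / 2 - 1) m P"
  shows "(\<integral>x. H (latitude s (r ** coord_proj (- {i}) ** transpose r) x) \<partial>sphere_measure)
    = H z * zonal TYPE('n) m (cos s)"
proof -
  interpret S: prob_space "sphere_measure :: (real^'n) measure" by (rule prob_space_sphere_measure)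
  let ?Q = "r ** coord_proj (- {i}) ** transpose r"
  let ?\<alpha> = "(real CARD('n) - 1) / 2 - 1"
  obtain a b where ab: "a \<in> I" "b \<in> - I" using I by blast
  then have card: "CARD('n) \<ge> 2" using card_mono[of "UNIV :: 'n set" "{a, b}"] by (cases "a = b") auto
  have "a \<noteq> b" using ab by auto
  then obtain j :: 'n where "j \<noteq> i" by metis
  then have ne: "- {i} \<noteq> {}" by auto
  have sp: "subspace_proj {i} ?Q" using r unfolding subspace_proj_def by blast
  obtain q where q: "orthogonal_matrix q" "P = q ** coord_proj (- I) ** transpose q"
    using P by (auto simp: subspace_proj_def)
  have Hm [measurable]: "H \<in> borel_measurable borel"
    unfolding H_def by measurable
  have "\<exists>C. \<forall>s. (\<integral>x. H (latitude s ?Q x) \<partial>sphere_measure)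
      = C * jacobi (real (card (- {i})) / 2 - 1) (real (card {i}) / 2 - 1) m (cos (2 * s))"
    unfolding H_def
    by (intro harmonic_latitude_mean_proj sp ne latitude_form_polynomial latitude_form_scale)
       (use latitude_form_harmonic[OF I(2) q(1)] q(2) in auto)
  moreover have "real (card (- {i})) / 2 - 1 = ?\<alpha>" "real (card {i}) / 2 - 1 = - 1 / 2"
    using card by (auto simp: Compl_eq_Diff_UNIV of_nat_diff)
  ultimately obtain C where C: "\<And>s. (\<integral>x. H (latitude s ?Q x) \<partial>sphere_measure)
      = C * jacobi ?\<alpha> (- 1 / 2) m (cos (2 * s))" by auto
  have "(\<integral>x. H (latitude 0 ?Q x) \<partial>sphere_measure) = (\<integral>x. H z \<partial>(sphere_measure :: (real^'n) measure))"
  proof (rule integral_cong_AE)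
    show "AE x in sphere_measure. H (latitude 0 ?Q x) = H z"
      using latitude_zonal[OF r card, of 0]
      by eventually_elim (auto simp: H_def latitude_form_even[of "-1", simplified])
  qed measurable
  also have "\<dots> = H z" by (simp add: S.prob_space[unfolded space_sphere_measure])
  finally have z: "H z = C * jacobi ?\<alpha> (- 1 / 2) m 1" using C[of 0] by simp
  have "0 < jacobi ?\<alpha> (- 1 / 2) m 1" unfolding jacobi_1 using card by (intro jacobi_coeff_0_pos) auto
  then show ?thesis
    unfolding C z zonal_def by (simp add: cos_double_cos)
qed

lemma cap_mass_const:
  fixes x y :: "real^'n::finite"
  assumes "norm x = 1" "norm y = 1"
  shows "cap_mass N x = cap_mass N y"
proof -
  obtain r where r: "orthogonal_matrix r" "r *v x = y"
    using reflection_exists[of x y] assms by auto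
  have "cap_mass N y = (\<integral>z. ((1 + y \<bullet> z) / 2) ^ N \<partial>distr sphere_measure sphere_measure ((*v) r))"
    by (simp add: cap_mass_def distr_sphere_measure_orthogonal[OF r(1)])
  also have "\<dots> = (\<integral>z. ((1 + y \<bullet> (r *v z)) / 2) ^ N \<partial>sphere_measure)"
    by (rule integral_distr[OF measurable_orthogonal_sphere[OF r(1)]]) measurable
  also have "\<dots> = cap_mass N x"
    unfolding cap_mass_def r(2)[symmetric] orthogonal_matrix_inner[OF r(1)] ..
  finally show ?thesis ..
qed

lemma continuous_on_matrix_mult [continuous_intros]:
  fixes f :: "'a::topological_space \<Rightarrow> real^'n^'m::finite" and g :: "'a \<Rightarrow> real^'k::finite^'n::finite"
  assumes "continuous_on S f" "continuous_on S g"
  shows "continuous_on S (\<lambda>x. f x ** g x)"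
  unfolding matrix_matrix_mult_def
  by (intro continuous_on_vec_lambda continuous_intros assms)

lemma zonal_continuous: "continuous_on UNIV (zonal TYPE('n::finite) m)"
proof -
  have "continuous_on UNIV (\<lambda>u. jacobi a b m (2 * u\<^sup>2 - 1))" for a b
    unfolding jacobi_def by (intro continuous_intros) auto
  then show ?thesis
    unfolding zonal_def divide_inverse by (intro continuous_on_mult_right)
qed

lemma snd_sphere_measurable [measurable]: "snd \<in> borel_measurable (M \<Otimes>\<^sub>M sphere_measure)"
  by (rule measurable_compose[OF measurable_snd measurable_ident_sphere_measure])

text \<open>
  Dominated convergence: by \<open>cap_kernel_approx_identity\<close> the inner average tends to \<open>G \<omega> (L \<omega>)\<close>, and as an
  average it is bounded by \<open>B\<close>. The mass of the kernel may be taken at the fixed point \<open>e\<close>, since it is the same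
  at all points of the sphere.
\<close>

lemma cap_average_limit:
  fixes L :: "'w \<Rightarrow> real^'n::finite"
  assumes M: "prob_space M" and w: "integrable M w" and L [measurable]: "L \<in> borel_measurable M"
    and L1: "AE \<omega> in M. norm (L \<omega>) = 1" and e: "norm (e :: real^'n) = 1"
    and G [measurable]: "(\<lambda>(\<omega>, z). G \<omega> z) \<in> borel_measurable (M \<Otimes>\<^sub>M borel)"
      "(\<lambda>(\<omega>, z). G \<omega> z) \<in> borel_measurable (M \<Otimes>\<^sub>M sphere_measure)"
    and Gc: "\<And>\<omega>. continuous_on usphere (G \<omega>)" and GB: "\<And>\<omega> z. \<omega> \<in> space M \<Longrightarrow> norm z = 1 \<Longrightarrow> \<bar>G \<omega> z\<bar> \<le> B"
  shows "(\<lambda>N. (\<integral>\<omega>. w \<omega> * (\<integral>z. ((1 + L \<omega> \<bullet> z) / 2) ^ N * G \<omega> z \<partial>sphere_measure) \<partial>M) / cap_mass N e)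
    \<longlonglongrightarrow> (\<integral>\<omega>. w \<omega> * G \<omega> (L \<omega>) \<partial>M)"
proof -
  interpret S: prob_space "sphere_measure :: (real^'n) measure" by (rule prob_space_sphere_measure)
  note [measurable] = borel_measurable_integrable[OF w]
  let ?A = "\<lambda>N \<omega>. (\<integral>z. ((1 + L \<omega> \<bullet> z) / 2) ^ N * G \<omega> z \<partial>sphere_measure) / cap_mass N e"
  have "(\<lambda>N. \<integral>\<omega>. w \<omega> * ?A N \<omega> \<partial>M) \<longlonglongrightarrow> (\<integral>\<omega>. w \<omega> * G \<omega> (L \<omega>) \<partial>M)"
  proof (rule integral_dominated_convergence[where w="\<lambda>\<omega>. \<bar>w \<omega>\<bar> * B"])
    show "(\<lambda>\<omega>. w \<omega> * G \<omega> (L \<omega>)) \<in> borel_measurable M" by measurable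
    show "(\<lambda>\<omega>. w \<omega> * ?A N \<omega>) \<in> borel_measurable M" for N by measurable
    show "integrable M (\<lambda>\<omega>. \<bar>w \<omega>\<bar> * B)" using w by simp
    show "AE \<omega> in M. (\<lambda>N. w \<omega> * ?A N \<omega>) \<longlonglongrightarrow> w \<omega> * G \<omega> (L \<omega>)"
      using L1
    proof eventually_elim
      case (elim \<omega>)
      show ?case
        using cap_kernel_approx_identity[OF elim Gc[of \<omega>]]
        by (intro tendsto_intros) (simp add: cap_mass_const[OF e elim])
    qed
    show "AE \<omega> in M. norm (w \<omega> * ?A N \<omega>) \<le> \<bar>w \<omega>\<bar> * B" for N
      using L1 AE_space
    proof eventually_elim
      case (elim \<omega>)
      have c: "0 < cap_mass N e" by (rule cap_mass_pos[OF e])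
      have "\<bar>\<integral>z. ((1 + L \<omega> \<bullet> z) / 2) ^ N * G \<omega> z \<partial>sphere_measure\<bar>
          \<le> (\<integral>z. \<bar>((1 + L \<omega> \<bullet> z) / 2) ^ N * G \<omega> z\<bar> \<partial>sphere_measure)"
        by (rule integral_abs_bound)
      also have "\<dots> \<le> (\<integral>z. ((1 + L \<omega> \<bullet> z) / 2) ^ N * B \<partial>sphere_measure)"
      proof (rule integral_mono)
        show "integrable sphere_measure (\<lambda>z. \<bar>((1 + L \<omega> \<bullet> z) / 2) ^ N * G \<omega> z\<bar>)"
          by (intro integrable_abs integrable_cap_kernel Gc)
        show "integrable sphere_measure (\<lambda>z. ((1 + L \<omega> \<bullet> z) / 2) ^ N * B)"
          by (intro integrable_cap_kernel continuous_intros)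
        fix z :: "real^'n" assume "z \<in> space sphere_measure"
        then show "\<bar>((1 + L \<omega> \<bullet> z) / 2) ^ N * G \<omega> z\<bar> \<le> ((1 + L \<omega> \<bullet> z) / 2) ^ N * B"
          using cap_kernel_bounds(1)[OF elim(1), of z] GB[OF elim(2), of z] by (simp add: abs_mult mult_left_mono)
      qed
      also have "\<dots> = B * cap_mass N e"
        unfolding cap_mass_const[OF e elim(1)] by (simp add: cap_mass_def mult.commute)
      finally have "\<bar>?A N \<omega>\<bar> \<le> B" using c by (simp add: divide_le_eq)
      then show ?case by (simp only: real_norm_def abs_mult) (intro mult_left_mono abs_ge_zero)
    qed
  qed
  then show ?thesis by simp
qed

section \<open>Duality between points and great subspheres\<close>

text \<open>
  A random great subsphere, given by its normal projection \<open>P\<close>, and a random point \<open>L\<close> at distance \<open>t\<close> from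
  it. The invariance of their joint law takes the place of an average over the orthogonal group. The bound
  by 2 holds also on the null set where the directions of the point degenerate.
\<close>

locale equivariant_pair = prob_space M for M :: "'w measure" +
  fixes P :: "'w \<Rightarrow> real^'n^'n::finite" and L :: "'w \<Rightarrow> real^'n" and I :: "'n set" and t :: real
  assumes P_meas [measurable]: "P \<in> borel_measurable M" and L_meas [measurable]: "L \<in> borel_measurable M"
    and I: "I \<noteq> {}" "- I \<noteq> {}"
    and P_proj: "\<And>\<omega>. \<omega> \<in> space M \<Longrightarrow> subspace_proj I (P \<omega>)"
    and L_bound: "\<And>\<omega>. \<omega> \<in> space M \<Longrightarrow> norm (L \<omega>) \<le> 2"
    and L_norm: "AE \<omega> in M. norm (L \<omega>) = 1"
    and L_form: "\<And>m. AE \<omega> in M. latitude_form (real (card (- I)) / 2 - 1) (real (card I) / 2 - 1) m (P \<omega>) (L \<omega>)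
        = jacobi (real (card (- I)) / 2 - 1) (real (card I) / 2 - 1) m (cos (2 * t))"
    and invariant: "\<And>\<gamma>. orthogonal_matrix \<gamma> \<Longrightarrow>
        distr M borel (\<lambda>\<omega>. (\<gamma> ** P \<omega> ** transpose \<gamma>, \<gamma> *v L \<omega>)) = distr M borel (\<lambda>\<omega>. (P \<omega>, L \<omega>))"
begin

abbreviation "\<alpha> \<equiv> real (card (- I)) / 2 - 1"
abbreviation "\<beta> \<equiv> real (card I) / 2 - 1"
abbreviation "S \<equiv> (sphere_measure :: (real^'n) measure)"

lemma PL_invariant:
  assumes g: "orthogonal_matrix \<gamma>" and F [measurable]: "F \<in> borel_measurable borel"
  shows "(\<integral>\<omega>. F (\<gamma> ** P \<omega> ** transpose \<gamma>, \<gamma> *v L \<omega>) \<partial>M) = (\<integral>\<omega>. (F (P \<omega>, L \<omega>) :: real) \<partial>M)"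
proof -
  have [measurable]: "(\<lambda>A :: real^'n^'n. \<gamma> ** A ** transpose \<gamma>) \<in> borel_measurable borel"
    by (intro borel_measurable_continuous_onI continuous_intros)
  have [measurable]: "(\<lambda>\<omega>. \<gamma> ** P \<omega> ** transpose \<gamma>) \<in> borel_measurable M"
    by (rule measurable_compose[OF P_meas]) measurable
  have "(\<integral>\<omega>. F (\<gamma> ** P \<omega> ** transpose \<gamma>, \<gamma> *v L \<omega>) \<partial>M)
      = (\<integral>p. F p \<partial>distr M borel (\<lambda>\<omega>. (\<gamma> ** P \<omega> ** transpose \<gamma>, \<gamma> *v L \<omega>)))"
    by (rule integral_distr[symmetric]) measurable
  also have "\<dots> = (\<integral>p. F p \<partial>distr M borel (\<lambda>\<omega>. (P \<omega>, L \<omega>)))" by (simp add: invariant[OF g])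
  also have "\<dots> = (\<integral>\<omega>. F (P \<omega>, L \<omega>) \<partial>M)" by (rule integral_distr) measurable
  finally show ?thesis .
qed

text \<open>
  How the position of \<open>L\<close> near \<open>z\<close>, weighted by the approximate identity, correlates with the distance
  between \<open>y\<close> and the random subsphere.
\<close>

definition corr :: "nat \<Rightarrow> nat \<Rightarrow> real^'n \<Rightarrow> real^'n \<Rightarrow> real" where
  "corr m N y z = (\<integral>\<omega>. ((1 + L \<omega> \<bullet> z) / 2) ^ N * latitude_form \<alpha> \<beta> m (P \<omega>) y \<partial>M)"

lemma corr_invariant:
  assumes g: "orthogonal_matrix \<gamma>"
  shows "corr m N (\<gamma> *v y) (\<gamma> *v z) = corr m N y z"
proof -
  let ?F = "\<lambda>p. ((1 + snd p \<bullet> (\<gamma> *v z)) / 2) ^ N * latitude_form \<alpha> \<beta> m (fst p) (\<gamma> *v y)"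
  have "?F \<in> borel_measurable borel"
    by (intro borel_measurable_continuous_onI continuous_intros) auto
  from PL_invariant[OF g this] show ?thesis
    by (simp add: corr_def latitude_form_conj[OF g] orthogonal_matrix_inner[OF g])
qed

lemma corr_even: "e \<in> {1, -1} \<Longrightarrow> corr m N (e *\<^sub>R y) z = corr m N y z"
  unfolding corr_def by (simp only: latitude_form_even)

text \<open>
  A reflection that fixes \<open>z\<close> moves \<open>e y\<close> to \<open>y'\<close>, and the sign \<open>e\<close> is absorbed by \<open>corr_even\<close>.
\<close>

lemma corr_same_angle:
  assumes "norm y = 1" "norm y' = 1" "e \<in> {1, -1}" "y' \<bullet> z = e * (y \<bullet> z)"
  shows "corr m N y' z = corr m N y z"
proof -
  have "norm (e *\<^sub>R y) = norm y'" and z: "(e *\<^sub>R y) \<bullet> z = y' \<bullet> z" using assms by auto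
  then obtain r where r: "orthogonal_matrix r" "r *v (e *\<^sub>R y) = y'" "r *v z = z"
    using reflection_exists by metis
  have "corr m N y' z = corr m N (e *\<^sub>R y) z"
    using corr_invariant[OF r(1), of m N "e *\<^sub>R y" z] r by simp
  then show ?thesis using corr_even[OF assms(3)] by simp
qed

lemma kernel_bound:
  assumes "\<omega> \<in> space M" "norm z = 1"
  shows "\<bar>((1 + L \<omega> \<bullet> z) / 2) ^ N\<bar> \<le> 2 ^ N"
proof -
  have "\<bar>L \<omega> \<bullet> z\<bar> \<le> 2" using Cauchy_Schwarz_ineq2[of "L \<omega>" z] L_bound[OF assms(1)] assms(2) by simp
  then have "\<bar>(1 + L \<omega> \<bullet> z) / 2\<bar> \<le> 2" by simp
  then show ?thesis unfolding power_abs by (intro power_mono) auto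
qed

lemma integrable_kernel:
  assumes "norm z = 1" shows "integrable M (\<lambda>\<omega>. ((1 + L \<omega> \<bullet> z) / 2) ^ N)"
  using kernel_bound[OF _ assms] by (intro integrable_const_bound[where B="2 ^ N"] AE_I2) auto

lemma integrable_form:
  assumes "norm y = 1" shows "integrable M (\<lambda>\<omega>. latitude_form \<alpha> \<beta> m (P \<omega>) y)"
  using latitude_form_bound[OF P_proj assms, of _ \<alpha> \<beta> m]
  by (intro integrable_const_bound[where B="form_bound \<alpha> \<beta> m"] AE_I2) auto

text \<open>
  By \<open>corr_same_angle\<close> the correlation does not change if \<open>y\<close> is averaged over all points that form the same
  angle with \<open>z\<close>. Under the integral, this average is the one of \<open>zonal_mean\<close>.
\<close>

lemma corr_zonal:
  assumes y: "norm y = 1" and z: "norm z = 1"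
  shows "corr m N y z = corr m N z z * zonal TYPE('n) m (y \<bullet> z)"
proof -
  interpret S: prob_space S by (rule prob_space_sphere_measure)
  obtain i r where r: "orthogonal_matrix r" "r *v axis i 1 = z" using exists_axis_proj[OF z] .
  obtain a b where "a \<in> I" "b \<in> - I" using I by blast
  then have card: "CARD('n) \<ge> 2" using card_mono[of "UNIV :: 'n set" "{a, b}"] by (cases "a = b") auto
  let ?Q = "r ** coord_proj (- {i}) ** transpose r"
  \<comment> \<open>the points at distance \<open>s\<close> from the line through \<open>z\<close> form the same angle as \<open>y\<close> with \<open>z\<close> or with \<open>-z\<close>\<close>
  define s where "s = arccos (y \<bullet> z)"
  have cs: "cos s = y \<bullet> z" unfolding s_def
    using Cauchy_Schwarz_ineq2[of y z] y z by (intro cos_arccos) auto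
  let ?K = "\<lambda>\<omega>. ((1 + L \<omega> \<bullet> z) / 2) ^ N" and ?H = "\<lambda>\<omega>. latitude_form \<alpha> \<beta> m (P \<omega>)"
  have "corr m N y z = (\<integral>x. corr m N y z \<partial>S)" by (simp add: S.prob_space[unfolded space_sphere_measure])
  also have "\<dots> = (\<integral>x. corr m N (latitude s ?Q x) z \<partial>S)"
  proof (rule integral_cong_AE)
    show "(\<lambda>x. corr m N (latitude s ?Q x) z) \<in> borel_measurable S"
      unfolding corr_def by measurable
    show "AE x in S. corr m N y z = corr m N (latitude s ?Q x) z"
      using latitude_zonal[OF r card, of s]
    proof eventually_elim
      case (elim x)
      then obtain e where e: "e \<in> {1, -1}" "latitude s ?Q x \<bullet> z = e * (y \<bullet> z)" "norm (latitude s ?Q x) = 1"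
        unfolding cs by blast
      show ?case by (rule corr_same_angle[OF y e(3) e(1,2), symmetric])
    qed
  qed measurable
  also have "\<dots> = (\<integral>x. \<integral>\<omega>. ?K \<omega> * ?H \<omega> (latitude s ?Q x) \<partial>M \<partial>S)" unfolding corr_def ..
  also have "\<dots> = (\<integral>\<omega>. ?K \<omega> * (\<integral>x. ?H \<omega> (latitude s ?Q x) \<partial>S) \<partial>M)"
  proof (rule weighted_fubini_sphere[OF prob_space_axioms integrable_kernel[OF z]])
    show "(\<lambda>(\<omega>, x). ?H \<omega> (latitude s ?Q x)) \<in> borel_measurable (M \<Otimes>\<^sub>M S)" by measurable
    fix \<omega> and x :: "real^'n" assume w: "\<omega> \<in> space M"
    have "\<bar>?H \<omega> (latitude s ?Q x)\<bar> \<le> form_bound \<alpha> \<beta> m * norm (latitude s ?Q x) ^ (2 * m)"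
      by (rule latitude_form_bound'[OF P_proj[OF w]])
    also have "\<dots> \<le> form_bound \<alpha> \<beta> m * 2 ^ (2 * m)"
      unfolding form_bound_def by (intro mult_left_mono power_mono latitude_norm_le sum_nonneg) auto
    finally show "\<bar>?H \<omega> (latitude s ?Q x)\<bar> \<le> form_bound \<alpha> \<beta> m * 2 ^ (2 * m)" .
  qed
  also have "\<dots> = (\<integral>\<omega>. ?K \<omega> * (?H \<omega> z * zonal TYPE('n) m (cos s)) \<partial>M)"
    by (intro Bochner_Integration.integral_cong refl) (simp add: zonal_mean[OF I P_proj r])
  also have "\<dots> = corr m N z z * zonal TYPE('n) m (cos s)"
    unfolding corr_def by (simp add: mult.assoc[symmetric])
  finally show ?thesis unfolding cs .
qed

lemma corr_diag_const:
  assumes "norm z = 1" "norm z' = 1" shows "corr m N z z = corr m N z' z'"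
proof -
  obtain r where r: "orthogonal_matrix r" "r *v z = z'"
    using reflection_exists[of z z'] assms by auto
  show ?thesis using corr_invariant[OF r(1), of m N z z] r(2) by simp
qed

text \<open>
  The correlation is integrated against \<open>f z\<close>, divided by the mass of the kernel. As \<open>N\<close> grows, the kernel
  forces \<open>z = L\<close>, and the left-hand side appears. On the other hand \<open>corr_zonal\<close> splits off the integral on
  the right-hand side. What remains is the correlation at \<open>y = z\<close>, which does not depend on \<open>z\<close>. In the
  limit it becomes the expectation of the form at the point \<open>L\<close> itself, where it is constantly the Jacobi
  value at distance \<open>t\<close>.
\<close>

lemma duality_continuous:
  assumes f: "continuous_on UNIV (f :: real^'n \<Rightarrow> real)" and y: "norm y = 1"
  shows "(\<integral>\<omega>. f (L \<omega>) * latitude_form \<alpha> \<beta> m (P \<omega>) y \<partial>M)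
    = jacobi \<alpha> \<beta> m (cos (2 * t)) * (\<integral>z. f z * zonal TYPE('n) m (y \<bullet> z) \<partial>S)"
proof -
  interpret S: prob_space S by (rule prob_space_sphere_measure)
  let ?K = "\<lambda>N \<omega> z. ((1 + L \<omega> \<bullet> z) / 2) ^ N" and ?H = "\<lambda>\<omega>. latitude_form \<alpha> \<beta> m (P \<omega>)"
  let ?I = "\<integral>z. f z * zonal TYPE('n) m (y \<bullet> z) \<partial>S"
  note M = prob_space_axioms
  have [measurable]: "f \<in> borel_measurable borel" using f by (rule borel_measurable_continuous_onI)
  have cf: "continuous_on usphere f" by (rule continuous_on_subset[OF f]) simp
  obtain B where B0: "0 \<le> B" and B: "\<And>z. norm z = 1 \<Longrightarrow> \<bar>f z\<bar> \<le> B"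
    using sphere_continuous_bounded[OF cf] by blast
  have KG: "\<bar>?K N \<omega> z * g\<bar> \<le> 2 ^ N * D" if "\<omega> \<in> space M" "norm z = 1" "\<bar>g\<bar> \<le> D" for N \<omega> z g D
    unfolding abs_mult using that by (intro mult_mono kernel_bound) auto
  have kappa: "(\<lambda>N. corr m N y y / cap_mass N y) \<longlonglongrightarrow> jacobi \<alpha> \<beta> m (cos (2 * t))"
  proof -
    have eq: "corr m N y y = (\<integral>\<omega>. 1 * (\<integral>z. ?K N \<omega> z * ?H \<omega> z \<partial>S) \<partial>M)" for N
    proof -
      have "corr m N y y = (\<integral>z. corr m N y y \<partial>S)" by (simp add: S.prob_space[unfolded space_sphere_measure])
      also have "\<dots> = (\<integral>z. \<integral>\<omega>. 1 * (?K N \<omega> z * ?H \<omega> z) \<partial>M \<partial>S)"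
        using corr_diag_const[OF y, of _ m N]
        by (intro Bochner_Integration.integral_cong refl) (simp add: corr_def)
      also have "\<dots> = (\<integral>\<omega>. 1 * (\<integral>z. ?K N \<omega> z * ?H \<omega> z \<partial>S) \<partial>M)"
      proof (rule weighted_fubini_sphere[OF M])
        show "(\<lambda>(\<omega>, z). ?K N \<omega> z * ?H \<omega> z) \<in> borel_measurable (M \<Otimes>\<^sub>M S)" by measurable
      qed (auto intro!: KG latitude_form_bound[OF P_proj])
      finally show ?thesis .
    qed
    have "(\<lambda>N. (\<integral>\<omega>. 1 * (\<integral>z. ?K N \<omega> z * ?H \<omega> z \<partial>S) \<partial>M) / cap_mass N y) \<longlonglongrightarrow> (\<integral>\<omega>. 1 * ?H \<omega> (L \<omega>) \<partial>M)"
      by (rule cap_average_limit[OF M _ L_meas L_norm y, where B="form_bound \<alpha> \<beta> m"])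
         (auto intro!: continuous_intros latitude_form_bound[OF P_proj])
    moreover have "(\<integral>\<omega>. 1 * ?H \<omega> (L \<omega>) \<partial>M) = (\<integral>\<omega>. jacobi \<alpha> \<beta> m (cos (2 * t)) \<partial>M)"
      using L_form[of m] by (intro integral_cong_AE) auto
    ultimately show ?thesis unfolding eq[symmetric] by (simp add: prob_space)
  qed
  have step: "(\<integral>\<omega>. ?H \<omega> y * (\<integral>z. ?K N \<omega> z * f z \<partial>S) \<partial>M) = corr m N y y * ?I" for N
  proof -
    have "(\<integral>\<omega>. ?H \<omega> y * (\<integral>z. ?K N \<omega> z * f z \<partial>S) \<partial>M) = (\<integral>z. \<integral>\<omega>. ?H \<omega> y * (?K N \<omega> z * f z) \<partial>M \<partial>S)"
    proof (rule weighted_fubini_sphere[OF M integrable_form[OF y], symmetric])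
      show "(\<lambda>(\<omega>, z). ?K N \<omega> z * f z) \<in> borel_measurable (M \<Otimes>\<^sub>M S)" by measurable
    qed (auto intro!: KG B)
    also have "\<dots> = (\<integral>z. corr m N y y * (f z * zonal TYPE('n) m (y \<bullet> z)) \<partial>S)"
    proof (intro Bochner_Integration.integral_cong refl)
      fix z assume "z \<in> space S"
      then have z: "norm z = 1" by simp
      have "(\<lambda>\<omega>. ?H \<omega> y * (?K N \<omega> z * f z)) = (\<lambda>\<omega>. f z * (?K N \<omega> z * ?H \<omega> y))" by (simp add: mult_ac)
      then have "(\<integral>\<omega>. ?H \<omega> y * (?K N \<omega> z * f z) \<partial>M) = f z * corr m N y z" unfolding corr_def by simp
      then show "(\<integral>\<omega>. ?H \<omega> y * (?K N \<omega> z * f z) \<partial>M) = corr m N y y * (f z * zonal TYPE('n) m (y \<bullet> z))"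
        unfolding corr_zonal[OF y z, of m N] corr_diag_const[OF z y, of m N] by (simp only: mult_ac)
    qed
    finally show ?thesis by simp
  qed
  have "(\<lambda>N. (\<integral>\<omega>. ?H \<omega> y * (\<integral>z. ?K N \<omega> z * f z \<partial>S) \<partial>M) / cap_mass N y) \<longlonglongrightarrow> (\<integral>\<omega>. ?H \<omega> y * f (L \<omega>) \<partial>M)"
    by (rule cap_average_limit[OF M integrable_form[OF y] L_meas L_norm y, where B=B]) (auto intro!: B cf)
  then have "(\<lambda>N. corr m N y y / cap_mass N y * ?I) \<longlonglongrightarrow> (\<integral>\<omega>. ?H \<omega> y * f (L \<omega>) \<partial>M)"
    unfolding step by simp
  moreover have "(\<lambda>N. corr m N y y / cap_mass N y * ?I) \<longlonglongrightarrow> jacobi \<alpha> \<beta> m (cos (2 * t)) * ?I"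
    by (intro tendsto_intros kappa)
  ultimately show ?thesis by (simp add: LIMSEQ_unique mult.commute)
qed

end

lemma integral_distr_density:
  fixes w :: "'w \<Rightarrow> real" and f :: "'b::topological_space \<Rightarrow> real"
  assumes [measurable]: "w \<in> borel_measurable M" "X \<in> M \<rightarrow>\<^sub>M borel" "f \<in> borel_measurable borel"
    and w: "AE x in M. 0 \<le> w x"
  shows "(\<integral>y. f y \<partial>distr (density M (\<lambda>x. ennreal (w x))) borel X) = (\<integral>x. w x * f (X x) \<partial>M)"
proof -
  have "(\<integral>y. f y \<partial>distr (density M (\<lambda>x. ennreal (w x))) borel X) = (\<integral>x. f (X x) \<partial>density M (\<lambda>x. ennreal (w x)))"
    by (rule integral_distr) measurable
  also have "\<dots> = (\<integral>x. w x *\<^sub>R f (X x) \<partial>M)"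
    by (rule integral_density) (use w in measurable)
  finally show ?thesis by simp
qed

lemma finite_measure_distr_density:
  fixes w :: "'w \<Rightarrow> real"
  assumes w: "integrable M w" and [measurable]: "X \<in> M \<rightarrow>\<^sub>M borel"
  shows "finite_measure (distr (density M (\<lambda>x. ennreal (w x))) borel X)"
proof -
  note [measurable] = borel_measurable_integrable[OF w]
  have "finite_measure (density M (\<lambda>x. ennreal (w x)))"
  proof (rule finite_measureI)
    have "emeasure (density M (\<lambda>x. ennreal (w x))) (space M) = (\<integral>\<^sup>+x. ennreal (w x) \<partial>M)"
      by (subst emeasure_density) (auto intro!: nn_integral_cong)
    also have "\<dots> \<le> (\<integral>\<^sup>+x. ennreal (norm (w x)) \<partial>M)"
      by (intro nn_integral_mono ennreal_leI) auto
    also have "\<dots> < \<infinity>" using w by (simp add: integrable_iff_bounded)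
    finally show "emeasure (density M (\<lambda>x. ennreal (w x))) (space (density M (\<lambda>x. ennreal (w x)))) \<noteq> \<infinity>" by simp
  qed
  then show ?thesis by (rule finite_measure.finite_measure_distr) measurable
qed

lemma zonal_0: "zonal TYPE('n::finite) 0 u = 1"
  by (simp add: zonal_def jacobi_def)

context equivariant_pair
begin

text \<open>
  This is the duality for \<open>m = 0\<close>, where both harmonics are the constant 1.
\<close>

lemma law_L: "distr M borel L = distr S borel (\<lambda>x. x)"
proof (rule finite_measure_eqI_continuous)
  interpret S: prob_space S by (rule prob_space_sphere_measure)
  show "finite_measure (distr M borel L)" by (intro finite_measure_distr) measurable
  show "finite_measure (distr S borel (\<lambda>x. x))" by (intro S.finite_measure_distr) measurable
  fix f :: "real^'n \<Rightarrow> real" assume f: "continuous_on UNIV f"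
  then have [measurable]: "f \<in> borel_measurable borel" by (rule borel_measurable_continuous_onI)
  obtain i :: 'n where True by blast
  have "norm (axis i 1 :: real^'n) = 1" by simp
  from duality_continuous[OF f this, of 0]
  have "(\<integral>\<omega>. f (L \<omega>) \<partial>M) = (\<integral>z. f z \<partial>S)"
    by (simp add: latitude_form_def jacobi_coeff_def jacobi_def zonal_0)
  then show "integral\<^sup>L (distr M borel L) f = integral\<^sup>L (distr S borel (\<lambda>x. x)) f"
    by (subst (1 2) integral_distr) auto
qed auto

lemma integrable_L_iff:
  assumes [measurable]: "f \<in> borel_measurable borel"
  shows "integrable M (\<lambda>\<omega>. f (L \<omega>) :: real) \<longleftrightarrow> integrable S f"
  using integrable_distr_eq[of L M borel f] integrable_distr_eq[of "\<lambda>x. x" S borel f]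
  by (simp add: law_L)

text \<open>
  A large constant \<open>B\<close> makes the two weights \<open>B + H\<close> and \<open>B + u\<close> nonnegative. The image under \<open>L\<close> of the
  first weighted measure and the second one agree on continuous functions, so they are equal and have the
  same integrals of \<open>f\<close>; the contributions of \<open>B\<close> agree by \<open>law_L\<close>.
\<close>

theorem duality_L1:
  assumes [measurable]: "f \<in> borel_measurable borel" and f: "integrable S f" and y: "norm y = 1"
  shows "(\<integral>\<omega>. f (L \<omega>) * latitude_form \<alpha> \<beta> m (P \<omega>) y \<partial>M)
    = jacobi \<alpha> \<beta> m (cos (2 * t)) * (\<integral>z. f z * zonal TYPE('n) m (y \<bullet> z) \<partial>S)"
proof -
  interpret S: prob_space S by (rule prob_space_sphere_measure)
  define J where "J = jacobi \<alpha> \<beta> m (cos (2 * t))"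
  define u where "u z = J * zonal TYPE('n) m (y \<bullet> z)" for z
  define H where "H \<omega> = latitude_form \<alpha> \<beta> m (P \<omega>) y" for \<omega>
  have gu: "(\<integral>z. g z * u z \<partial>S) = J * (\<integral>z. g z * zonal TYPE('n) m (y \<bullet> z) \<partial>S)" for g
  proof -
    have "(\<lambda>z. g z * u z) = (\<lambda>z. J * (g z * zonal TYPE('n) m (y \<bullet> z)))" by (simp add: u_def mult_ac)
    then show ?thesis by simp
  qed
  have uc: "continuous_on A u" for A
    unfolding u_def
    by (intro continuous_intros continuous_on_compose2[OF zonal_continuous]) auto
  have um [measurable]: "u \<in> borel_measurable borel" using uc by (rule borel_measurable_continuous_onI)
  have Hm [measurable]: "H \<in> borel_measurable M" unfolding H_def by measurable
  obtain B0 where B0: "\<And>z. norm z = 1 \<Longrightarrow> \<bar>u z\<bar> \<le> B0"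
    using sphere_continuous_bounded[OF uc] by blast
  define B where "B = max B0 (form_bound \<alpha> \<beta> m)"
  have Bu: "\<bar>u z\<bar> \<le> B" if "norm z = 1" for z using B0[OF that] by (simp add: B_def)
  have BH: "\<bar>H \<omega>\<bar> \<le> B" if "\<omega> \<in> space M" for \<omega>
    using latitude_form_bound[OF P_proj[OF that] y, of \<alpha> \<beta> m] by (simp add: B_def H_def)
  let ?N1 = "distr (density M (\<lambda>\<omega>. ennreal (B + H \<omega>))) borel L"
  let ?N2 = "distr (density S (\<lambda>z. ennreal (B + u z))) borel (\<lambda>x. x)"
  have pos1: "AE \<omega> in M. 0 \<le> B + H \<omega>"
  proof (rule AE_I2)
    show "0 \<le> B + H \<omega>" if "\<omega> \<in> space M" for \<omega> using BH[OF that] by linarith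
  qed
  have pos2: "AE z in S. 0 \<le> B + u z"
  proof (rule AE_I2)
    show "0 \<le> B + u z" if "z \<in> space S" for z using Bu[of z] that by auto
  qed
  have int1: "(\<integral>x. g x \<partial>?N1) = B * (\<integral>\<omega>. g (L \<omega>) \<partial>M) + (\<integral>\<omega>. g (L \<omega>) * H \<omega> \<partial>M)"
    and int2: "(\<integral>x. g x \<partial>?N2) = B * (\<integral>z. g z \<partial>S) + (\<integral>z. g z * u z \<partial>S)"
    and same: "(\<integral>\<omega>. g (L \<omega>) \<partial>M) = (\<integral>z. g z \<partial>S)"
    if gm [measurable]: "g \<in> borel_measurable borel" and gi: "integrable S g" for g :: "real^'n \<Rightarrow> real"
  proof -
    have gL: "integrable M (\<lambda>\<omega>. g (L \<omega>))" using gi by (simp add: integrable_L_iff)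
    have gLH: "integrable M (\<lambda>\<omega>. g (L \<omega>) * H \<omega>)"
      by (rule integrable_mult_bounded[OF gL Hm BH])
    have gu: "integrable S (\<lambda>z. g z * u z)"
      by (rule integrable_mult_bounded[OF gi, of _ B]) (auto intro: Bu)
    show "(\<integral>x. g x \<partial>?N1) = B * (\<integral>\<omega>. g (L \<omega>) \<partial>M) + (\<integral>\<omega>. g (L \<omega>) * H \<omega> \<partial>M)"
    proof -
      have "(\<lambda>\<omega>. (B + H \<omega>) * g (L \<omega>)) = (\<lambda>\<omega>. B * g (L \<omega>) + g (L \<omega>) * H \<omega>)" by (simp add: algebra_simps)
      then show ?thesis using gL gLH by (subst integral_distr_density[OF _ L_meas gm pos1]) simp_all
    qed
    show "(\<integral>x. g x \<partial>?N2) = B * (\<integral>z. g z \<partial>S) + (\<integral>z. g z * u z \<partial>S)"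
    proof -
      have "(\<lambda>z. (B + u z) * g z) = (\<lambda>z. B * g z + g z * u z)" by (simp add: algebra_simps)
      then show ?thesis
        using gi gu by (subst integral_distr_density[OF _ measurable_ident_sphere_measure gm pos2]) simp_all
    qed
    have "(\<integral>\<omega>. g (L \<omega>) \<partial>M) = (\<integral>x. g x \<partial>distr M borel L)" by (rule integral_distr[symmetric]) measurable
    also have "\<dots> = (\<integral>x. g x \<partial>distr S borel (\<lambda>x. x))" unfolding law_L ..
    also have "\<dots> = (\<integral>z. g z \<partial>S)" by (rule integral_distr) measurable
    finally show "(\<integral>\<omega>. g (L \<omega>) \<partial>M) = (\<integral>z. g z \<partial>S)" .
  qed
  have "?N1 = ?N2"
  proof (rule finite_measure_eqI_continuous)
    have "integrable M H" by (rule integrable_const_bound[where B=B]) (auto simp: BH)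
    then show "finite_measure ?N1" by (intro finite_measure_distr_density) auto
    have "integrable S u" by (rule S.integrable_const_bound[where B=B]) (auto simp: Bu)
    then show "finite_measure ?N2"
      by (intro finite_measure_distr_density measurable_ident_sphere_measure Bochner_Integration.integrable_add) auto
    fix g :: "real^'n \<Rightarrow> real" assume g: "continuous_on UNIV g"
    then have gm: "g \<in> borel_measurable borel" by (rule borel_measurable_continuous_onI)
    have gi: "integrable S g" by (intro integrable_sphere_continuous continuous_on_subset[OF g]) simp
    show "integral\<^sup>L ?N1 g = integral\<^sup>L ?N2 g"
      unfolding int1[OF gm gi] int2[OF gm gi] same[OF gm gi]
      unfolding gu duality_continuous[OF g y, of m, folded H_def J_def] ..
  qed auto
  then have "integral\<^sup>L ?N1 f = integral\<^sup>L ?N2 f" by simp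
  then have "(\<integral>\<omega>. f (L \<omega>) * H \<omega> \<partial>M) = (\<integral>z. f z * u z \<partial>S)"
    unfolding int1[OF assms(1) f] int2[OF assms(1) f] same[OF assms(1) f] by simp
  then show ?thesis unfolding gu unfolding H_def J_def .
qed

end

section \<open>Completeness of the zonal harmonics\<close>

text \<open>
  As a polynomial in \<open>u\<^sup>2\<close> the zonal harmonic has degree exactly \<open>m\<close>, because its leading coefficient is a
  sum of positive numbers. So \<open>u\<^sup>2\<^sup>m\<close> is a combination of the zonal harmonics of index at most \<open>m\<close>.
\<close>

lemma zonal_span:
  fixes \<Lambda> :: "(real \<Rightarrow> real) \<Rightarrow> real"
  assumes add: "\<And>f g. continuous_on UNIV f \<Longrightarrow> continuous_on UNIV g \<Longrightarrow> \<Lambda> (\<lambda>u. f u + g u) = \<Lambda> f + \<Lambda> g"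
    and scale: "\<And>c f. continuous_on UNIV f \<Longrightarrow> \<Lambda> (\<lambda>u. c * f u) = c * \<Lambda> f"
    and zonal: "\<And>m. \<Lambda> (zonal TYPE('n::finite) m) = 0"
    and card: "CARD('n) \<ge> 2"
  shows "\<Lambda> (\<lambda>u. u ^ (2 * m)) = 0"
proof -
  define \<alpha> where "\<alpha> = (real CARD('n) - 1) / 2 - 1"
  have \<alpha>: "- 1 < \<alpha>" using card by (simp add: \<alpha>_def)
  have zero: "\<Lambda> (\<lambda>u. 0) = 0" using scale[of "\<lambda>_. 0" 0] by simp
  have sum0: "\<Lambda> (\<lambda>u. \<Sum>i\<in>A. f i u) = (\<Sum>i\<in>A. \<Lambda> (f i))" if "finite A" "\<And>i. i \<in> A \<Longrightarrow> continuous_on UNIV (f i)" for A :: "nat set" and f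
    using that
  proof (induction A)
    case empty then show ?case by (simp add: zero)
  next
    case (insert x F)
    then have "\<Lambda> (\<lambda>u. f x u + (\<Sum>i\<in>F. f i u)) = \<Lambda> (f x) + (\<Sum>i\<in>F. \<Lambda> (f i))"
      by (subst add) (auto intro!: continuous_intros)
    then show ?case using insert by simp
  qed
  show ?thesis
  proof (induction m rule: less_induct)
    case (less m)
    define a where "a s = ((real m + \<alpha>) gchoose (m - s)) * ((real m + (- 1 / 2)) gchoose s)" for s
    \<comment> \<open>the zonal harmonic as a polynomial in \<open>u\<^sup>2\<close>, up to normalization\<close>
    define p where "p = (\<Sum>s\<le>m. Polynomial.smult (a s) ([:-1, 1:] ^ s * [:0, 1:] ^ (m - s)))"
    have pu: "poly p (u\<^sup>2) = jacobi \<alpha> (- 1 / 2) m (2 * u\<^sup>2 - 1)" for u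
    proof -
      have "(2 * u\<^sup>2 - 1 - 1) / 2 = u\<^sup>2 - 1" "(2 * u\<^sup>2 - 1 + 1) / 2 = u\<^sup>2" by (simp_all add: field_simps)
      note e = this
      show ?thesis unfolding p_def jacobi_def e by (simp add: poly_sum a_def mult.assoc)
    qed
    have degs: "degree (Polynomial.smult (a s) ([:-1, 1:] ^ s * [:0, 1:] ^ (m - s))) \<le> m" if "s \<le> m" for s
    proof -
      have "degree ([:-1, 1::real:] ^ s * [:0, 1:] ^ (m - s)) \<le> s + (m - s)"
        by (intro order_trans[OF degree_mult_le] add_mono order_trans[OF degree_power_le]) auto
      then show ?thesis using that by (intro order_trans[OF degree_smult_le]) simp
    qed
    have deg: "degree p \<le> m" unfolding p_def by (intro degree_sum_le degs) auto
    have "coeff ([:-1, 1::real:] ^ s * [:0, 1:] ^ (m - s)) m = 1" if "s \<le> m" for s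
    proof -
      have "degree ([:-1, 1::real:] ^ s * [:0, 1:] ^ (m - s)) = m"
        using that by (subst degree_mult_eq) (auto simp: degree_power_eq)
      moreover have "lead_coeff ([:-1, 1::real:] ^ s * [:0, 1:] ^ (m - s)) = 1"
        by (simp add: lead_coeff_mult lead_coeff_power)
      ultimately show ?thesis by simp
    qed
    then have "coeff p m = (\<Sum>s\<le>m. a s)" unfolding p_def by (simp add: coeff_sum)
    moreover have "0 < a s" if "s \<le> m" for s
      unfolding a_def using that \<alpha> by (intro mult_pos_pos gbinomial_pos) auto
    ultimately have lead: "coeff p m > 0" using sum_pos[of "{..m}" a] by auto
    have ex: "poly p (u\<^sup>2) = (\<Sum>i\<le>m. coeff p i * u ^ (2 * i))" for u
      unfolding poly_altdef power_mult using deg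
      by (intro sum.mono_neutral_left) (auto simp: coeff_eq_0)
    have "\<Lambda> (\<lambda>u. poly p (u\<^sup>2)) = \<Lambda> (\<lambda>u. jacobi \<alpha> (- 1 / 2) m 1 * zonal TYPE('n) m u)"
      using jacobi_coeff_0_pos[OF \<alpha>, of "- 1 / 2" m]
      unfolding pu zonal_def \<alpha>_def[symmetric] jacobi_1 by simp
    also have "\<dots> = 0" using scale[OF zonal_continuous[where 'n='n]] zonal by simp
    finally have "0 = (\<Sum>i\<le>m. \<Lambda> (\<lambda>u. coeff p i * u ^ (2 * i)))"
      unfolding ex by (subst (asm) sum0) (auto intro!: continuous_intros)
    also have "\<dots> = (\<Sum>i\<le>m. coeff p i * \<Lambda> (\<lambda>u. u ^ (2 * i)))"
      by (intro sum.cong refl scale continuous_intros)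
    also have "\<dots> = (\<Sum>i\<in>{m}. coeff p i * \<Lambda> (\<lambda>u. u ^ (2 * i)))"
      by (rule sum.mono_neutral_right) (use less in auto)
    finally show ?case using lead by simp
  qed
qed

text \<open>
  The orthogonality extends to all even powers of \<open>y \<bullet> x\<close> by \<open>zonal_span\<close>, and to the odd ones because \<open>f\<close> is
  even. Hence \<open>f\<close> is orthogonal to the kernels \<open>((1 + y \<bullet> x) / 2)\<^sup>N\<close>, and in the limit to all continuous
  functions. Then its positive and its negative part are densities of the same measure.
\<close>

theorem zonal_orthogonal_imp_zero:
  fixes f :: "real^'n::finite \<Rightarrow> real"
  assumes card: "CARD('n) \<ge> 2" and fm [measurable]: "f \<in> borel_measurable borel"
    and f: "integrable sphere_measure f" and even: "AE x in sphere_measure. f (- x) = f x"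
    and orth: "\<And>m y. norm y = 1 \<Longrightarrow> (\<integral>x. f x * zonal TYPE('n) m (y \<bullet> x) \<partial>sphere_measure) = 0"
  shows "AE x in sphere_measure. f x = 0"
proof -
  let ?S = "sphere_measure :: (real^'n) measure"
  interpret S: prob_space ?S by (rule prob_space_sphere_measure)
  have int: "integrable ?S (\<lambda>x. f x * g (y \<bullet> x))" if g: "continuous_on UNIV g" for g :: "real \<Rightarrow> real" and y
  proof -
    have c: "continuous_on A (\<lambda>x. g (y \<bullet> x))" for A
      by (intro continuous_on_compose2[OF g] continuous_intros) auto
    obtain B where "\<And>z. norm z = 1 \<Longrightarrow> \<bar>g (y \<bullet> z)\<bar> \<le> B"
      using sphere_continuous_bounded[OF c] by blast
    then show ?thesis
      by (intro integrable_mult_bounded[OF f] measurable_sphere_measure_borel borel_measurable_continuous_onI c) auto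
  qed
  have even_moment: "(\<integral>x. f x * (y \<bullet> x) ^ (2 * m) \<partial>?S) = 0" if y: "norm y = 1" for y m
  proof (rule zonal_span[where 'n='n and \<Lambda>="\<lambda>g. \<integral>x. f x * g (y \<bullet> x) \<partial>?S"])
    show "(\<integral>x. f x * (g (y \<bullet> x) + h (y \<bullet> x)) \<partial>?S) = (\<integral>x. f x * g (y \<bullet> x) \<partial>?S) + (\<integral>x. f x * h (y \<bullet> x) \<partial>?S)"
      if "continuous_on UNIV g" "continuous_on UNIV h" for g h
      using int[OF that(1), of y] int[OF that(2), of y] by (simp add: distrib_left)
    show "(\<integral>x. f x * (c * g (y \<bullet> x)) \<partial>?S) = c * (\<integral>x. f x * g (y \<bullet> x) \<partial>?S)" for c g
    proof -
      have "(\<lambda>x. f x * (c * g (y \<bullet> x))) = (\<lambda>x. c * (f x * g (y \<bullet> x)))" by (simp add: mult_ac)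
      then show ?thesis by simp
    qed
    show "(\<integral>x. f x * zonal TYPE('n) m (y \<bullet> x) \<partial>?S) = 0" for m by (rule orth[OF y])
  qed (rule card)
  have neg: "distr ?S ?S uminus = ?S"
    by (rule distr_sphere_measure_isometry) (auto simp: linear_uminus surj_def intro: exI[of _ "- _"])
  have negm: "uminus \<in> ?S \<rightarrow>\<^sub>M ?S"
    unfolding measurable_cong_sets[OF sets_sphere_measure sets_sphere_measure]
    by (rule measurable_restrict_space3) auto
  have odd_moment: "(\<integral>x. f x * (y \<bullet> x) ^ m \<partial>?S) = 0" if "odd m" for y m
  proof -
    have "(\<integral>x. f x * (y \<bullet> x) ^ m \<partial>?S) = (\<integral>x. f x * (y \<bullet> x) ^ m \<partial>distr ?S ?S uminus)" by (simp add: neg)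
    also have "\<dots> = (\<integral>x. f (- x) * (y \<bullet> (- x)) ^ m \<partial>?S)"
      by (rule integral_distr[OF negm]) measurable
    also have "\<dots> = (\<integral>x. - (f x * (y \<bullet> x) ^ m) \<partial>?S)"
    proof (rule integral_cong_AE)
      show "AE x in ?S. f (- x) * (y \<bullet> - x) ^ m = - (f x * (y \<bullet> x) ^ m)"
        using even by eventually_elim (use that in simp)
    qed measurable
    finally show ?thesis by simp
  qed
  have moment: "(\<integral>x. f x * (y \<bullet> x) ^ m \<partial>?S) = 0" if "norm y = 1" for y m
    using odd_moment[of m y] even_moment[OF that] by (cases "even m") (auto elim!: evenE)
  have kernel: "(\<integral>x. f x * ((1 + y \<bullet> x) / 2) ^ N \<partial>?S) = 0" if y: "norm y = 1" for y N
  proof -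
    have "f x * ((1 + y \<bullet> x) / 2) ^ N = (\<Sum>k\<le>N. (real (N choose k) / 2 ^ N) * (f x * (y \<bullet> x) ^ k))" for x
      using binomial_ring[of "y \<bullet> x" 1 N]
      by (simp add: power_divide add.commute sum_distrib_left sum_divide_distrib mult_ac)
    then have "(\<integral>x. f x * ((1 + y \<bullet> x) / 2) ^ N \<partial>?S)
        = (\<Sum>k\<le>N. (real (N choose k) / 2 ^ N) * (\<integral>x. f x * (y \<bullet> x) ^ k \<partial>?S))"
      by (simp only:) (subst Bochner_Integration.integral_sum,
          auto intro!: integrable_mult_right int[of "\<lambda>u. u ^ _"] continuous_intros)
    then show ?thesis by (simp add: moment[OF y])
  qed
  have cont: "(\<integral>x. f x * g x \<partial>?S) = 0" if g: "continuous_on UNIV g" for g :: "real^'n \<Rightarrow> real"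
  proof -
    obtain i :: 'n where True by blast
    have e: "norm (axis i 1 :: real^'n) = 1" by simp
    have cg: "continuous_on usphere g" by (rule continuous_on_subset[OF g]) simp
    have gm [measurable]: "g \<in> borel_measurable borel" using g by (rule borel_measurable_continuous_onI)
    obtain B where B: "\<And>z. norm z = 1 \<Longrightarrow> \<bar>g z\<bar> \<le> B"
      using sphere_continuous_bounded[OF cg] by blast
    let ?K = "\<lambda>N x z. ((1 + x \<bullet> z) / 2) ^ N"
    note L = S.prob_space_axioms f measurable_ident_sphere_measure
    have fst_meas [measurable]: "fst \<in> borel_measurable (?S \<Otimes>\<^sub>M ?S)"
      by (rule measurable_compose[OF measurable_fst measurable_ident_sphere_measure])
    have zero: "(\<integral>x. f x * (\<integral>z. ?K N x z * g z \<partial>?S) \<partial>?S) = 0" for N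
    proof -
      have "(\<integral>x. f x * (\<integral>z. ?K N x z * g z \<partial>?S) \<partial>?S) = (\<integral>z. \<integral>x. f x * (?K N x z * g z) \<partial>?S \<partial>?S)"
      proof (rule weighted_fubini_sphere[OF L(1,2), where B="1 * B", symmetric])
        show "(\<lambda>(x, z). ?K N x z * g z) \<in> borel_measurable (?S \<Otimes>\<^sub>M ?S)" by measurable
        fix x z :: "real^'n" assume "x \<in> space ?S" and z: "norm z = 1"
        then have x: "norm x = 1" by simp
        show "\<bar>?K N x z * g z\<bar> \<le> 1 * B"
          unfolding abs_mult power_abs using cap_kernel_bounds[OF x z] B[OF z]
          by (intro mult_mono power_le_one) auto
      qed
      also have "\<dots> = (\<integral>z. 0 \<partial>?S)"
      proof (intro Bochner_Integration.integral_cong refl)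
        fix z :: "real^'n" assume "z \<in> space ?S"
        then have z: "norm z = 1" by simp
        have "(\<lambda>x. f x * (?K N x z * g z)) = (\<lambda>x. f x * ((1 + z \<bullet> x) / 2) ^ N * g z)"
          by (simp add: inner_commute mult.assoc)
        then show "(\<integral>x. f x * (?K N x z * g z) \<partial>?S) = 0" using kernel[OF z, of N] by simp
      qed
      finally show ?thesis by simp
    qed
    have "(\<lambda>N. (\<integral>x. f x * (\<integral>z. ?K N x z * g z \<partial>?S) \<partial>?S) / cap_mass N (axis i 1 :: real^'n)) \<longlonglongrightarrow> (\<integral>x. f x * g x \<partial>?S)"
      by (rule cap_average_limit[OF L _ e, where B=B]) (auto intro!: B cg)
    then show ?thesis unfolding zero by (simp add: LIMSEQ_const_iff)
  qed
  \<comment> \<open>\<open>w 1\<close> and \<open>w (-1)\<close> are the positive and the negative part of \<open>f\<close>\<close>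
  define w where "w = (\<lambda>e x. max 0 (e * f x))"
  have wi: "integrable ?S (w e)" for e
    unfolding w_def using f by (intro integrable_max) auto
  have wm [measurable]: "w e \<in> borel_measurable borel" for e unfolding w_def by measurable
  let ?N = "\<lambda>e. distr (density ?S (\<lambda>x. ennreal (w e x))) borel (\<lambda>x. x)"
  have int_N: "(\<integral>x. g x \<partial>?N e) = (\<integral>x. w e x * g x \<partial>?S)" if [measurable]: "g \<in> borel_measurable borel" for e and g :: "real^'n \<Rightarrow> real"
    by (rule integral_distr_density) (auto simp: w_def)
  have split: "w 1 x - w (-1) x = f x" "w 1 x * sgn (f x) - w (-1) x * sgn (f x) = \<bar>f x\<bar>" for x
    by (auto simp: w_def max_def sgn_if)
  have bounded: "integrable ?S (\<lambda>x. w e x * g x)"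
    if [measurable]: "g \<in> borel_measurable borel" and g: "\<And>x. \<bar>g x\<bar> \<le> 1" for e and g :: "real^'n \<Rightarrow> real"
    by (rule integrable_mult_bounded[OF wi, of _ 1]) (auto simp: g)
  have "?N 1 = ?N (-1)"
  proof (rule finite_measure_eqI_continuous)
    show "finite_measure (?N 1)" "finite_measure (?N (-1))"
      by (intro finite_measure_distr_density wi measurable_ident_sphere_measure)+
    fix g :: "real^'n \<Rightarrow> real" assume g: "continuous_on UNIV g" "\<And>x. 0 \<le> g x \<and> g x \<le> 1"
    then have gm [measurable]: "g \<in> borel_measurable borel" by (intro borel_measurable_continuous_onI)
    have i: "integrable ?S (\<lambda>x. w e x * g x)" for e using g(2) by (intro bounded gm) (simp add: abs_le_iff order_trans[of _ 0])
    have "0 = (\<integral>x. w 1 x * g x - w (-1) x * g x \<partial>?S)"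
      using cont[OF g(1)] by (simp add: left_diff_distrib[symmetric] split)
    then show "integral\<^sup>L (?N 1) g = integral\<^sup>L (?N (-1)) g"
      unfolding int_N[OF gm] using i by simp
  qed auto
  \<comment> \<open>testing with \<open>sgn f\<close> turns the difference of the two parts into \<open>|f|\<close>\<close>
  then have "integral\<^sup>L (?N 1) (\<lambda>x. sgn (f x)) = integral\<^sup>L (?N (-1)) (\<lambda>x. sgn (f x))" by simp
  then have "(\<integral>x. w 1 x * sgn (f x) - w (-1) x * sgn (f x) \<partial>?S) = 0"
    by (subst Bochner_Integration.integral_diff) (auto simp: int_N sgn_if intro!: bounded)
  then have "(\<integral>x. \<bar>f x\<bar> \<partial>?S) = 0" by (simp only: split)
  then show ?thesis
    using integral_nonneg_eq_0_iff_AE[of ?S "\<lambda>x. \<bar>f x\<bar>"] f by simp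
qed

section \<open>Independence of the directions of a uniform point\<close>

lemma emeasure_lborel_scaled:
  fixes C :: "'a::euclidean_space set"
  assumes [measurable]: "C \<in> sets borel" and c: "0 < c"
  shows "emeasure lborel C = ennreal (c ^ DIM('a)) * emeasure lborel ((\<lambda>x. c *\<^sub>R x) -` C)"
proof -
  have "emeasure lborel C = emeasure (density (distr lborel borel (\<lambda>x. 0 + c *\<^sub>R x)) (\<lambda>_. ennreal (\<bar>c\<bar> ^ DIM('a)))) C"
    using lborel_affine[of c "0 :: 'a"] c by simp
  also have "\<dots> = ennreal (c ^ DIM('a)) * emeasure (distr lborel borel (\<lambda>x. c *\<^sub>R x)) C"
    using c by (subst emeasure_density) (auto simp: nn_integral_cmult)
  finally show ?thesis by (simp add: emeasure_distr)
qed

text \<open>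
  For \<open>c = 1\<close> this is the definition of the surface measure by volumes of cones, and both sides scale in the
  same way.
\<close>

lemma emeasure_cone:
  assumes A: "A \<in> sets borel" "A \<subseteq> usphere"
  shows "emeasure lborel {a::'a::euclidean_space. norm a < c \<and> sgn a \<in> A}
    = emeasure sphere_measure A * emeasure lborel {a::'a. norm a < c \<and> sgn a \<in> usphere}"
proof (cases "0 < c")
  case False
  then have e: "{a::'a. norm a < c \<and> Q a} = {}" for Q by (auto simp: not_less) (meson less_le_trans norm_ge_zero not_less)
  show ?thesis unfolding e by simp
next
  case True
  interpret S: prob_space "sphere_measure :: 'a measure" by (rule prob_space_sphere_measure)
  have base: "emeasure lborel (ball 0 1 \<inter> sgn -` D) = emeasure sphere_measure D * emeasure lborel (ball (0::'a) 1)"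
    if "D \<in> sets borel" "D \<subseteq> usphere" for D :: "'a set"
  proof -
    have "emeasure lborel (ball (0::'a) 1) / emeasure lborel (ball (0::'a) 1) = 1"
      using ball_lborel_pos[where 'a='a] by (simp add: ennreal_divide_self less_top)
    then show ?thesis using emeasure_sphere_measure[OF that] by (simp add: ennreal_divide_times)
  qed
  have sc: "emeasure lborel {a::'a. norm a < c \<and> sgn a \<in> D} = ennreal (c ^ DIM('a)) * (emeasure sphere_measure D * emeasure lborel (ball (0::'a) 1))"
    if D: "D \<in> sets borel" "D \<subseteq> usphere" for D :: "'a set"
  proof -
    have "{a::'a. norm a < c \<and> sgn a \<in> D} = ball 0 c \<inter> sgn -` D" by auto
    then have "{a::'a. norm a < c \<and> sgn a \<in> D} \<in> sets borel"
      using measurable_sets[OF borel_measurable_sgn D(1)] by auto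
    then have "emeasure lborel {a::'a. norm a < c \<and> sgn a \<in> D}
        = ennreal (c ^ DIM('a)) * emeasure lborel ((\<lambda>x. c *\<^sub>R x) -` {a::'a. norm a < c \<and> sgn a \<in> D})"
      by (rule emeasure_lborel_scaled[OF _ True])
    also have "(\<lambda>x. c *\<^sub>R x) -` {a::'a. norm a < c \<and> sgn a \<in> D} = ball 0 1 \<inter> sgn -` D"
      using True by (auto simp: sgn_scaleR)
    finally show ?thesis by (simp add: base[OF D])
  qed
  have "emeasure sphere_measure (usphere :: 'a set) = 1" using S.emeasure_space_1 by simp
  then show ?thesis using sc[OF A] sc[of usphere] by (simp add: mult_ac)
qed

definition cone_pair :: "'a::euclidean_space set \<Rightarrow> 'b::euclidean_space set \<Rightarrow> ('a \<times> 'b) set" where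
  "cone_pair A B = {z. norm z < 1 \<and> sgn (fst z) \<in> A \<and> sgn (snd z) \<in> B}"

lemma cone_pair_borel [measurable]:
  assumes [measurable]: "A \<in> sets borel" "B \<in> sets borel"
  shows "cone_pair A B \<in> sets borel"
proof -
  have [measurable]: "(\<lambda>z :: 'a \<times> 'b. sgn (fst z)) \<in> borel_measurable borel" "(\<lambda>z :: 'a \<times> 'b. sgn (snd z)) \<in> borel_measurable borel"
    by (rule measurable_compose[OF _ borel_measurable_sgn], intro borel_measurable_continuous_onI continuous_intros)+
  have "cone_pair A B = ball 0 1 \<inter> (\<lambda>z. sgn (fst z)) -` A \<inter> (\<lambda>z. sgn (snd z)) -` B"
    by (auto simp: cone_pair_def)
  then show ?thesis
    using measurable_sets[of "\<lambda>z :: 'a \<times> 'b. sgn (fst z)" borel borel A] measurable_sets[of "\<lambda>z :: 'a \<times> 'b. sgn (snd z)" borel borel B]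
    by auto
qed

text \<open>
  Each slice at a fixed second component is the part of a ball with directions in \<open>A\<close>, whose volume is
  proportional to the surface measure of \<open>A\<close>. The same argument for the other component, by the symmetry of
  the product, yields the product formula of \<open>emeasure_cone_pair\<close>.
\<close>

lemma emeasure_cone_pair_fst:
  fixes A :: "'a::euclidean_space set" and B :: "'b::euclidean_space set"
  assumes A: "A \<in> sets borel" "A \<subseteq> usphere" and [measurable]: "B \<in> sets borel"
  shows "emeasure lborel (cone_pair A B) = emeasure sphere_measure A * emeasure lborel (cone_pair (usphere :: 'a set) B)"
proof -
  note [measurable] = A(1)
  have slice: "(\<lambda>x. (x, y)) -` cone_pair D B =
      (if norm y < 1 \<and> sgn y \<in> B then {a. norm a < sqrt (1 - (norm y)\<^sup>2) \<and> sgn a \<in> D} else {})" for D :: "'a set" and y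
  proof -
    have "norm (a, y) < 1 \<longleftrightarrow> norm y < 1 \<and> norm a < sqrt (1 - (norm y)\<^sup>2)" for a :: 'a
    proof -
      have "norm (a, y) < 1 \<longleftrightarrow> (norm a)\<^sup>2 + (norm y)\<^sup>2 < 1" by (simp add: norm_Pair real_sqrt_lt_1_iff)
      also have "\<dots> \<longleftrightarrow> norm y < 1 \<and> norm a < sqrt (1 - (norm y)\<^sup>2)"
      proof (intro iffI conjI)
        assume h: "(norm a)\<^sup>2 + (norm y)\<^sup>2 < 1"
        have "(norm y)\<^sup>2 < 1\<^sup>2" using h zero_le_power2[of "norm a"] unfolding one_power2 by linarith
        then show "norm y < 1" by (rule power2_less_imp_less) simp
        show "norm a < sqrt (1 - (norm y)\<^sup>2)" using h by (intro real_less_rsqrt) simp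
      next
        assume h: "norm y < 1 \<and> norm a < sqrt (1 - (norm y)\<^sup>2)"
        then have "(norm a)\<^sup>2 < (sqrt (1 - (norm y)\<^sup>2))\<^sup>2" by (intro power_strict_mono) auto
        moreover have "(norm y)\<^sup>2 \<le> 1" using h by (intro power_le_one) auto
        ultimately show "(norm a)\<^sup>2 + (norm y)\<^sup>2 < 1" by simp
      qed
      finally show ?thesis .
    qed
    then show ?thesis unfolding cone_pair_def by auto
  qed
  have e: "emeasure lborel (cone_pair D B) = (\<integral>\<^sup>+y. emeasure lborel ((\<lambda>x. (x, y)) -` cone_pair D B) \<partial>lborel)"
    if [measurable]: "D \<in> sets borel" for D :: "'a set"
  proof -
    have "cone_pair D B \<in> sets (lborel \<Otimes>\<^sub>M lborel)" by (subst lborel_prod) simp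
    from lborel_pair.emeasure_pair_measure_alt2[OF this] show ?thesis by (simp only: lborel_prod)
  qed
  have "emeasure lborel (cone_pair A B)
      = (\<integral>\<^sup>+y. emeasure sphere_measure A * emeasure lborel ((\<lambda>x. (x, y)) -` cone_pair (usphere :: 'a set) B) \<partial>lborel)"
    unfolding e[OF A(1)] slice by (intro nn_integral_cong) (simp add: emeasure_cone[OF A])
  also have "\<dots> = emeasure sphere_measure A * (\<integral>\<^sup>+y. emeasure lborel ((\<lambda>x. (x, y)) -` cone_pair (usphere :: 'a set) B) \<partial>lborel)"
  proof (rule nn_integral_cmult)
    have "cone_pair (usphere :: 'a set) B \<in> sets (lborel \<Otimes>\<^sub>M lborel)" by (subst lborel_prod) simp
    from lborel_pair.measurable_emeasure_Pair2[OF this]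
    show "(\<lambda>y. emeasure lborel ((\<lambda>x. (x, y)) -` cone_pair (usphere :: 'a set) B)) \<in> borel_measurable lborel" .
  qed
  also have "(\<integral>\<^sup>+y. emeasure lborel ((\<lambda>x. (x, y)) -` cone_pair (usphere :: 'a set) B) \<partial>lborel) = emeasure lborel (cone_pair (usphere :: 'a set) B)"
    by (subst e) auto
  finally show ?thesis .
qed

lemma emeasure_cone_pair_swap:
  fixes A :: "'a::euclidean_space set" and B :: "'b::euclidean_space set"
  assumes [measurable]: "A \<in> sets borel" "B \<in> sets borel"
  shows "emeasure lborel (cone_pair A B) = emeasure lborel (cone_pair B A)"
proof -
  have "distr lborel borel (prod.swap :: 'b \<times> 'a \<Rightarrow> 'a \<times> 'b) = lborel"
  proof (rule lborel_distr_linear_isometry)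
    show "linear (prod.swap :: 'b \<times> 'a \<Rightarrow> 'a \<times> 'b)" by (rule linearI) auto
  qed (auto simp: norm_prod_def add.commute intro: surjI[of _ prod.swap])
  then have "emeasure lborel (cone_pair A B) = emeasure (distr lborel borel (prod.swap :: 'b \<times> 'a \<Rightarrow> 'a \<times> 'b)) (cone_pair A B)"
    by simp
  also have "\<dots> = emeasure lborel (prod.swap -` cone_pair A B)"
    by (subst emeasure_distr) (auto intro!: borel_measurable_continuous_onI continuous_on_swap)
  also have "prod.swap -` cone_pair A B = cone_pair B A"
    by (auto simp: cone_pair_def norm_prod_def add.commute)
  finally show ?thesis .
qed

lemma emeasure_cone_pair:
  fixes A :: "'a::euclidean_space set" and B :: "'b::euclidean_space set"
  assumes A: "A \<in> sets borel" "A \<subseteq> usphere" and B: "B \<in> sets borel" "B \<subseteq> usphere"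
  shows "emeasure lborel (cone_pair A B)
    = emeasure sphere_measure A * emeasure sphere_measure B * emeasure lborel (cone_pair usphere usphere :: ('a \<times> 'b) set)"
proof -
  have "emeasure lborel (cone_pair A B) = emeasure sphere_measure A * emeasure lborel (cone_pair (usphere :: 'a set) B)"
    by (rule emeasure_cone_pair_fst[OF A B(1)])
  also have "emeasure lborel (cone_pair (usphere :: 'a set) B) = emeasure lborel (cone_pair B (usphere :: 'a set))"
    using B by (intro emeasure_cone_pair_swap) auto
  also have "\<dots> = emeasure sphere_measure B * emeasure lborel (cone_pair (usphere :: 'b set) (usphere :: 'a set))"
    by (rule emeasure_cone_pair_fst[OF B]) auto
  also have "emeasure lborel (cone_pair (usphere :: 'b set) (usphere :: 'a set)) = emeasure lborel (cone_pair (usphere :: 'a set) (usphere :: 'b set))"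
    by (intro emeasure_cone_pair_swap) auto
  finally show ?thesis by (simp add: mult.assoc)
qed

lemma emeasure_cone_pair_usphere:
  "emeasure lborel (cone_pair usphere usphere :: ('a::euclidean_space \<times> 'b::euclidean_space) set) = emeasure lborel (ball (0 :: 'a \<times> 'b) 1)"
proof -
  obtain a :: 'a where a: "a \<in> Basis" using nonempty_Basis by blast
  obtain b :: 'b where b: "b \<in> Basis" using nonempty_Basis by blast
  have n: "{z :: 'a \<times> 'b. c \<bullet> z = 0} \<in> null_sets lborel" if "c \<noteq> 0" for c
    using negligible_hyperplane[of c 0] that closed_hyperplane[of c 0]
    by (auto simp: negligible_iff_null_sets null_sets_completion_iff)
  let ?N = "{z :: 'a \<times> 'b. (a, 0) \<bullet> z = 0} \<union> {z. (0, b) \<bullet> z = 0}"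
  have N: "?N \<in> null_sets lborel" using nonzero_Basis[OF a] nonzero_Basis[OF b] by (intro null_sets.Un n) (auto simp: zero_prod_def)
  have "cone_pair usphere usphere \<union> ?N = ball (0 :: 'a \<times> 'b) 1 \<union> ?N"
    by (auto simp: cone_pair_def norm_sgn)
  then have "emeasure lborel (cone_pair usphere usphere \<union> ?N) = emeasure lborel (ball (0 :: 'a \<times> 'b) 1 \<union> ?N)" by simp
  then show ?thesis using N by (simp add: emeasure_Un_null_set)
qed

abbreviation left_set :: "('p::finite + 'q::finite) set" where "left_set \<equiv> range Inl"

lemma card_left_set:
  "card (left_set :: ('p::finite + 'q::finite) set) = CARD('p)" "card (- (left_set :: ('p + 'q) set)) = CARD('q)"
proof -
  show "card (left_set :: ('p + 'q) set) = CARD('p)" by (simp add: card_image)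
  have "- (left_set :: ('p + 'q) set) = range Inr" by (auto simp: UNIV_sum image_iff) (metis sum.exhaust)
  then show "card (- (left_set :: ('p + 'q) set)) = CARD('q)" by (simp add: card_image)
qed

lemma UNIV_sum_split: "(\<Sum>i\<in>UNIV. f i) = (\<Sum>i\<in>UNIV. f (Inl i)) + (\<Sum>j\<in>UNIV. f (Inr j))"
  for f :: "'p::finite + 'q::finite \<Rightarrow> real"
proof -
  have "(\<Sum>i\<in>UNIV. f i) = (\<Sum>i\<in>range Inl. f i) + (\<Sum>i\<in>range Inr. f i)"
    unfolding UNIV_sum by (rule sum.union_disjoint) auto
  then show ?thesis by (simp add: sum.reindex)
qed

lemma join_vec_linear: "linear (\<lambda>z :: (real^'p::finite) \<times> (real^'q::finite). join_vec (fst z) (snd z))"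
  by (rule linearI) (auto simp: join_vec_def vec_eq_iff split: sum.split)

lemma norm_join_vec: "norm (join_vec a b) = norm (a, b)"
  for a :: "real^'p::finite" and b :: "real^'q::finite"
  unfolding norm_Pair norm_vec_def[of "join_vec a b"] L2_set_def UNIV_sum_split
  by (simp add: join_vec_def norm_vec_def L2_set_def sum_nonneg)

lemma join_vec_surj: "surj (\<lambda>z :: (real^'p::finite) \<times> (real^'q::finite). join_vec (fst z) (snd z))"
proof (rule surjI)
  show "join_vec (fst (\<chi> i. x $ Inl i, \<chi> i. x $ Inr i)) (snd (\<chi> i. x $ Inl i, \<chi> i. x $ Inr i)) = x" for x :: "real^('p+'q)"
    by (auto simp: join_vec_def vec_eq_iff split: sum.split)
qed

lemma split_dir_join:
  "split_dir left_set (join_vec a b) = join_vec (sgn a) (sgn b)"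
  for a :: "real^'p::finite" and b :: "real^'q::finite"
proof -
  have 1: "blend left_set 1 0 (join_vec a b) = join_vec a 0" "blend left_set 0 1 (join_vec a b) = join_vec 0 b"
    by (auto simp: blend_def join_vec_def vec_eq_iff split: sum.split)
  have "norm (join_vec a (0 :: real^'q)) = norm a" "norm (join_vec (0 :: real^'p) b) = norm b"
    by (simp_all add: norm_join_vec)
  then show ?thesis unfolding split_dir_def 1
    by (auto simp: sgn_div_norm join_vec_def vec_eq_iff split: sum.split)
qed

lemma blend_join_vec: "join_vec (\<alpha> *\<^sub>R a) (\<beta> *\<^sub>R b) = blend left_set \<alpha> \<beta> (join_vec a b)"
  by (auto simp: blend_def join_vec_def vec_eq_iff split: sum.split)

lemma join_vec_measurable: "(\<lambda>z :: (real^'p::finite) \<times> (real^'q::finite). join_vec (fst z) (snd z)) \<in> borel_measurable borel"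
  using join_vec_linear linear_conv_bounded_linear linear_continuous_on borel_measurable_continuous_onI by blast

definition left_part :: "real^('p::finite + 'q::finite) \<Rightarrow> real^'p" where "left_part x = (\<chi> i. x $ Inl i)"
definition right_part :: "real^('p::finite + 'q::finite) \<Rightarrow> real^'q" where "right_part x = (\<chi> i. x $ Inr i)"

lemma part_measurable [measurable]: "left_part \<in> borel_measurable borel" "right_part \<in> borel_measurable borel"
  unfolding left_part_def right_part_def
  by (intro borel_measurable_continuous_onI continuous_on_vec_lambda continuous_intros)+

lemma part_join [simp]: "left_part (join_vec a b) = a" "right_part (join_vec a b) = b"
  "join_vec (left_part x) (right_part x) = x"
  by (auto simp: left_part_def right_part_def join_vec_def vec_eq_iff split: sum.split)

lemma part_scaleR: "left_part (c *\<^sub>R x) = c *\<^sub>R left_part x" "right_part (c *\<^sub>R x) = c *\<^sub>R right_part x"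
  by (auto simp: left_part_def right_part_def vec_eq_iff)

text \<open>
  Up to the null set where one part of \<open>x\<close> vanishes, the points with directions in a given rectangle span a
  \<open>cone_pair\<close>, whose volume is given by the product formula \<open>emeasure_cone_pair\<close>.
\<close>

theorem sphere_measure_directions_independent:
  "distr (sphere_measure :: (real^('p::finite + 'q::finite)) measure) borel (\<lambda>x. (sgn (left_part x), sgn (right_part x)))
   = distr sphere_measure borel (\<lambda>x. x) \<Otimes>\<^sub>M distr sphere_measure borel (\<lambda>x. x)"
proof (rule pair_measure_eqI[symmetric])
  interpret P: prob_space "sphere_measure :: (real^'p) measure" by (rule prob_space_sphere_measure)
  interpret Q: prob_space "sphere_measure :: (real^'q) measure" by (rule prob_space_sphere_measure)
  interpret P': prob_space "distr (sphere_measure :: (real^'p) measure) borel (\<lambda>x. x)" by (rule P.prob_space_distr) measurable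
  interpret Q': prob_space "distr (sphere_measure :: (real^'q) measure) borel (\<lambda>x. x)" by (rule Q.prob_space_distr) measurable
  show "sigma_finite_measure (distr (sphere_measure :: (real^'p) measure) borel (\<lambda>x. x))" ..
  show "sigma_finite_measure (distr (sphere_measure :: (real^'q) measure) borel (\<lambda>x. x))" ..
  let ?S = "sphere_measure :: (real^('p + 'q)) measure"
  let ?X = "\<lambda>x :: real^('p + 'q). (sgn (left_part x), sgn (right_part x))"
  have X [measurable]: "?X \<in> borel_measurable borel" by measurable
  show "sets (distr sphere_measure borel (\<lambda>x :: real^'p. x) \<Otimes>\<^sub>M distr sphere_measure borel (\<lambda>x :: real^'q. x)) = sets (distr ?S borel ?X)"
  proof -
    have "sets (distr sphere_measure borel (\<lambda>x :: real^'p. x) \<Otimes>\<^sub>M distr sphere_measure borel (\<lambda>x :: real^'q. x))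
        = sets ((borel :: (real^'p) measure) \<Otimes>\<^sub>M (borel :: (real^'q) measure))"
      by (intro sets_pair_measure_cong) auto
    then show ?thesis by (simp only: borel_prod sets_distr)
  qed
  fix A :: "(real^'p) set" and B :: "(real^'q) set"
  assume "A \<in> sets (distr sphere_measure borel (\<lambda>x. x))" "B \<in> sets (distr sphere_measure borel (\<lambda>x. x))"
  then have AB [measurable]: "A \<in> sets borel" "B \<in> sets borel" by auto
  define A' B' where AB': "A' = A \<inter> usphere" "B' = B \<inter> usphere"
  have m [measurable]: "A' \<in> sets borel" "B' \<in> sets borel" unfolding AB' by auto
  have sub: "A' \<subseteq> usphere" "B' \<subseteq> usphere" unfolding AB' by auto
  let ?C = "{x \<in> usphere. ?X x \<in> A' \<times> B'}"
  have rect: "A \<times> B \<in> sets borel" "A' \<times> B' \<in> sets borel"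
    using AB m by (auto simp: borel_prod[symmetric])
  have C: "?C \<in> sets borel"
  proof -
    have "?C = usphere \<inter> ?X -` (A' \<times> B')" by auto
    then show ?thesis using measurable_sets[OF X rect(2)] by auto
  qed
  have "left_set \<noteq> {}" "- (left_set :: ('p + 'q) set) \<noteq> {}" by auto
  note nz = blend_nonzero_AE[OF this(1)] blend_nonzero_AE[OF this(2)]
  have "emeasure (distr ?S borel ?X) (A \<times> B) = emeasure ?S {x \<in> usphere. ?X x \<in> A \<times> B}"
    using rect(1) by (subst emeasure_distr) (auto intro!: arg_cong[where f="emeasure _"])
  also have "\<dots> = emeasure ?S ?C"
  proof (rule emeasure_eq_AE)
    show "AE x in ?S. x \<in> {x \<in> usphere. ?X x \<in> A \<times> B} \<longleftrightarrow> x \<in> ?C"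
      using nz
    proof eventually_elim
      case (elim x)
      have "blend left_set 1 0 x = join_vec (left_part x) 0" "blend left_set 0 1 x = join_vec 0 (right_part x)"
        using blend_join_vec[of 1 "left_part x" 0 "right_part x"] blend_join_vec[of 0 "left_part x" 1 "right_part x"] by simp_all
      moreover have "join_vec (0 :: real^'p) (0 :: real^'q) = 0"
        using norm_join_vec[of "0 :: real^'p" "0 :: real^'q"] by (simp add: norm_Pair)
      ultimately have "left_part x \<noteq> 0" "right_part x \<noteq> 0" 
        using elim blend_swap[of left_set 0 1 x] by auto
      then show ?case by (auto simp: AB' norm_sgn)
    qed
    show "{x \<in> usphere. ?X x \<in> A \<times> B} \<in> sets ?S"
    proof -
      have "{x \<in> usphere. ?X x \<in> A \<times> B} = usphere \<inter> ?X -` (A \<times> B)" by auto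
      then show ?thesis using measurable_sets[OF X rect(1)] by (auto simp: sets_sphere_measure_iff)
    qed
    show "?C \<in> sets ?S" using C by (auto simp: sets_sphere_measure_iff)
  qed
  also have "\<dots> = emeasure lborel (ball 0 1 \<inter> sgn -` ?C) / emeasure lborel (ball (0 :: real^('p+'q)) 1)"
    by (rule emeasure_sphere_measure[OF C]) auto
  also have "emeasure lborel (ball 0 1 \<inter> sgn -` ?C) = emeasure lborel (cone_pair A' B')"
  proof -
    let ?J = "\<lambda>z :: (real^'p) \<times> (real^'q). join_vec (fst z) (snd z)"
    have "distr lborel borel ?J = lborel"
      by (rule lborel_distr_linear_isometry[OF join_vec_linear _ join_vec_surj]) (simp add: norm_join_vec)
    then have "emeasure lborel (ball 0 1 \<inter> sgn -` ?C) = emeasure (distr lborel borel ?J) (ball 0 1 \<inter> sgn -` ?C)" by simp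
    also have "\<dots> = emeasure lborel (?J -` (ball 0 1 \<inter> sgn -` ?C))"
      using join_vec_measurable measurable_sets[OF borel_measurable_sgn C] by (subst emeasure_distr) auto
    also have "?J -` (ball 0 1 \<inter> sgn -` ?C) = cone_pair A' B'"
    proof -
      have "sgn (join_vec a b) \<in> ?C \<longleftrightarrow> sgn a \<in> A' \<and> sgn b \<in> B'" for a b
      proof (cases "a = 0 \<or> b = 0")
        case True
        have "join_vec a b \<noteq> 0 \<Longrightarrow> sgn (left_part (sgn (join_vec a b))) = sgn a \<and> sgn (right_part (sgn (join_vec a b))) = sgn b"
          by (simp add: sgn_div_norm[of "join_vec a b"] part_scaleR sgn_scaleR)
        then show ?thesis using True sub by (auto simp: norm_sgn subset_iff)
      next
        case False
        then have "join_vec a b \<noteq> 0" by (metis part_join(1) part_scaleR(1) scaleR_zero_left)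
        moreover from this have "sgn (left_part (sgn (join_vec a b))) = sgn a \<and> sgn (right_part (sgn (join_vec a b))) = sgn b"
          by (simp add: sgn_div_norm[of "join_vec a b"] part_scaleR sgn_scaleR)
        ultimately show ?thesis by (simp add: norm_sgn)
      qed
      then show ?thesis unfolding cone_pair_def by (auto simp: norm_join_vec)
    qed
    finally show ?thesis .
  qed
  also have "\<dots> = emeasure sphere_measure A' * emeasure sphere_measure B' * emeasure lborel (ball (0 :: real^('p+'q)) 1)"
    unfolding emeasure_cone_pair[OF m(1) sub(1) m(2) sub(2)] emeasure_cone_pair_usphere by (simp add: emeasure_ball)
  also have "\<dots> / emeasure lborel (ball (0 :: real^('p+'q)) 1) = emeasure sphere_measure A' * emeasure sphere_measure B'"
    using ball_lborel_pos[where 'a="real^('p+'q)"] by (simp add: mult_divide_eq_ennreal)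
  finally show "emeasure (distr sphere_measure borel (\<lambda>x. x)) A * emeasure (distr sphere_measure borel (\<lambda>x. x)) B
      = emeasure (distr ?S borel ?X) (A \<times> B)"
    by (simp add: emeasure_distr AB' Int_commute)
qed

section \<open>The space of great subspheres\<close>

lemma stiefel_columns:
  assumes "v \<in> stiefel"
  shows "column i v \<bullet> column j v = (if i = j then 1 else 0)"
proof -
  have "(transpose v ** v) $ i $ j = column i v \<bullet> column j v"
    by (simp add: matrix_matrix_mult_def transpose_def column_def inner_vec_def)
  then show ?thesis using assms by (simp add: stiefel_def mat_def)
qed

lemma column_mult: "column j (r ** v) = r *v column j v"
  by (simp add: column_def matrix_matrix_mult_def matrix_vector_mult_def vec_eq_iff)

lemma column_v0: "column j (v0 :: real^'q^('p::finite+'q::finite)) = axis (Inr j) 1"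
  by (auto simp: column_def v0_def vec_eq_iff axis_def split: sum.split)

text \<open>
  The coordinate vectors are moved to the columns of \<open>v\<close> one after the other. The reflection that moves the
  next one fixes the columns that are already in place, because they are orthogonal to the old and the new
  position.
\<close>

lemma stiefel_frame_exists:
  fixes v :: "real^'q^('p::finite+'q::finite)"
  assumes v: "v \<in> stiefel"
  obtains r where "orthogonal_matrix r" "r ** v0 = v"
proof -
  have "\<exists>r. orthogonal_matrix r \<and> (\<forall>j\<in>K. r *v axis (Inr j) 1 = column j v)" if "finite K" for K
    using that
  proof (induction K)
    case empty
    then show ?case using orthogonal_matrix_id by blast
  next
    case (insert j K)
    then obtain r where r: "orthogonal_matrix r" "\<And>i. i \<in> K \<Longrightarrow> r *v axis (Inr i) 1 = column i v" by blast
    have "norm (r *v axis (Inr j) 1) = norm (column j v)"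
    proof -
      have "norm (column j v) = 1" using stiefel_columns[OF v, of j j] by (simp add: norm_eq_1)
      then show ?thesis by (simp add: orthogonal_matrix_norm[OF r(1)])
    qed
    then obtain s where s: "orthogonal_matrix s" "s *v (r *v axis (Inr j) 1) = column j v"
      "\<And>z. (r *v axis (Inr j) 1) \<bullet> z = column j v \<bullet> z \<Longrightarrow> s *v z = z"
      by (rule reflection_exists) blast
    have "s *v column i v = column i v" if i: "i \<in> K" for i
    proof (rule s(3))
      have "(r *v axis (Inr j) 1) \<bullet> column i v = axis (Inr j) 1 \<bullet> (axis (Inr i) 1 :: real^('p+'q))"
        unfolding r(2)[OF i, symmetric] by (rule orthogonal_matrix_inner[OF r(1)])
      also have "\<dots> = column j v \<bullet> column i v"
        using insert.hyps i by (auto simp: stiefel_columns[OF v] inner_axis_axis)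
      finally show "(r *v axis (Inr j) 1) \<bullet> column i v = column j v \<bullet> column i v" .
    qed
    then have "\<forall>i\<in>insert j K. (s ** r) *v axis (Inr i) 1 = column i v"
      using s(2) r(2) by (auto simp: matrix_vector_mul_assoc[symmetric])
    then show ?case using orthogonal_matrix_mul[OF s(1) r(1)] by blast
  qed
  from this[of UNIV] obtain r where r: "orthogonal_matrix r" "\<And>j. r *v axis (Inr j) 1 = column j v" by auto
  have "column j (r ** v0) = column j v" for j by (simp add: column_mult column_v0 r(2))
  then have "r ** v0 = v" by (auto simp: column_def vec_eq_iff)
  with r(1) show ?thesis by (rule that)
qed

lemma v0_proj: "(v0 :: real^'q^('p::finite+'q::finite)) ** transpose v0 = coord_proj (- left_set)"
proof -
  have "(\<Sum>k\<in>UNIV. (v0 :: real^'q^('p+'q)) $ i $ k * v0 $ j $ k) = (if i = j \<and> i \<in> - left_set then 1 else 0)" for i j :: "'p + 'q"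
    by (cases i; cases j) (auto simp: v0_def if_distrib[where f="\<lambda>a. a * _"] cong: if_cong)
  then show ?thesis
    by (simp add: vec_eq_iff matrix_matrix_mult_def transpose_def coord_proj_def)
qed

lemma stiefel_proj:
  fixes r :: "real^('p::finite+'q::finite)^('p+'q)"
  shows "(r ** v0) ** transpose (r ** v0) = r ** coord_proj (- left_set) ** transpose r"
  by (simp add: matrix_transpose_mul v0_proj[symmetric] matrix_mul_assoc)

lemma great_subsphere_alt:
  "great_subsphere v = {x \<in> usphere. (v ** transpose v) *v x = 0}" if v: "v \<in> stiefel"
proof -
  have 1: "x \<in> orthogonal_comp (columns v) \<longleftrightarrow> transpose v *v x = 0" for x
  proof -
    have "(transpose v *v x) $ i = column i v \<bullet> x" for i
      by (simp add: matrix_vector_mult_def transpose_def column_def inner_vec_def del: transpose_matrix_vector)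
    then have "transpose v *v x = 0 \<longleftrightarrow> (\<forall>i. column i v \<bullet> x = 0)"
      unfolding vec_eq_iff by simp
    moreover have "x \<in> orthogonal_comp (columns v) \<longleftrightarrow> (\<forall>i. column i v \<bullet> x = 0)"
      by (auto simp: orthogonal_comp_def columns_def orthogonal_def)
    ultimately show ?thesis by blast
  qed
  have 2: "transpose v *v x = 0 \<longleftrightarrow> (v ** transpose v) *v x = 0" for x
  proof
    assume "(v ** transpose v) *v x = 0"
    then have "transpose v *v ((v ** transpose v) *v x) = 0" by simp
    then have "((transpose v ** v) ** transpose v) *v x = 0"
      by (simp add: matrix_vector_mul_assoc matrix_mul_assoc del: transpose_matrix_vector)
    then show "transpose v *v x = 0" using v by (simp add: stiefel_def del: transpose_matrix_vector)
  qed (simp add: matrix_vector_mul_assoc[symmetric] del: transpose_matrix_vector)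
  show ?thesis unfolding great_subsphere_def by (auto simp: 1 2 simp del: transpose_matrix_vector)
qed

text \<open>
  An orthogonal projection is determined by its kernel, and the kernel of \<open>v v\<^sup>T\<close> is spanned by the great
  subsphere.
\<close>

lemma great_subsphere_determines_proj:
  assumes v: "v \<in> stiefel" and w: "w \<in> stiefel" and eq: "great_subsphere v = great_subsphere w"
  shows "v ** transpose v = w ** transpose w"
proof -
  have half: "(w ** transpose w) ** (v ** transpose v) = w ** transpose w"
    if v: "v \<in> stiefel" and w: "w \<in> stiefel" and eq: "great_subsphere v = great_subsphere w" for v w :: "real^'a^('b+'a)"
  proof -
    define P Q where "P = v ** transpose v" and "Q = w ** transpose w"
    have PP: "P ** P = P"
    proof -
      have "P ** P = v ** (transpose v ** v) ** transpose v" unfolding P_def by (simp only: matrix_mul_assoc)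
      then show ?thesis using v by (simp add: stiefel_def P_def)
    qed
    have ker: "Q *v x = 0" if x: "P *v x = 0" for x
    proof (cases "x = 0")
      case False
      have "P *v sgn x = 0" using x by (simp add: sgn_div_norm matrix_vector_mult_scaleR)
      then have "sgn x \<in> great_subsphere v" using False by (simp add: great_subsphere_alt[OF v] P_def norm_sgn)
      then have "Q *v sgn x = 0" unfolding eq by (simp add: great_subsphere_alt[OF w] Q_def)
      then show ?thesis using False by (simp add: sgn_div_norm matrix_vector_mult_scaleR)
    qed simp
    have "(Q ** P) *v x = Q *v x" for x
    proof -
      have "P *v (x - P *v x) = 0" by (simp add: matrix_vector_mult_diff_distrib matrix_vector_mul_assoc PP)
      from ker[OF this] show ?thesis by (simp add: matrix_vector_mult_diff_distrib matrix_vector_mul_assoc)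
    qed
    then have "Q ** P = Q" by (simp add: matrix_eq)
    then show ?thesis unfolding P_def Q_def .
  qed
  have sym: "transpose (u ** transpose u) = u ** transpose u" for u :: "real^'a^('b+'a)"
    by (simp add: matrix_transpose_mul)
  have "v ** transpose v = (v ** transpose v) ** (w ** transpose w)"
    by (rule half[OF w v eq[symmetric], symmetric])
  also have "\<dots> = transpose ((w ** transpose w) ** (v ** transpose v))"
    unfolding matrix_transpose_mul[of "w ** transpose w"] sym ..
  also have "\<dots> = w ** transpose w" unfolding half[OF v w eq] by (rule sym)
  finally show ?thesis .
qed

definition frame_of :: "(real^('p::finite+'q::finite)) set \<Rightarrow> real^'q^('p+'q)" where
  "frame_of \<xi> = (SOME v. v \<in> stiefel \<and> \<xi> = great_subsphere v)"

text \<open>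
  The orthogonal projection onto the linear space normal to \<open>\<xi>\<close>; it does not depend on the chosen frame by
  \<open>normal_proj_great_subsphere\<close>.
\<close>

definition normal_proj :: "(real^('p::finite+'q::finite)) set \<Rightarrow> real^('p+'q)^('p+'q)" where
  "normal_proj \<xi> = frame_of \<xi> ** transpose (frame_of \<xi>)"

lemma frame_of:
  assumes "\<xi> \<in> Xi" shows "frame_of \<xi> \<in> stiefel" "great_subsphere (frame_of \<xi>) = \<xi>"
proof -
  have "\<exists>v. v \<in> stiefel \<and> \<xi> = great_subsphere v" using assms by (auto simp: Xi_def)
  then have "frame_of \<xi> \<in> stiefel \<and> \<xi> = great_subsphere (frame_of \<xi>)"
    unfolding frame_of_def by (rule someI_ex)
  then show "frame_of \<xi> \<in> stiefel" "great_subsphere (frame_of \<xi>) = \<xi>" by auto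
qed

lemma normal_proj_great_subsphere:
  assumes "v \<in> stiefel" shows "normal_proj (great_subsphere v) = v ** transpose v"
proof -
  have "great_subsphere v \<in> Xi" using assms by (auto simp: Xi_def)
  from frame_of[OF this] show ?thesis
    unfolding normal_proj_def by (intro great_subsphere_determines_proj assms)
qed

lemma stiefel_orthogonal_mult:
  assumes "orthogonal_matrix \<gamma>" "v \<in> stiefel" shows "\<gamma> ** v \<in> stiefel"
proof -
  have "transpose (\<gamma> ** v) ** (\<gamma> ** v) = transpose v ** (transpose \<gamma> ** \<gamma>) ** v"
    by (simp only: matrix_transpose_mul matrix_mul_assoc)
  then show ?thesis using assms by (simp add: stiefel_def orthogonal_matrix)
qed

lemma great_subsphere_orthogonal_mult:
  assumes g: "orthogonal_matrix \<gamma>" and v: "v \<in> stiefel"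
  shows "(\<lambda>x. \<gamma> *v x) ` great_subsphere v = great_subsphere (\<gamma> ** v)"
proof -
  have t: "orthogonal_matrix (transpose \<gamma>)" using g by simp
  have P: "(\<gamma> ** v) ** transpose (\<gamma> ** v) = \<gamma> ** (v ** transpose v) ** transpose \<gamma>"
    by (simp only: matrix_transpose_mul matrix_mul_assoc)
  have inj: "\<gamma> *v y = 0 \<longleftrightarrow> y = 0" for y
    using orthogonal_matrix_norm[OF g, of y] by (metis norm_eq_zero)
  have "y \<in> (\<lambda>x. \<gamma> *v x) ` great_subsphere v \<longleftrightarrow> y \<in> great_subsphere (\<gamma> ** v)" for y
  proof
    assume "y \<in> (\<lambda>x. \<gamma> *v x) ` great_subsphere v"
    then obtain x where x: "x \<in> great_subsphere v" "y = \<gamma> *v x" by blast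
    show "y \<in> great_subsphere (\<gamma> ** v)"
      using x unfolding great_subsphere_alt[OF stiefel_orthogonal_mult[OF g v]] great_subsphere_alt[OF v] P x(2)
      by (simp add: conj_mult_vec[OF g] orthogonal_matrix_norm[OF g] inj)
  next
    assume y: "y \<in> great_subsphere (\<gamma> ** v)"
    have yy: "y = \<gamma> *v (transpose \<gamma> *v y)" by (rule orthogonal_matrix_cancel(2)[OF g, symmetric])
    let ?x = "transpose \<gamma> *v y"
    have "\<gamma> *v ?x \<in> great_subsphere (\<gamma> ** v)" using y yy by simp
    then have "?x \<in> great_subsphere v"
      unfolding great_subsphere_alt[OF stiefel_orthogonal_mult[OF g v]] great_subsphere_alt[OF v] P
      by (simp add: conj_mult_vec[OF g] orthogonal_matrix_norm[OF g] inj del: transpose_matrix_vector)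
    then show "y \<in> (\<lambda>x. \<gamma> *v x) ` great_subsphere v" using yy by blast
  qed
  then show ?thesis by blast
qed

lemma Xi_orthogonal_image:
  assumes g: "orthogonal_matrix \<gamma>" and "\<xi> \<in> Xi"
  shows "(\<lambda>x. \<gamma> *v x) ` \<xi> \<in> Xi" "normal_proj ((\<lambda>x. \<gamma> *v x) ` \<xi>) = \<gamma> ** normal_proj \<xi> ** transpose \<gamma>"
proof -
  obtain v where v: "v \<in> stiefel" "\<xi> = great_subsphere v" using assms(2) by (auto simp: Xi_def)
  note gv = stiefel_orthogonal_mult[OF g v(1)]
  show "(\<lambda>x. \<gamma> *v x) ` \<xi> \<in> Xi"
    unfolding v(2) great_subsphere_orthogonal_mult[OF g v(1)] using gv by (auto simp: Xi_def)
  show "normal_proj ((\<lambda>x. \<gamma> *v x) ` \<xi>) = \<gamma> ** normal_proj \<xi> ** transpose \<gamma>"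
    unfolding v(2) great_subsphere_orthogonal_mult[OF g v(1)] normal_proj_great_subsphere[OF gv] normal_proj_great_subsphere[OF v(1)]
    by (simp only: matrix_transpose_mul matrix_mul_assoc)
qed

lemma normal_proj_subspace_proj:
  fixes \<xi> :: "(real^('p::finite+'q::finite)) set"
  assumes "\<xi> \<in> Xi" shows "subspace_proj left_set (normal_proj \<xi>)"
proof -
  obtain r where "orthogonal_matrix r" "r ** v0 = frame_of \<xi>"
    using stiefel_frame_exists[OF frame_of(1)[OF assms]] .
  then show ?thesis
    unfolding subspace_proj_def normal_proj_def using stiefel_proj[of r] by auto
qed

lemma stiefel_borel: "(stiefel :: (real^'q^('p::finite+'q::finite)) set) \<in> sets borel"
proof -
  have "closed ((\<lambda>v :: real^'q^('p+'q). transpose v ** v) -` {mat 1})"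
  proof (rule closed_vimage)
    have "continuous_on UNIV (\<lambda>v :: real^'q^('p+'q). transpose v)"
      unfolding transpose_def by (intro continuous_on_vec_lambda continuous_intros)
    then show "continuous_on UNIV (\<lambda>v :: real^'q^('p+'q). transpose v ** v)"
      by (intro continuous_intros)
  qed simp
  then show ?thesis by (simp add: stiefel_def vimage_def)
qed

lemma Xi_space_generator:
  "{A. A \<subseteq> Xi \<and> {v \<in> stiefel. great_subsphere v \<in> A} \<in> sets borel} \<subseteq> Pow (Xi :: (real^('p::finite+'q::finite)) set set)"
  by auto

lemma space_Xi_space [simp]: "space Xi_space = Xi"
  by (simp add: Xi_space_def space_measure_of_conv)

text \<open>
  Measurability on \<open>Xi\<close> is that of the quotient of the Stiefel manifold, so it is checked on frames.
\<close>

lemma measurable_Xi_spaceI: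
  fixes h :: "(real^('p::finite+'q::finite)) set \<Rightarrow> 'b::topological_space"
  assumes "(\<lambda>v :: real^'q^('p+'q). h (great_subsphere v)) \<in> borel_measurable (restrict_space borel stiefel)"
  shows "h \<in> Xi_space \<rightarrow>\<^sub>M borel"
proof (rule measurableI)
  fix B :: "'b set" assume B: "B \<in> sets borel"
  have "{v \<in> stiefel. great_subsphere v \<in> h -` B \<inter> Xi} = (\<lambda>v. h (great_subsphere v)) -` B \<inter> space (restrict_space borel (stiefel :: (real^'q^('p+'q)) set))"
    by (auto simp: Xi_def space_restrict_space)
  moreover have "\<dots> \<in> sets borel"
  proof -
    have "C \<in> sets borel" if "C \<in> sets (restrict_space borel stiefel)" for C :: "(real^'q^('p+'q)) set"
      using that sets_restrict_space_iff[of "stiefel :: (real^'q^('p+'q)) set" borel C] stiefel_borel[where 'p='p and 'q='q] by simp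
    then show ?thesis using measurable_sets[OF assms B] by blast
  qed
  ultimately have "{v \<in> stiefel :: (real^'q^('p+'q)) set. great_subsphere v \<in> h -` B \<inter> Xi} \<in> sets borel"
    by simp
  then show "h -` B \<inter> space Xi_space \<in> sets Xi_space"
    unfolding space_Xi_space unfolding Xi_space_def by (intro in_measure_of[OF Xi_space_generator]) auto
qed simp

lemma normal_proj_measurable: "normal_proj \<in> Xi_space \<rightarrow>\<^sub>M (borel :: (real^('p::finite+'q::finite)^('p+'q)) measure)"
proof (rule measurable_Xi_spaceI)
  have "continuous_on UNIV (\<lambda>v :: real^'q^('p+'q). transpose v)"
    unfolding transpose_def by (intro continuous_on_vec_lambda continuous_intros)
  then have "(\<lambda>v :: real^'q^('p+'q). v ** transpose v) \<in> borel_measurable borel"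
    by (intro borel_measurable_continuous_onI continuous_intros)
  then have "(\<lambda>v :: real^'q^('p+'q). v ** transpose v) \<in> borel_measurable (restrict_space borel stiefel)"
    by (rule measurable_restrict_space1)
  then show "(\<lambda>v :: real^'q^('p+'q). normal_proj (great_subsphere v)) \<in> borel_measurable (restrict_space borel stiefel)"
    by (rule measurable_cong[THEN iffD2, rotated]) (auto simp: space_restrict_space normal_proj_great_subsphere)
qed

lemma Xi_orthogonal_measurable:
  fixes \<gamma> :: "real^('p::finite+'q::finite)^('p+'q)"
  assumes g: "orthogonal_matrix \<gamma>"
  shows "(\<lambda>\<xi>. (\<lambda>x. \<gamma> *v x) ` \<xi>) \<in> Xi_space \<rightarrow>\<^sub>M Xi_space"
  unfolding Xi_space_def[where 'p='p and 'q='q]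
proof (rule measurable_measure_of[OF Xi_space_generator])
  show "(\<lambda>\<xi>. (\<lambda>x. \<gamma> *v x) ` \<xi>) \<in> space (sigma Xi {A. A \<subseteq> Xi \<and> {v \<in> stiefel. great_subsphere v \<in> A} \<in> sets borel}) \<rightarrow> Xi"
    using Xi_orthogonal_image(1)[OF g] by (auto simp: space_measure_of_conv)
  fix A assume A: "A \<in> {A. A \<subseteq> Xi \<and> {v \<in> stiefel :: (real^'q^('p+'q)) set. great_subsphere v \<in> A} \<in> sets borel}"
  let ?h = "\<lambda>v :: real^'q^('p+'q). \<gamma> ** v"
  have "?h \<in> borel_measurable borel" by (intro borel_measurable_continuous_onI continuous_intros)
  then have "?h -` {v \<in> stiefel. great_subsphere v \<in> A} \<inter> stiefel \<in> sets borel"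
    using measurable_sets[of ?h borel borel "{v \<in> stiefel. great_subsphere v \<in> A}"] A stiefel_borel by auto
  also have "?h -` {v \<in> stiefel. great_subsphere v \<in> A} \<inter> stiefel
      = {v \<in> stiefel. great_subsphere v \<in> (\<lambda>\<xi>. (\<lambda>x. \<gamma> *v x) ` \<xi>) -` A \<inter> Xi}"
    using stiefel_orthogonal_mult[OF g] great_subsphere_orthogonal_mult[OF g] by (auto simp: Xi_def)
  finally show "(\<lambda>\<xi>. (\<lambda>x. \<gamma> *v x) ` \<xi>) -` A \<inter> space (sigma Xi {A. A \<subseteq> Xi \<and> {v \<in> stiefel. great_subsphere v \<in> A} \<in> sets borel})
      \<in> sets (sigma Xi {A. A \<subseteq> Xi \<and> {v \<in> stiefel. great_subsphere v \<in> A} \<in> sets borel})"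
    by (intro in_measure_of[OF Xi_space_generator]) (auto simp: space_measure_of_conv)
qed

lemma split_dir_law:
  "distr (sphere_measure \<Otimes>\<^sub>M sphere_measure) borel (\<lambda>z. join_vec (fst z) (snd z))
    = distr (sphere_measure :: (real^('p::finite + 'q::finite)) measure) borel (split_dir left_set)"
proof -
  let ?J = "\<lambda>z :: (real^'p) \<times> (real^'q). join_vec (fst z) (snd z)"
  let ?X = "\<lambda>x :: real^('p + 'q). (sgn (left_part x), sgn (right_part x))"
  note [measurable] = join_vec_measurable
  interpret P: prob_space "sphere_measure :: (real^'p) measure" by (rule prob_space_sphere_measure)
  interpret Q: prob_space "sphere_measure :: (real^'q) measure" by (rule prob_space_sphere_measure)
  interpret Q': prob_space "distr (sphere_measure :: (real^'q) measure) borel (\<lambda>x. x)" by (rule Q.prob_space_distr) measurable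
  have sd: "split_dir left_set = (\<lambda>x. ?J (?X x))"
  proof
    show "split_dir left_set x = ?J (?X x)" for x
      using split_dir_join[of "left_part x" "right_part x"] by simp
  qed
  have "distr sphere_measure borel (split_dir left_set) = distr (distr sphere_measure borel ?X) borel ?J"
    unfolding sd by (subst distr_distr) (auto simp: o_def)
  also have "\<dots> = distr (distr sphere_measure borel (\<lambda>x :: real^'p. x) \<Otimes>\<^sub>M distr sphere_measure borel (\<lambda>x :: real^'q. x)) borel ?J"
    unfolding sphere_measure_directions_independent ..
  also have "\<dots> = distr (distr (sphere_measure \<Otimes>\<^sub>M sphere_measure) (borel \<Otimes>\<^sub>M borel) (\<lambda>(x, y). (x, y))) borel ?J"
    by (subst pair_measure_distr) (auto intro: Q'.sigma_finite_measure_axioms)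
  also have "\<dots> = distr (sphere_measure \<Otimes>\<^sub>M sphere_measure) borel ?J"
  proof (subst distr_distr)
    show "?J \<in> (borel \<Otimes>\<^sub>M borel) \<rightarrow>\<^sub>M borel" using join_vec_measurable by (simp only: borel_prod)
    show "(\<lambda>(x, y). (x, y)) \<in> sphere_measure \<Otimes>\<^sub>M sphere_measure \<rightarrow>\<^sub>M (borel :: (real^'p) measure) \<Otimes>\<^sub>M (borel :: (real^'q) measure)"
      unfolding case_prod_beta
      by (intro measurable_Pair measurable_compose[OF measurable_fst measurable_ident_sphere_measure]
          measurable_compose[OF measurable_snd measurable_ident_sphere_measure])
  qed (simp add: o_def case_prod_beta)
  finally show ?thesis ..
qed

lemma funk_radon_cong:
  fixes f g :: "real^('p::finite+'q::finite) \<Rightarrow> real"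
  assumes "\<xi> \<in> Xi" and "\<And>x. norm x = 1 \<Longrightarrow> f x = g x"
  shows "funk_radon t f \<xi> = funk_radon t g \<xi>"
proof -
  define r where "r = (SOME r. orthogonal_matrix r \<and> r ** v0 = frame_of \<xi>)"
  have r: "orthogonal_matrix r \<and> r ** v0 = frame_of \<xi>"
    unfolding r_def by (rule someI_ex) (use stiefel_frame_exists[OF frame_of(1)[OF assms(1)]] in metis)
  have "norm (r *v join_vec (cos t *\<^sub>R \<eta>) (sin t *\<^sub>R \<zeta>)) = 1" if "norm \<eta> = 1" "norm \<zeta> = 1" for \<eta> :: "real^'p" and \<zeta> :: "real^'q"
    using r that by (simp add: orthogonal_matrix_norm norm_join_vec norm_Pair)
  then show ?thesis
    unfolding funk_radon_def Let_def frame_of_def[symmetric] r_def[symmetric]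
    by (intro Bochner_Integration.integral_cong refl assms(2)) auto
qed

text \<open>
  The frame chosen in the definition moves the coordinate subsphere to \<open>\<xi>\<close>. As the two directions of a uniform
  random point are independent and uniform, the double average is an average over one uniform point.
\<close>

lemma funk_radon_latitude:
  fixes f :: "real^('p::finite+'q::finite) \<Rightarrow> real"
  assumes xi: "\<xi> \<in> Xi" and fm [measurable]: "f \<in> borel_measurable borel"
    and int: "integrable sphere_measure (\<lambda>x. f (latitude t (normal_proj \<xi>) x))"
  shows "funk_radon t f \<xi> = (\<integral>x. f (latitude t (normal_proj \<xi>) x) \<partial>sphere_measure)"
proof -
  define r where "r = (SOME r. orthogonal_matrix r \<and> r ** v0 = frame_of \<xi>)"
  have "orthogonal_matrix r \<and> r ** v0 = frame_of \<xi>"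
    unfolding r_def by (rule someI_ex) (use stiefel_frame_exists[OF frame_of(1)[OF xi]] in metis)
  then have r: "orthogonal_matrix r" "r ** v0 = frame_of \<xi>" by auto
  have P: "normal_proj \<xi> = r ** coord_proj (- left_set) ** transpose r"
    unfolding normal_proj_def r(2)[symmetric] by (rule stiefel_proj)
  let ?g = "\<lambda>u. f (r *v blend left_set (cos t) (sin t) u)"
  let ?J = "\<lambda>z :: (real^'p) \<times> (real^'q). join_vec (fst z) (snd z)"
  have gm [measurable]: "?g \<in> borel_measurable borel" by measurable
  note [measurable] = join_vec_measurable
  interpret PQ: pair_prob_space "sphere_measure :: (real^'p) measure" "sphere_measure :: (real^'q) measure"
    by (intro pair_prob_space.intro pair_sigma_finite.intro prob_space_imp_sigma_finite prob_space_sphere_measure)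
  have Jm [measurable]: "?J \<in> sphere_measure \<Otimes>\<^sub>M sphere_measure \<rightarrow>\<^sub>M borel"
  proof -
    have "(\<lambda>z. ?J (fst z, snd z)) \<in> sphere_measure \<Otimes>\<^sub>M sphere_measure \<rightarrow>\<^sub>M borel"
    proof (rule measurable_compose[OF _ join_vec_measurable])
      have "(\<lambda>z. (fst z, snd z)) \<in> sphere_measure \<Otimes>\<^sub>M sphere_measure \<rightarrow>\<^sub>M (borel :: (real^'p) measure) \<Otimes>\<^sub>M (borel :: (real^'q) measure)"
        by (intro measurable_Pair measurable_compose[OF measurable_fst measurable_ident_sphere_measure]
          measurable_compose[OF measurable_snd measurable_ident_sphere_measure])
      then show "(\<lambda>z. (fst z, snd z)) \<in> sphere_measure \<Otimes>\<^sub>M sphere_measure \<rightarrow>\<^sub>M (borel :: ((real^'p) \<times> (real^'q)) measure)"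
        by (simp only: borel_prod)
    qed
    then show ?thesis by simp
  qed
  have lat: "r *v latitude t (coord_proj (- left_set)) x = latitude t (normal_proj \<xi>) (r *v x)" for x
    unfolding P latitude_conj[OF r(1)] ..
  have lr: "(\<integral>x. f (latitude t (normal_proj \<xi>) (r *v x)) \<partial>sphere_measure) = (\<integral>x. f (latitude t (normal_proj \<xi>) x) \<partial>sphere_measure)"
    and ir: "integrable sphere_measure (\<lambda>x. f (latitude t (normal_proj \<xi>) (r *v x)))"
  proof -
    note m = measurable_orthogonal_sphere[OF r(1)]
    have fl: "(\<lambda>x. f (latitude t (normal_proj \<xi>) x)) \<in> borel_measurable sphere_measure" by measurable
    show "(\<integral>x. f (latitude t (normal_proj \<xi>) (r *v x)) \<partial>sphere_measure) = (\<integral>x. f (latitude t (normal_proj \<xi>) x) \<partial>sphere_measure)"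
      using integral_distr[OF m fl] by (simp add: distr_sphere_measure_orthogonal[OF r(1)])
    show "integrable sphere_measure (\<lambda>x. f (latitude t (normal_proj \<xi>) (r *v x)))"
      using integrable_distr_eq[OF m fl] int by (simp add: distr_sphere_measure_orthogonal[OF r(1)])
  qed
  have gs: "?g (split_dir left_set x) = f (latitude t (normal_proj \<xi>) (r *v x))" for x
    unfolding latitude_coord[symmetric] lat ..
  have iJ: "integrable (sphere_measure \<Otimes>\<^sub>M sphere_measure) (\<lambda>z. ?g (?J z))"
  proof -
    have "integrable (distr sphere_measure borel (split_dir left_set)) ?g"
      by (subst integrable_distr_eq) (use ir in \<open>auto simp: gs\<close>)
    then show ?thesis unfolding split_dir_law[symmetric] by (subst (asm) integrable_distr_eq) auto
  qed
  have "funk_radon t f \<xi> = (\<integral>\<zeta>. (\<integral>\<eta>. ?g (?J (\<eta>, \<zeta>)) \<partial>sphere_measure) \<partial>sphere_measure)"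
    unfolding funk_radon_def Let_def frame_of_def[symmetric] r_def[symmetric] by (simp add: blend_join_vec)
  also have "\<dots> = (\<integral>z. ?g (?J z) \<partial>(sphere_measure \<Otimes>\<^sub>M sphere_measure))"
    using PQ.integral_snd[of "\<lambda>\<eta> \<zeta>. ?g (?J (\<eta>, \<zeta>))"] iJ by (simp add: case_prod_beta')
  also have "\<dots> = (\<integral>u. ?g u \<partial>distr (sphere_measure \<Otimes>\<^sub>M sphere_measure) borel ?J)"
    by (rule integral_distr[symmetric]) measurable
  also have "\<dots> = (\<integral>x. ?g (split_dir left_set x) \<partial>sphere_measure)"
    unfolding split_dir_law by (rule integral_distr) measurable
  also have "\<dots> = (\<integral>x. f (latitude t (normal_proj \<xi>) x) \<partial>sphere_measure)"
    unfolding gs by (rule lr)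
  finally show ?thesis .
qed

section \<open>Uniqueness and non-uniqueness\<close>

text \<open>
  Moving the subsphere and the point \<open>x\<close> by an orthogonal \<open>\<gamma>\<close> conjugates the projection and moves the point at
  distance \<open>t\<close> by \<open>\<gamma>\<close>, while the product of the two invariant measures is preserved.
\<close>

lemma equivariant_pair_Xi:
  fixes \<mu> :: "(real^('p::finite+'q::finite)) set measure"
  assumes "invariant_prob_Xi \<mu>"
  shows "equivariant_pair (\<mu> \<Otimes>\<^sub>M sphere_measure) (\<lambda>\<omega>. normal_proj (fst \<omega>))
    (\<lambda>\<omega>. latitude t (normal_proj (fst \<omega>)) (snd \<omega>)) left_set t"
proof -
  let ?S = "sphere_measure :: (real^('p+'q)) measure"
  let ?M = "\<mu> \<Otimes>\<^sub>M ?S"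
  let ?P = "\<lambda>\<omega> :: (real^('p+'q)) set \<times> (real^('p+'q)). normal_proj (fst \<omega>)"
  let ?L = "\<lambda>\<omega> :: (real^('p+'q)) set \<times> (real^('p+'q)). latitude t (?P \<omega>) (snd \<omega>)"
  from assms have prob: "prob_space \<mu>" and space: "space \<mu> = Xi" and sets: "sets \<mu> = sets Xi_space"
    and inv: "\<And>\<gamma>. orthogonal_matrix \<gamma> \<Longrightarrow> distr \<mu> \<mu> (\<lambda>\<xi>. (\<lambda>x. \<gamma> *v x) ` \<xi>) = \<mu>"
    by (auto simp: invariant_prob_Xi_def)
  interpret mu: prob_space \<mu> by (rule prob)
  interpret S: prob_space ?S by (rule prob_space_sphere_measure)
  interpret MS: pair_prob_space \<mu> ?S ..
  have Pm: "normal_proj \<in> borel_measurable \<mu>"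
    using normal_proj_measurable by (simp add: measurable_cong_sets[OF sets refl])
  have Pm' [measurable]: "?P \<in> borel_measurable ?M"
    by (rule measurable_compose[OF measurable_fst Pm])
  have sm [measurable]: "snd \<in> borel_measurable ?M"
    by (rule measurable_compose[OF measurable_snd measurable_ident_sphere_measure])
  have Lm [measurable]: "?L \<in> borel_measurable ?M" by measurable
  have ne: "(left_set :: ('p+'q) set) \<noteq> {}" "- (left_set :: ('p+'q) set) \<noteq> {}" by auto
  have AE_lat: "AE \<omega> in ?M. norm (?L \<omega>) = 1 \<and> latitude_form a b m (?P \<omega>) (?L \<omega>) = jacobi a b m (cos (2 * t))" for a b m
  proof (rule MS.AE_pair_measure)
    show "{\<omega> \<in> space ?M. norm (?L \<omega>) = 1 \<and> latitude_form a b m (?P \<omega>) (?L \<omega>) = jacobi a b m (cos (2 * t))} \<in> sets ?M"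
      by measurable
    show "AE \<xi> in \<mu>. AE x in ?S. norm (?L (\<xi>, x)) = 1 \<and> latitude_form a b m (?P (\<xi>, x)) (?L (\<xi>, x)) = jacobi a b m (cos (2 * t))"
    proof (rule AE_I2)
      fix \<xi> assume "\<xi> \<in> space \<mu>"
      then have "subspace_proj left_set (normal_proj \<xi>)" using space by (intro normal_proj_subspace_proj) simp
      from latitude_AE[OF ne this]
      show "AE x in ?S. norm (?L (\<xi>, x)) = 1 \<and> latitude_form a b m (?P (\<xi>, x)) (?L (\<xi>, x)) = jacobi a b m (cos (2 * t))"
        by simp
    qed
  qed
  show ?thesis
  proof (intro equivariant_pair.intro MS.prob_space_axioms equivariant_pair_axioms.intro)
    show "?P \<in> borel_measurable ?M" "?L \<in> borel_measurable ?M" by (rule Pm', rule Lm)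
    show "(left_set :: ('p+'q) set) \<noteq> {}" "- (left_set :: ('p+'q) set) \<noteq> {}" by (rule ne)+
    show "subspace_proj left_set (?P \<omega>)" if "\<omega> \<in> space ?M" for \<omega>
    proof (rule normal_proj_subspace_proj)
      show "fst \<omega> \<in> Xi" using that by (simp add: space_pair_measure mem_Times_iff space)
    qed
    show "norm (?L \<omega>) \<le> 2" for \<omega> by (rule latitude_norm_le)
    show "AE \<omega> in ?M. norm (?L \<omega>) = 1" using AE_lat[of 0 0 0] by (rule eventually_mono) (rule conjunct1)
    show "AE \<omega> in ?M. latitude_form (real (card (- (left_set :: ('p+'q) set))) / 2 - 1) (real (card (left_set :: ('p+'q) set)) / 2 - 1) m (?P \<omega>) (?L \<omega>)
        = jacobi (real (card (- (left_set :: ('p+'q) set))) / 2 - 1) (real (card (left_set :: ('p+'q) set)) / 2 - 1) m (cos (2 * t))" for m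
      using AE_lat[of "real (card (- (left_set :: ('p+'q) set))) / 2 - 1" "real (card (left_set :: ('p+'q) set)) / 2 - 1" m]
      by (rule eventually_mono) (rule conjunct2)
    fix \<gamma> :: "real^('p+'q)^('p+'q)" assume g: "orthogonal_matrix \<gamma>"
    let ?G = "\<lambda>\<xi>. (\<lambda>x. \<gamma> *v x) ` \<xi>"
    let ?T = "\<lambda>(\<xi>, x). (?G \<xi>, \<gamma> *v x)"
    have Gm: "?G \<in> \<mu> \<rightarrow>\<^sub>M \<mu>"
      using Xi_orthogonal_measurable[OF g] by (simp add: measurable_cong_sets[OF sets sets])
    have gm: "(*v) \<gamma> \<in> ?S \<rightarrow>\<^sub>M ?S" by (rule measurable_orthogonal_sphere[OF g])
    have "distr \<mu> \<mu> ?G \<Otimes>\<^sub>M distr ?S ?S ((*v) \<gamma>) = distr ?M ?M ?T"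
      by (rule pair_measure_distr[OF Gm gm])
         (simp add: distr_sphere_measure_orthogonal[OF g] S.sigma_finite_measure_axioms)
    then have TM: "distr ?M ?M ?T = ?M" by (simp add: inv[OF g] distr_sphere_measure_orthogonal[OF g])
    have Tm [measurable]: "?T \<in> ?M \<rightarrow>\<^sub>M ?M"
      unfolding case_prod_beta'
      by (intro measurable_Pair measurable_compose[OF measurable_fst Gm] measurable_compose[OF measurable_snd gm])
    have "distr ?M borel (\<lambda>\<omega>. (\<gamma> ** ?P \<omega> ** transpose \<gamma>, \<gamma> *v ?L \<omega>)) = distr ?M borel (\<lambda>\<omega>. (?P (?T \<omega>), ?L (?T \<omega>)))"
    proof (rule distr_cong)
      fix \<omega> assume "\<omega> \<in> space ?M"
      then obtain \<xi> x where w: "\<omega> = (\<xi>, x)" "\<xi> \<in> Xi" using space by (auto simp: space_pair_measure)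
      show "(\<gamma> ** ?P \<omega> ** transpose \<gamma>, \<gamma> *v ?L \<omega>) = (?P (?T \<omega>), ?L (?T \<omega>))"
        unfolding w(1) by (simp add: Xi_orthogonal_image(2)[OF g w(2)] latitude_conj[OF g])
    qed simp_all
    also have "\<dots> = distr (distr ?M ?M ?T) borel (\<lambda>\<omega>. (?P \<omega>, ?L \<omega>))"
    proof -
      have "(\<lambda>\<omega>. (?P \<omega>, ?L \<omega>)) \<in> ?M \<rightarrow>\<^sub>M borel" by measurable
      from distr_distr[OF this Tm] show ?thesis by (simp add: o_def)
    qed
    also have "\<dots> = distr ?M borel (\<lambda>\<omega>. (?P \<omega>, ?L \<omega>))" unfolding TM ..
    finally show "distr ?M borel (\<lambda>\<omega>. (\<gamma> ** ?P \<omega> ** transpose \<gamma>, \<gamma> *v ?L \<omega>)) = distr ?M borel (\<lambda>\<omega>. (?P \<omega>, ?L \<omega>))" .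
  qed
qed

text \<open>
  Only the values on the sphere are controlled, so \<open>f\<close> is replaced by its extension by 0.
\<close>

lemma sphere_function_borel:
  fixes f :: "'a::euclidean_space \<Rightarrow> real"
  assumes "integrable sphere_measure f"
  shows "(\<lambda>x. indicator usphere x * f x) \<in> borel_measurable borel"
    and "integrable sphere_measure (\<lambda>x. indicator usphere x * f x)"
proof -
  have "f \<in> borel_measurable (restrict_space borel usphere)"
    using borel_measurable_integrable[OF assms] by (simp add: measurable_cong_sets[OF sets_sphere_measure refl])
  then show "(\<lambda>x. indicator usphere x * f x) \<in> borel_measurable borel"
    by (subst (asm) borel_measurable_restrict_space_iff) (auto simp: mult.commute)
  show "integrable sphere_measure (\<lambda>x. indicator usphere x * f x)"
    by (rule Bochner_Integration.integrable_cong[THEN iffD1, OF refl _ assms]) auto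
qed

text \<open>
  By \<open>law_L\<close> the random point at distance \<open>t\<close> from a random subsphere is uniformly distributed. So an
  integrable \<open>f\<close> is integrable over the points at distance \<open>t\<close> from almost every subsphere.
\<close>

lemma funk_radon_AE:
  fixes \<mu> :: "(real^('p::finite+'q::finite)) set measure"
  assumes mu: "invariant_prob_Xi \<mu>" and f: "integrable sphere_measure f"
  shows "AE \<xi> in \<mu>. integrable sphere_measure (\<lambda>x. indicator usphere (latitude t (normal_proj \<xi>) x) * f (latitude t (normal_proj \<xi>) x))
    \<and> funk_radon t f \<xi> = (\<integral>x. indicator usphere (latitude t (normal_proj \<xi>) x) * f (latitude t (normal_proj \<xi>) x) \<partial>sphere_measure)"
proof -
  let ?S = "sphere_measure :: (real^('p+'q)) measure"
  let ?f = "\<lambda>x. indicator usphere x * f x"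
  from mu have prob: "prob_space \<mu>" and space: "space \<mu> = Xi" by (auto simp: invariant_prob_Xi_def)
  interpret mu: prob_space \<mu> by (rule prob)
  interpret S: prob_space ?S by (rule prob_space_sphere_measure)
  interpret MS: pair_prob_space \<mu> ?S ..
  interpret E: equivariant_pair "\<mu> \<Otimes>\<^sub>M ?S" "\<lambda>\<omega>. normal_proj (fst \<omega>)" "\<lambda>\<omega>. latitude t (normal_proj (fst \<omega>)) (snd \<omega>)" left_set t
    by (rule equivariant_pair_Xi[OF mu])
  note b = sphere_function_borel[OF f]
  have "integrable (\<mu> \<Otimes>\<^sub>M ?S) (\<lambda>\<omega>. ?f (latitude t (normal_proj (fst \<omega>)) (snd \<omega>)))"
    using E.integrable_L_iff[OF b(1)] b(2) by blast
  from MS.AE_integrable_fst'[OF this] have "AE \<xi> in \<mu>. integrable ?S (\<lambda>x. ?f (latitude t (normal_proj \<xi>) x))" by simp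
  then show ?thesis
    using AE_space
  proof eventually_elim
    case (elim \<xi>)
    then have xi: "\<xi> \<in> Xi" using space by simp
    have "funk_radon t f \<xi> = funk_radon t ?f \<xi>" by (rule funk_radon_cong[OF xi]) auto
    also have "\<dots> = (\<integral>x. ?f (latitude t (normal_proj \<xi>) x) \<partial>?S)"
      by (rule funk_radon_latitude[OF xi b(1) elim(1)])
    finally show ?case using elim(1) by simp
  qed
qed

text \<open>
  The weight \<open>H\<close> in \<open>duality_L1\<close> depends on the subsphere only. Hence the left-hand side of the duality is the
  integral of \<open>H\<close> times the transform, which vanishes.
\<close>

lemma funk_radon_zero_orthogonal:
  fixes \<mu> :: "(real^('p::finite+'q::finite)) set measure"
  assumes mu: "invariant_prob_Xi \<mu>" and f: "integrable sphere_measure f"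
    and zero: "AE \<xi> in \<mu>. funk_radon t f \<xi> = 0"
    and J: "jacobi (real CARD('q) / 2 - 1) (real CARD('p) / 2 - 1) m (cos (2 * t)) \<noteq> 0"
    and y: "norm y = 1"
  shows "(\<integral>x. f x * zonal TYPE('p + 'q) m (y \<bullet> x) \<partial>sphere_measure) = 0"
proof -
  let ?S = "sphere_measure :: (real^('p+'q)) measure"
  let ?f = "\<lambda>x. indicator usphere x * f x"
  let ?H = "latitude_form (real CARD('q) / 2 - 1) (real CARD('p) / 2 - 1) m"
  let ?P = "\<lambda>\<omega> :: (real^('p+'q)) set \<times> (real^('p+'q)). normal_proj (fst \<omega>)"
  let ?L = "\<lambda>\<omega> :: (real^('p+'q)) set \<times> (real^('p+'q)). latitude t (?P \<omega>) (snd \<omega>)"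
  from mu have prob: "prob_space \<mu>" and space: "space \<mu> = Xi" by (auto simp: invariant_prob_Xi_def)
  interpret mu: prob_space \<mu> by (rule prob)
  interpret S: prob_space ?S by (rule prob_space_sphere_measure)
  interpret MS: pair_prob_space \<mu> ?S ..
  interpret E: equivariant_pair "\<mu> \<Otimes>\<^sub>M ?S" ?P ?L left_set t
    by (rule equivariant_pair_Xi[OF mu])
  note b = sphere_function_borel[OF f]
  note duality = E.duality_L1[OF b y, of m, unfolded card_left_set]
  have int: "integrable (\<mu> \<Otimes>\<^sub>M ?S) (\<lambda>\<omega>. ?f (?L \<omega>))"
    using E.integrable_L_iff[OF b(1)] b(2) by blast
  have intH: "integrable (\<mu> \<Otimes>\<^sub>M ?S) (\<lambda>\<omega>. ?f (?L \<omega>) * ?H (?P \<omega>) y)"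
    using E.P_meas latitude_form_bound[OF E.P_proj y] by (intro integrable_mult_bounded[OF int]) measurable
  have "(\<integral>\<omega>. ?f (?L \<omega>) * ?H (?P \<omega>) y \<partial>(\<mu> \<Otimes>\<^sub>M ?S))
      = (\<integral>\<xi>. \<integral>x. ?f (latitude t (normal_proj \<xi>) x) * ?H (normal_proj \<xi>) y \<partial>?S \<partial>\<mu>)"
    using MS.integral_fst'[OF intH] by simp
  also have "\<dots> = (\<integral>\<xi>. 0 \<partial>\<mu>)"
  proof (rule integral_cong_AE)
    show "(\<lambda>\<xi>. \<integral>x. ?f (latitude t (normal_proj \<xi>) x) * ?H (normal_proj \<xi>) y \<partial>?S) \<in> borel_measurable \<mu>"
      using borel_measurable_integrable[OF MS.integrable_fst'[OF intH]] by simp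
    show "AE \<xi> in \<mu>. (\<integral>x. ?f (latitude t (normal_proj \<xi>) x) * ?H (normal_proj \<xi>) y \<partial>?S) = 0"
      using zero funk_radon_AE[OF mu f, of t] by eventually_elim simp
  qed simp
  finally have "(\<integral>z. ?f z * zonal TYPE('p + 'q) m (y \<bullet> z) \<partial>?S) = 0" using duality J by simp
  moreover have "(\<integral>z. ?f z * zonal TYPE('p + 'q) m (y \<bullet> z) \<partial>?S) = (\<integral>z. f z * zonal TYPE('p + 'q) m (y \<bullet> z) \<partial>?S)"
    by (intro Bochner_Integration.integral_cong refl) simp
  ultimately show ?thesis by simp
qed

theorem funk_radon_uniqueness:
  fixes \<mu> :: "(real^('p::finite+'q::finite)) set measure" and T :: "real set"
  assumes mu: "invariant_prob_Xi \<mu>" and f: "f \<in> L1_even"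
    and zero: "\<And>t. t \<in> T \<Longrightarrow> AE \<xi> in \<mu>. funk_radon t f \<xi> = 0"
    and J: "\<And>m. \<exists>t\<in>T. jacobi (real CARD('q) / 2 - 1) (real CARD('p) / 2 - 1) m (cos (2 * t)) \<noteq> 0"
  shows "AE x in sphere_measure. f x = 0"
proof -
  let ?f = "\<lambda>x. indicator usphere x * f x"
  from f have fi: "integrable sphere_measure f" and even: "AE x in sphere_measure. f (- x) = f x"
    by (auto simp: L1_even_def)
  note b = sphere_function_borel[OF fi]
  have "AE x in sphere_measure. ?f x = 0"
  proof (rule zonal_orthogonal_imp_zero[OF _ b])
    show "CARD('p + 'q) \<ge> 2" using zero_less_card_finite[where 'a='p] zero_less_card_finite[where 'a='q]
      unfolding card_sum by linarith
    show "AE x in sphere_measure. ?f (- x) = ?f x"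
      using even AE_space by eventually_elim auto
    fix m and y :: "real^('p+'q)" assume y: "norm y = 1"
    obtain t where t: "t \<in> T" "jacobi (real CARD('q) / 2 - 1) (real CARD('p) / 2 - 1) m (cos (2 * t)) \<noteq> 0"
      using J by blast
    have "(\<integral>x. f x * zonal TYPE('p + 'q) m (y \<bullet> x) \<partial>sphere_measure) = 0"
      by (rule funk_radon_zero_orthogonal[OF mu fi zero[OF t(1)] t(2) y])
    moreover have "(\<integral>x. ?f x * zonal TYPE('p + 'q) m (y \<bullet> x) \<partial>sphere_measure) = (\<integral>x. f x * zonal TYPE('p + 'q) m (y \<bullet> x) \<partial>sphere_measure)"
      by (intro Bochner_Integration.integral_cong refl) simp
    ultimately show "(\<integral>x. ?f x * zonal TYPE('p + 'q) m (y \<bullet> x) \<partial>sphere_measure) = 0" by simp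
  qed
  then show ?thesis using AE_space by eventually_elim simp
qed

theorem funk_radon_harmonic_zero:
  fixes Y :: "real^('p::finite+'q::finite) \<Rightarrow> real"
  assumes Y: "spherical_harmonic (2 * m) Y"
    and J: "jacobi (real CARD('q) / 2 - 1) (real CARD('p) / 2 - 1) m (cos (2 * t)) = 0"
    and xi: "\<xi> \<in> Xi"
  shows "funk_radon t Y \<xi> = 0"
proof -
  let ?S = "sphere_measure :: (real^('p+'q)) measure"
  interpret S: prob_space ?S by (rule prob_space_sphere_measure)
  obtain p where p: "real_polynomial_function p" "\<And>c x. p (c *\<^sub>R x) = c ^ (2 * m) * p x"
    "\<And>x. laplacian p x = 0" "\<And>x. x \<in> usphere \<Longrightarrow> Y x = p x"
    using Y by (auto simp: spherical_harmonic_def)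
  have pc: "continuous_on A p" for A
    using p(1) by (intro continuous_on_polymonial_function) (simp add: real_polynomial_function_eq)
  have pm [measurable]: "p \<in> borel_measurable borel" using pc by (rule borel_measurable_continuous_onI)
  have "compact (p ` cball 0 2)" by (rule compact_continuous_image[OF pc compact_cball])
  then obtain B where B: "\<And>x. norm x \<le> 2 \<Longrightarrow> \<bar>p x\<bar> \<le> B"
    using compact_imp_bounded bounded_iff by (metis imageI real_norm_def mem_cball_0)
  have int: "integrable ?S (\<lambda>x. p (latitude t (normal_proj \<xi>) x))"
    by (rule S.integrable_const_bound[where B=B]) (auto intro!: B latitude_norm_le)
  have ne: "(left_set :: ('p+'q) set) \<noteq> {}" "- (left_set :: ('p+'q) set) \<noteq> {}" by auto
  have "funk_radon t Y \<xi> = funk_radon t p \<xi>" by (rule funk_radon_cong[OF xi]) (simp add: p(4))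
  also have "\<dots> = (\<integral>x. p (latitude t (normal_proj \<xi>) x) \<partial>?S)" by (rule funk_radon_latitude[OF xi pm int])
  also have "\<dots> = 0"
    using harmonic_latitude_mean_proj[OF ne normal_proj_subspace_proj[OF xi] p(1-3)] J
    by (auto simp: card_left_set)
  finally show ?thesis .
qed

text \<open>
  An example is \<open>latitude_form\<close> for a fixed subsphere: on this subsphere its value is that of the Jacobi
  polynomial at 1, which is positive.
\<close>

lemma nontrivial_even_harmonic:
  "\<exists>Y :: real^('p::finite+'q::finite) \<Rightarrow> real. spherical_harmonic (2 * m) Y \<and> Y \<in> L1_even \<and> \<not> (AE x in sphere_measure. Y x = 0)"
proof -
  let ?\<alpha> = "real (card (- (left_set :: ('p+'q) set))) / 2 - 1" and ?\<beta> = "real (card (left_set :: ('p+'q) set)) / 2 - 1"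
  let ?S = "sphere_measure :: (real^('p+'q)) measure"
  interpret S: prob_space ?S by (rule prob_space_sphere_measure)
  define Y where "Y = latitude_form ?\<alpha> ?\<beta> m (coord_proj (- left_set) :: real^('p+'q)^('p+'q))"
  have ne: "- (left_set :: ('p+'q) set) \<noteq> {}" by auto
  have harm: "spherical_harmonic (2 * m) Y"
    unfolding spherical_harmonic_def Y_def
    by (intro exI[of _ "latitude_form ?\<alpha> ?\<beta> m (coord_proj (- left_set))"] conjI allI ballI refl
        latitude_form_polynomial latitude_form_scale latitude_form_harmonic_coord[OF ne])
  have Yc: "continuous_on A Y" for A
    unfolding Y_def by (intro continuous_intros)
  have "Y (- x) = Y x" for x
    using latitude_form_scale[of ?\<alpha> ?\<beta> m "coord_proj (- left_set)" "-1" x] by (simp add: Y_def)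
  then have L1: "Y \<in> L1_even" unfolding L1_even_def by (simp add: integrable_sphere_continuous[OF Yc])
  obtain i :: 'p where True by blast
  let ?e = "axis (Inl i) 1 :: real^('p+'q)"
  have "?e - coord_proj (- left_set) *v ?e = ?e" "coord_proj (- left_set) *v ?e = 0"
    by (auto simp: coord_proj_mult axis_def vec_eq_iff)
  then have "Y ?e = (\<Sum>s\<le>m. jacobi_coeff ?\<alpha> ?\<beta> m s * 1 ^ (m - s) * 0 ^ s)"
    unfolding Y_def latitude_form_def by simp
  also have "\<dots> = (\<Sum>s\<in>{0}. jacobi_coeff ?\<alpha> ?\<beta> m s * 1 ^ (m - s) * 0 ^ s)"
    by (rule sum.mono_neutral_right) auto
  also have "\<dots> > 0" using ne by (simp add: jacobi_coeff_0_pos card_left_set)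
  finally have e: "?e \<in> {x. Y x \<noteq> 0}" by simp
  have op: "open {x. Y x \<noteq> 0}" using Yc[of UNIV] by (rule open_Collect_neq) (rule continuous_on_const)
  have "0 < measure ?S ({x. Y x \<noteq> 0} \<inter> usphere)"
    by (rule sphere_measure_open_pos[OF op e]) simp
  moreover have "measure ?S ({x. Y x \<noteq> 0} \<inter> usphere) = 0" if "AE x in ?S. Y x = 0"
  proof -
    have "{x. Y x \<noteq> 0} \<inter> usphere \<in> sets ?S" using op by (auto simp: sets_sphere_measure_iff)
    moreover have "{x. Y x \<noteq> 0} \<inter> usphere = {x \<in> space ?S. \<not> Y x = 0}" by auto
    ultimately show ?thesis using that AE_iff_measurable[of "{x. Y x \<noteq> 0} \<inter> usphere" ?S "\<lambda>x. Y x = 0"]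
      by (simp add: measure_def)
  qed
  ultimately have "\<not> (AE x in ?S. Y x = 0)" by linarith
  then show ?thesis using harm L1 by blast
qed

theorem theorem1p1:
  fixes n k :: nat and \<sigma> \<rho> :: real
    and \<mu> :: "(real^('p::finite+'q::finite)) set measure"
  assumes "n \<ge> 2" and "1 \<le> k" and "k \<le> n - 1"
    and "CARD('p) = k + 1" and "CARD('q) = n - k"
    and "\<sigma> = (real n - real k) / 2 - 1" and "\<rho> = (real k - 1) / 2"
    and "invariant_prob_Xi \<mu>"
  shows
    "(\<forall>t\<in>{0<..<pi/2}.
        (\<forall>f\<in>L1_even. \<forall>g\<in>L1_even.
            (AE \<xi> in \<mu>. funk_radon t f \<xi> = funk_radon t g \<xi>) \<longrightarrow>
            (AE x in sphere_measure. f x = g x))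
        \<longleftrightarrow> (\<forall>j. even j \<longrightarrow> jacobi \<sigma> \<rho> (j div 2) (cos (2 * t)) \<noteq> 0))
     \<and>
     (\<forall>l\<ge>1. \<forall>t :: nat \<Rightarrow> real. (\<forall>i\<in>{1..l}. t i \<in> {0<..<pi/2}) \<longrightarrow>
        ((\<nexists>j. even j \<and> (\<forall>i\<in>{1..l}. jacobi \<sigma> \<rho> (j div 2) (cos (2 * t i)) = 0)) \<longrightarrow>
           (\<forall>f\<in>L1_even. (\<forall>i\<in>{1..l}. AE \<xi> in \<mu>. funk_radon (t i) f \<xi> = 0) \<longrightarrow>
              (AE x in sphere_measure. f x = 0)))
        \<and>
        (\<forall>j\<^sub>0. even j\<^sub>0 \<and> (\<forall>i\<in>{1..l}. jacobi \<sigma> \<rho> (j\<^sub>0 div 2) (cos (2 * t i)) = 0) \<longrightarrow>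
           (\<forall>Y :: real^('p+'q) \<Rightarrow> real. spherical_harmonic j\<^sub>0 Y \<longrightarrow>
              (\<forall>i\<in>{1..l}. \<forall>\<xi>\<in>Xi. funk_radon (t i) Y \<xi> = 0))))"
proof -
  have CQ: "real CARD('q) / 2 - 1 = \<sigma>" and CP: "real CARD('p) / 2 - 1 = \<rho>"
    using assms(1-7) by (auto simp: of_nat_diff field_simps)
  note mu = \<open>invariant_prob_Xi \<mu>\<close>
  from mu have space: "space \<mu> = Xi" by (simp add: invariant_prob_Xi_def)
  have uniq: "AE x in sphere_measure. f x = 0"
    if "f \<in> L1_even" "\<And>t. t \<in> T \<Longrightarrow> AE \<xi> in \<mu>. funk_radon t f \<xi> = 0"
      "\<And>m. \<exists>t\<in>T. jacobi \<sigma> \<rho> m (cos (2 * t)) \<noteq> 0" for f :: "real^('p+'q) \<Rightarrow> real" and T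
    using funk_radon_uniqueness[OF mu that(1), of T] that(2,3) unfolding CQ CP by blast
  have vanish: "funk_radon t Y \<xi> = 0"
    if "even j" "jacobi \<sigma> \<rho> (j div 2) (cos (2 * t)) = 0" "spherical_harmonic j Y" "\<xi> \<in> Xi"
    for j t and Y :: "real^('p+'q) \<Rightarrow> real" and \<xi>
    using funk_radon_harmonic_zero[of "j div 2" Y t \<xi>] that unfolding CQ CP by simp
  have zero_L1: "(\<lambda>_. 0) \<in> (L1_even :: (real^('p+'q) \<Rightarrow> real) set)" by (simp add: L1_even_def)
  have part1: "(\<forall>f\<in>L1_even. \<forall>g\<in>L1_even.
            (AE \<xi> in \<mu>. funk_radon t f \<xi> = funk_radon t g \<xi>) \<longrightarrow>
            (AE x in sphere_measure. f x = g x))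
        \<longleftrightarrow> (\<forall>j. even j \<longrightarrow> jacobi \<sigma> \<rho> (j div 2) (cos (2 * t)) \<noteq> 0)" for t
  proof (intro iffI ballI impI allI notI)
    fix j :: nat
    assume inj: "\<forall>f\<in>L1_even. \<forall>g\<in>L1_even. (AE \<xi> in \<mu>. funk_radon t f \<xi> = funk_radon t g \<xi>) \<longrightarrow>
            (AE x in sphere_measure. f x = g x)"
      and j: "even j" "jacobi \<sigma> \<rho> (j div 2) (cos (2 * t)) = 0"
    obtain Y :: "real^('p+'q) \<Rightarrow> real" where Y: "spherical_harmonic (2 * (j div 2)) Y" "Y \<in> L1_even"
      "\<not> (AE x in sphere_measure. Y x = 0)"
      using nontrivial_even_harmonic by blast
    have "AE \<xi> in \<mu>. funk_radon t Y \<xi> = funk_radon t (\<lambda>_. 0) \<xi>"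
    proof (rule AE_I2)
      fix \<xi> assume "\<xi> \<in> space \<mu>"
      then have "funk_radon t Y \<xi> = 0" using Y(1) j space by (intro vanish[of j]) auto
      then show "funk_radon t Y \<xi> = funk_radon t (\<lambda>_. 0) \<xi>" by (simp add: funk_radon_def Let_def)
    qed
    with inj Y(2) zero_L1 have "AE x in sphere_measure. Y x = 0" by blast
    with Y(3) show False by simp
  next
    fix f g :: "real^('p+'q) \<Rightarrow> real"
    assume J: "\<forall>j. even j \<longrightarrow> jacobi \<sigma> \<rho> (j div 2) (cos (2 * t)) \<noteq> 0"
      and f: "f \<in> L1_even" and g: "g \<in> L1_even"
      and eq: "AE \<xi> in \<mu>. funk_radon t f \<xi> = funk_radon t g \<xi>"
    have fi: "integrable sphere_measure f" and gi: "integrable sphere_measure g"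
      using f g by (auto simp: L1_even_def)
    have h: "(\<lambda>x. f x - g x) \<in> L1_even"
      using f g by (auto simp: L1_even_def elim: eventually_elim2)
    have "AE x in sphere_measure. f x - g x = 0"
    proof (rule uniq[OF h, of "{t}"])
      have "AE \<xi> in \<mu>. funk_radon t (\<lambda>x. f x - g x) \<xi> = 0"
        using funk_radon_AE[OF mu fi, of t] funk_radon_AE[OF mu gi, of t]
          funk_radon_AE[OF mu Bochner_Integration.integrable_diff[OF fi gi], of t] eq
        by eventually_elim (simp add: right_diff_distrib)
      then show "AE \<xi> in \<mu>. funk_radon t' (\<lambda>x. f x - g x) \<xi> = 0" if "t' \<in> {t}" for t'
        using that by simp
      show "\<exists>t\<in>{t}. jacobi \<sigma> \<rho> m (cos (2 * t)) \<noteq> 0" for m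
        using J[rule_format, of "2 * m"] by simp
    qed
    then show "AE x in sphere_measure. f x = g x" by eventually_elim simp
  qed
  have part2: "AE x in sphere_measure. f x = 0"
    if none: "\<nexists>j. even j \<and> (\<forall>i\<in>{1..l}. jacobi \<sigma> \<rho> (j div 2) (cos (2 * t i)) = 0)"
      and f: "f \<in> L1_even" and zero: "\<forall>i\<in>{1..l}. AE \<xi> in \<mu>. funk_radon (t i) f \<xi> = 0"
    for l and t :: "nat \<Rightarrow> real" and f :: "real^('p+'q) \<Rightarrow> real"
  proof (rule uniq[OF f, of "t ` {1..l}"])
    show "AE \<xi> in \<mu>. funk_radon u f \<xi> = 0" if "u \<in> t ` {1..l}" for u using that zero by auto
    show "\<exists>u\<in>t ` {1..l}. jacobi \<sigma> \<rho> m (cos (2 * u)) \<noteq> 0" for m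
    proof -
      have "\<not> (\<forall>i\<in>{1..l}. jacobi \<sigma> \<rho> ((2 * m) div 2) (cos (2 * t i)) = 0)"
        using none by (metis dvd_triv_left)
      then show ?thesis by auto
    qed
  qed
  show ?thesis
  proof (intro conjI ballI allI impI, goal_cases)
    case (1 t)
    show ?case by (rule part1)
  next
    case (2 l t f)
    show ?case by (rule part2[OF 2(3-5)])
  next
    case (3 l t j Y i \<xi>)
    then show ?case by (intro vanish[of j]) blast+
  qed
qed

end
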